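(* Let $M$ be a compact two-point homogeneous space with diameter $D$. There is a countable dense set $S\subset(0,D)$ such that, for $t\in(0,D)$, the geodesic ball of radius $t$ in $M$ fails the Pompeiu property if $t\in S$ and has the Pompeiu property if $t\in(0,D)\setminus S$.
   Context: A two-point homogeneous space is a connected Riemannian manifold $M$ (of positive dimension) such that for any points $p,q,p',q'\in M$ with $d(p,q)=d(p',q')$ there is an isometry $h$ of $M$ with $h(p)=p'$ and $h(q)=q'$. The geodesic ball of radius $t$ is $B(y_0,t)=\{x\in M: d(x,y_0)<t\}$ for any point $y_0\in M$ (all such balls of the same radius are congruent under isometries). A bounded domain $\Omega\subseteq M$ has the Pompeiu property if the only continuous function $f:M\to\mathbb R$ with $\int_{h(\Omega)}f=0$ for all isometries $h$ of $M$ (integration with respect to the Riemannian measure) is $f=0$; otherwise $\Omega$ fails the Pompeiu property. *)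

theory Defs
  imports "HOL-Analysis.Analysis"
begin

section \<open>Smooth maps between Euclidean spaces\<close>

text \<open>Meaningful for open \<open>U\<close>, where the Frechet derivative is unique.\<close>

primrec Ck_on :: "nat \<Rightarrow> ('e::euclidean_space \<Rightarrow> 'f::real_normed_vector) \<Rightarrow> 'e set \<Rightarrow> bool" where
  "Ck_on 0 f U \<longleftrightarrow> continuous_on U f"
| "Ck_on (Suc k) f U \<longleftrightarrow>
     (\<forall>x\<in>U. f differentiable (at x)) \<and>
     (\<forall>v. Ck_on k (\<lambda>x. frechet_derivative f (at x) v) U)"

definition smooth_on :: "('e::euclidean_space \<Rightarrow> 'f::real_normed_vector) \<Rightarrow> 'e set \<Rightarrow> bool" where
  "smooth_on f U \<longleftrightarrow> (\<forall>k. Ck_on k f U)"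

section \<open>Smooth manifolds\<close>

text \<open>
  The manifold is the whole type \<open>'a\<close> with its class topology. Its dimension is \<open>CARD('n)\<close>, which is
  automatically positive. A chart is a pair \<open>(U, \<phi>)\<close>, where only the values of \<open>\<phi>\<close> on \<open>U\<close> matter.
\<close>

type_synonym ('a, 'n) chart = "'a set \<times> ('a \<Rightarrow> real ^ 'n)"

abbreviation cdom :: "('a, 'n) chart \<Rightarrow> 'a set" where
  "cdom c \<equiv> fst c"

abbreviation cmap :: "('a, 'n) chart \<Rightarrow> 'a \<Rightarrow> real ^ 'n" where
  "cmap c \<equiv> snd c"

definition cinv :: "('a, 'n) chart \<Rightarrow> real ^ 'n \<Rightarrow> 'a" where
  "cinv c = inv_into (cdom c) (cmap c)"

text \<open>The atlas is not required to be maximal.\<close>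

definition smooth_atlas ::
    "('a::{t2_space,second_countable_topology}, 'n::finite) chart set \<Rightarrow> bool" where
  "smooth_atlas A \<longleftrightarrow>
     (\<forall>c\<in>A. open (cdom c) \<and> open (cmap c ` cdom c) \<and>
        homeomorphism (cdom c) (cmap c ` cdom c) (cmap c) (cinv c)) \<and>
     (\<Union>c\<in>A. cdom c) = UNIV \<and>
     (\<forall>c\<in>A. \<forall>c'\<in>A. smooth_on (cmap c' \<circ> cinv c) (cmap c ` (cdom c \<inter> cdom c')))"

text \<open>The derivative at \<open>p\<close> of a map \<open>h\<close>, in the coordinates \<open>c\<close> around \<open>p\<close> and \<open>c'\<close> around \<open>h p\<close>.\<close>

definition coord_deriv ::
    "('a, 'n::finite) chart \<Rightarrow> ('a, 'n) chart \<Rightarrow> ('a \<Rightarrow> 'a) \<Rightarrow> 'a \<Rightarrow> real ^ 'n \<Rightarrow> real ^ 'n" where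
  "coord_deriv c c' h p = frechet_derivative (cmap c' \<circ> h \<circ> cinv c) (at (cmap c p))"

definition smooth_map ::
    "('a::topological_space, 'n::finite) chart set \<Rightarrow> ('a \<Rightarrow> 'a) \<Rightarrow> bool" where
  "smooth_map A h \<longleftrightarrow> continuous_on UNIV h \<and>
     (\<forall>c\<in>A. \<forall>c'\<in>A. smooth_on (cmap c' \<circ> h \<circ> cinv c) (cmap c ` (cdom c \<inter> h -` cdom c')))"

section \<open>Riemannian manifolds\<close>

text \<open>
  \<open>g c p\<close> is the inner product on the tangent space at \<open>p\<close>, written in the coordinates of the
  chart \<open>c\<close>; the last condition is the transformation law of a covariant 2-tensor.
\<close>

type_synonym ('a, 'n) metric_tensor =
  "('a, 'n) chart \<Rightarrow> 'a \<Rightarrow> real ^ 'n \<Rightarrow> real ^ 'n \<Rightarrow> real"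

definition riemannian_metric ::
    "('a::topological_space, 'n::finite) chart set \<Rightarrow> ('a, 'n) metric_tensor \<Rightarrow> bool" where
  "riemannian_metric A g \<longleftrightarrow>
     (\<forall>c\<in>A. \<forall>p\<in>cdom c. bilinear (g c p) \<and> (\<forall>u v. g c p u v = g c p v u) \<and>
        (\<forall>u. u \<noteq> 0 \<longrightarrow> g c p u u > 0)) \<and>
     (\<forall>c\<in>A. \<forall>u v. smooth_on (\<lambda>x. g c (cinv c x) u v) (cmap c ` cdom c)) \<and>
     (\<forall>c\<in>A. \<forall>c'\<in>A. \<forall>p\<in>cdom c \<inter> cdom c'. \<forall>u v.
        g c p u v = g c' p (coord_deriv c c' id p u) (coord_deriv c c' id p v))"

definition connected_riemannian_manifold ::
    "('a::{t2_space,second_countable_topology}, 'n::finite) chart set \<Rightarrow>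
     ('a, 'n) metric_tensor \<Rightarrow> bool" where
  "connected_riemannian_manifold A g \<longleftrightarrow>
     smooth_atlas A \<and> riemannian_metric A g \<and> connected (UNIV :: 'a set)"

text \<open>Riemannian isometries, i.e. diffeomorphisms preserving the metric tensor.\<close>

definition isometry ::
    "('a::topological_space, 'n::finite) chart set \<Rightarrow> ('a, 'n) metric_tensor \<Rightarrow> ('a \<Rightarrow> 'a) \<Rightarrow> bool" where
  "isometry A g h \<longleftrightarrow> bij h \<and> smooth_map A h \<and> smooth_map A (inv h) \<and>
     (\<forall>c\<in>A. \<forall>c'\<in>A. \<forall>p\<in>cdom c \<inter> h -` cdom c'. \<forall>u v.
        g c p u v = g c' (h p) (coord_deriv c c' h p u) (coord_deriv c c' h p v))"

subsection \<open>Distance\<close>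

definition piecewise_C1_curve ::
    "('a::topological_space, 'n::finite) chart set \<Rightarrow> (real \<Rightarrow> 'a) \<Rightarrow> bool" where
  "piecewise_C1_curve A \<gamma> \<longleftrightarrow> path \<gamma> \<and>
     (\<forall>c\<in>A. \<forall>a b. {a..b} \<subseteq> {0..1} \<and> \<gamma> ` {a..b} \<subseteq> cdom c \<longrightarrow>
        (cmap c \<circ> \<gamma>) piecewise_C1_differentiable_on {a..b})"

text \<open>By the transformation law, the speed does not depend on the chart chosen around \<open>\<gamma> t\<close>.\<close>

definition speed ::
    "('a, 'n::finite) chart set \<Rightarrow> ('a, 'n) metric_tensor \<Rightarrow> (real \<Rightarrow> 'a) \<Rightarrow> real \<Rightarrow> real" where
  "speed A g \<gamma> t =
     (let c = (SOME c. c \<in> A \<and> \<gamma> t \<in> cdom c);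
          v = vector_derivative (cmap c \<circ> \<gamma>) (at t)
      in sqrt (g c (\<gamma> t) v v))"

definition curve_length ::
    "('a, 'n::finite) chart set \<Rightarrow> ('a, 'n) metric_tensor \<Rightarrow> (real \<Rightarrow> 'a) \<Rightarrow> ennreal" where
  "curve_length A g \<gamma> = (\<integral>\<^sup>+t\<in>{0..1}. ennreal (speed A g \<gamma> t) \<partial>lborel)"

definition riem_dist ::
    "('a::topological_space, 'n::finite) chart set \<Rightarrow> ('a, 'n) metric_tensor \<Rightarrow> 'a \<Rightarrow> 'a \<Rightarrow> real" where
  "riem_dist A g p q =
     enn2real (INF \<gamma>\<in>{\<gamma>. piecewise_C1_curve A \<gamma> \<and> pathstart \<gamma> = p \<and> pathfinish \<gamma> = q}.
       curve_length A g \<gamma>)"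

definition riem_diameter ::
    "('a::topological_space, 'n::finite) chart set \<Rightarrow> ('a, 'n) metric_tensor \<Rightarrow> real" where
  "riem_diameter A g = (SUP (p, q)\<in>UNIV. riem_dist A g p q)"

definition geodesic_ball ::
    "('a::topological_space, 'n::finite) chart set \<Rightarrow> ('a, 'n) metric_tensor \<Rightarrow>
     'a \<Rightarrow> real \<Rightarrow> 'a set" where
  "geodesic_ball A g y t = {x. riem_dist A g x y < t}"

subsection \<open>Measure\<close>

definition gram :: "('a, 'n::finite) metric_tensor \<Rightarrow> ('a, 'n) chart \<Rightarrow> 'a \<Rightarrow> real ^ 'n ^ 'n" where
  "gram g c p = (\<chi> i j. g c p (axis i 1) (axis j 1))"

text \<open>
  The unique Borel measure with density \<open>sqrt (det (g\<^sub>i\<^sub>j))\<close> with respect to Lebesgue measure in every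
  chart. Existence and uniqueness follow from the change of variables formula and second countability.
\<close>

definition riem_measure ::
    "('a::topological_space, 'n::finite) chart set \<Rightarrow> ('a, 'n) metric_tensor \<Rightarrow> 'a measure" where
  "riem_measure A g = (THE \<mu>. sets \<mu> = sets borel \<and>
     (\<forall>c\<in>A. \<forall>B\<in>sets borel. B \<subseteq> cdom c \<longrightarrow>
        emeasure \<mu> B = (\<integral>\<^sup>+x\<in>cmap c ` B. ennreal (sqrt (det (gram g c (cinv c x)))) \<partial>lborel)))"

section \<open>Two-point homogeneous spaces and the Pompeiu property\<close>

definition two_point_homogeneous ::
    "('a::{t2_space,second_countable_topology}, 'n::finite) chart set \<Rightarrow>
     ('a, 'n) metric_tensor \<Rightarrow> bool" where
  "two_point_homogeneous A g \<longleftrightarrow> connected_riemannian_manifold A g \<and>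
     (\<forall>p q p' q'. riem_dist A g p q = riem_dist A g p' q' \<longrightarrow>
        (\<exists>h. isometry A g h \<and> h p = p' \<and> h q = q'))"

definition pompeiu_property ::
    "('a::topological_space, 'n::finite) chart set \<Rightarrow> ('a, 'n) metric_tensor \<Rightarrow> 'a set \<Rightarrow> bool" where
  "pompeiu_property A g \<Omega> \<longleftrightarrow>
     (\<forall>f :: 'a \<Rightarrow> real. continuous_on UNIV f \<longrightarrow>
        (\<forall>h. isometry A g h \<longrightarrow> (LINT x:h ` \<Omega>|riem_measure A g. f x) = 0) \<longrightarrow>
        (\<forall>x. f x = 0))"

end

theory Submission
  imports Defs "HOL-Computational_Algebra.Polynomial" "HOL-Complex_Analysis.Great_Picard"
begin

text \<open>
  Let \<open>T t f x\<close> be the integral of \<open>f\<close> over the ball of radius \<open>t\<close> around \<open>x\<close>. As the isometries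
  act transitively, the balls of radius \<open>t\<close> have the Pompeiu property if and only if the operator
  \<open>T t\<close> is injective on continuous functions. These operators are symmetric, compact and commute with
  isometries. They also commute with one another: the kernel of \<open>T s \<circ> T t\<close> at \<open>(x, z)\<close> is the volume
  of the intersection of two balls around \<open>x\<close> and \<open>z\<close> with radii \<open>s\<close> and \<open>t\<close>, and an isometry that
  exchanges \<open>x\<close> and \<open>z\<close> exchanges the radii (\<open>T_commute\<close>). Hence they have simultaneous
  eigenfunctions, and the eigenvalues of such a function form a function \<open>\<Lambda>\<close> of the radius. An
  operator \<open>T t\<close> fails to be injective exactly when \<open>\<Lambda> t = 0\<close> for one of these functions \<open>\<Lambda>\<close>
  (\<open>exceptional_radii_iff\<close>), and \<open>S\<close> is the set of all their zeros below the diameter.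

  \<open>S\<close> is countable. There are countably many functions \<open>\<Lambda>\<close>, because Bessel's inequality bounds the
  sum of \<open>(\<Lambda> t)\<^sup>2\<close> over all of them for every \<open>t\<close> (\<open>countable_spectrum\<close>). The eigenspace that belongs to
  \<open>\<Lambda>\<close> has finite dimension, and by two-point homogeneity its reproducing kernel is a function
  \<open>z (d x y)\<close> of the distance. Up to a nonzero factor, \<open>\<Lambda> t\<close> is the integral of \<open>z (d x y)\<close> over the
  ball of radius \<open>t\<close>, so a zero of \<open>\<Lambda>\<close> to which other zeros converge from the right is a zero of \<open>z\<close>
  (\<open>countable_eigenvalue_zeros\<close>). Finally \<open>z\<close> has countably many zeros: along a minimizing geodesic
  of maximal length the kernel takes the form \<open>z \<bar>s - t\<bar> = (\<Sum>i<n. F i s * F i t)\<close>, and this forces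
  the translates \<open>z \<bar>t - s\<bar>\<close> to satisfy linear differential equations with constant coefficients
  (\<open>countable_zeros_finite_rank\<close>).

  \<open>S\<close> is dense. If no \<open>\<Lambda>\<close> vanished between \<open>t1\<close> and \<open>t2\<close>, then \<open>\<Lambda> t1\<close> and \<open>\<Lambda> t2\<close> would always have the same
  sign and \<open>T t1 \<circ> T t2\<close> would be positive definite. But let \<open>f \<noteq> 0\<close> have integral zero and
  a support of diameter less than \<open>t2 - t1\<close>. Around each point of the support, \<open>T t2 f\<close> vanishes
  on the ball of radius \<open>t1\<close>, so \<open>T t1 (T t2 f)\<close> is orthogonal to \<open>f\<close>
  (\<open>exceptional_radius_between\<close>).

  This argument needs little of Riemannian geometry: the distance is a continuous metric with
  minimizing geodesics between any two points, and the measure is finite, is preserved by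
  isometries and gives balls of small radius \<open>r\<close> a volume of at least \<open>c * r ^ n\<close>. The last property makes
  spheres null sets (\<open>sphere_null\<close>), hence \<open>T t f\<close> continuous and \<open>T t\<close> compact. The locale
  \<open>homogeneous_metric_measure\<close> collects these properties. They are derived here for the infimum of the lengths of curves and for the measure with density
  \<open>sqrt (det (g\<^sub>i\<^sub>j))\<close> in charts.
\<close>

section \<open>Orthonormal systems in spaces of functions\<close>

lemma exists_linear_dependence:
  fixes c :: "'j \<Rightarrow> nat \<Rightarrow> real"
  assumes "finite J" "N < card J"
  shows "\<exists>\<alpha>. (\<exists>j\<in>J. \<alpha> j \<noteq> 0) \<and> (\<forall>i<N. (\<Sum>j\<in>J. \<alpha> j * c j i) = 0)"
  using assms
proof (induction N arbitrary: J c)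
  case 0
  then have "J \<noteq> {}" by auto
  then show ?case by (intro exI[of _ "\<lambda>_. 1"]) auto
next
  case (Suc N)
  show ?case
  proof (cases "\<forall>j\<in>J. c j N = 0")
    case True
    obtain \<alpha> where a: "\<exists>j\<in>J. \<alpha> j \<noteq> 0" "\<forall>i<N. (\<Sum>j\<in>J. \<alpha> j * c j i) = 0"
      using Suc.IH[OF Suc.prems(1)] Suc.prems(2) Suc_lessD by blast
    have "\<forall>i<Suc N. (\<Sum>j\<in>J. \<alpha> j * c j i) = 0"
      using a(2) True by (auto simp: less_Suc_eq)
    with a(1) show ?thesis by blast
  next
    case False
    then obtain p where p: "p \<in> J" "c p N \<noteq> 0" by blast
    \<comment> \<open>Eliminate the last equation with the pivot \<open>c p N\<close>.\<close>
    let ?c = "\<lambda>j i. c j i - c j N / c p N * c p i"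
    have "finite (J - {p})" "N < card (J - {p})" using Suc.prems p by auto
    from Suc.IH[OF this, of ?c] obtain \<alpha>
      where a: "\<exists>j\<in>J-{p}. \<alpha> j \<noteq> 0" "\<forall>i<N. (\<Sum>j\<in>J-{p}. \<alpha> j * ?c j i) = 0" by blast
    define \<beta> where "\<beta> = \<alpha>(p := - (\<Sum>j\<in>J-{p}. \<alpha> j * (c j N / c p N)))"
    have s: "(\<Sum>j\<in>J. \<beta> j * c j i) = (\<Sum>j\<in>J-{p}. \<alpha> j * ?c j i)" for i
    proof -
      have "(\<Sum>j\<in>J. \<beta> j * c j i) = \<beta> p * c p i + (\<Sum>j\<in>J-{p}. \<beta> j * c j i)"
        using Suc.prems(1) p(1) by (simp add: sum.remove)
      also have "(\<Sum>j\<in>J-{p}. \<beta> j * c j i) = (\<Sum>j\<in>J-{p}. \<alpha> j * c j i)"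
        by (rule sum.cong) (auto simp: \<beta>_def)
      also have "\<beta> p * c p i = - (\<Sum>j\<in>J-{p}. \<alpha> j * (c j N / c p N) * c p i)"
        by (simp add: \<beta>_def sum_distrib_right)
      finally show ?thesis by (simp add: algebra_simps sum_subtractf)
    qed
    have "\<forall>i<Suc N. (\<Sum>j\<in>J. \<beta> j * c j i) = 0"
      unfolding s using a(2) p(2) by (auto simp: less_Suc_eq)
    moreover have "\<exists>j\<in>J. \<beta> j \<noteq> 0" using a(1) by (auto simp: \<beta>_def)
    ultimately show ?thesis by blast
  qed
qed

lemma quadratic_form_Cauchy_Schwarz:
  fixes a b c :: real
  assumes "\<And>s. 0 \<le> a + 2 * s * b + s\<^sup>2 * c" "0 \<le> a" "0 \<le> c"
  shows "b\<^sup>2 \<le> a * c"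
proof (cases "c = 0")
  case True
  have "b = 0"
  proof (rule ccontr)
    assume "b \<noteq> 0"
    \<comment> \<open>This argument gives the linear function \<open>a + 2 * s * b\<close> the value \<open>-1\<close>.\<close>
    then show False using assms(1)[of "- (a + 1) / (2 * b)"] True by (simp add: field_simps)
  qed
  then show ?thesis using assms by simp
next
  case False
  then have "0 < c" using assms by simp
  have "0 \<le> a + 2 * (- b / c) * b + (- b / c)\<^sup>2 * c" by (rule assms)
  also have "\<dots> = a - b\<^sup>2 / c" using \<open>0 < c\<close> by (simp add: field_simps power2_eq_square)
  finally show ?thesis using \<open>0 < c\<close> by (simp add: field_simps)
qed

text \<open>Both the space of continuous functions with the inner product of \<open>L\<^sup>2\<close> and spaces of
  finite vectors, as functions of their index, are of this form. The elements are functions,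
  so that an expansion in an orthonormal system is an identity between values.\<close>

locale inner_function_space =
  fixes W :: "('i \<Rightarrow> real) set" and ip :: "('i \<Rightarrow> real) \<Rightarrow> ('i \<Rightarrow> real) \<Rightarrow> real"
  assumes zero_mem: "(\<lambda>x. 0) \<in> W"
    and lin_mem: "f \<in> W \<Longrightarrow> g \<in> W \<Longrightarrow> (\<lambda>x. a * f x + b * g x) \<in> W"
    and ip_lin: "f \<in> W \<Longrightarrow> g \<in> W \<Longrightarrow> h \<in> W \<Longrightarrow>
                  ip (\<lambda>x. a * f x + b * g x) h = a * ip f h + b * ip g h"
    and ip_sym: "f \<in> W \<Longrightarrow> g \<in> W \<Longrightarrow> ip f g = ip g f"
    and ip_nonneg: "f \<in> W \<Longrightarrow> 0 \<le> ip f f"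
    and ip_definite: "f \<in> W \<Longrightarrow> ip f f = 0 \<Longrightarrow> f = (\<lambda>x. 0)"
begin

definition orthonormal :: "(nat \<Rightarrow> 'i \<Rightarrow> real) \<Rightarrow> nat \<Rightarrow> bool" where
  "orthonormal e n \<longleftrightarrow> (\<forall>i<n. e i \<in> W \<and> (\<forall>j<n. ip (e i) (e j) = (if i = j then 1 else 0)))"

lemma scale_mem: "f \<in> W \<Longrightarrow> (\<lambda>x. a * f x) \<in> W"
  using lin_mem[of f f a 0] by simp

lemma diff_mem: "f \<in> W \<Longrightarrow> g \<in> W \<Longrightarrow> (\<lambda>x. f x - g x) \<in> W"
  using lin_mem[of f g 1 "-1"] by simp

lemma ip_scale: "f \<in> W \<Longrightarrow> h \<in> W \<Longrightarrow> ip (\<lambda>x. a * f x) h = a * ip f h"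
  using ip_lin[of f f h a 0] by simp

lemma ip_diff: "f \<in> W \<Longrightarrow> g \<in> W \<Longrightarrow> h \<in> W \<Longrightarrow> ip (\<lambda>x. f x - g x) h = ip f h - ip g h"
  using ip_lin[of f g h 1 "-1"] by simp

lemma ip_zero: "h \<in> W \<Longrightarrow> ip (\<lambda>x. 0) h = 0"
  using ip_lin[of h h h 0 0] by simp

lemma sum_mem: "\<forall>i<(n::nat). e i \<in> W \<Longrightarrow> (\<lambda>x. \<Sum>i<n. a i * e i x) \<in> W"
proof (induction n)
  case 0 then show ?case by (simp add: zero_mem)
next
  case (Suc n)
  then have "(\<lambda>x. 1 * (\<Sum>i<n. a i * e i x) + a n * e n x) \<in> W"
    by (intro lin_mem) auto
  then show ?case by simp
qed

lemma ip_sum: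
  "\<forall>i<(n::nat). e i \<in> W \<Longrightarrow> h \<in> W \<Longrightarrow> ip (\<lambda>x. \<Sum>i<n. a i * e i x) h = (\<Sum>i<n. a i * ip (e i) h)"
proof (induction n)
  case 0 then show ?case by (simp add: ip_zero)
next
  case (Suc n)
  then have "ip (\<lambda>x. 1 * (\<Sum>i<n. a i * e i x) + a n * e n x) h
      = 1 * ip (\<lambda>x. \<Sum>i<n. a i * e i x) h + a n * ip (e n) h"
    by (intro ip_lin sum_mem) auto
  with Suc show ?case by simp
qed

lemma ip_sum_orthonormal:
  assumes "orthonormal e n" "j < n"
  shows "ip (\<lambda>x. \<Sum>i<n. a i * e i x) (e j) = a j"
proof -
  have "ip (\<lambda>x. \<Sum>i<n. a i * e i x) (e j) = (\<Sum>i<n. a i * ip (e i) (e j))"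
    using assms by (intro ip_sum) (auto simp: orthonormal_def)
  also have "\<dots> = (\<Sum>i<n. if i = j then a i else 0)"
    using assms by (intro sum.cong) (auto simp: orthonormal_def)
  finally show ?thesis using assms by simp
qed

lemma ip_sum_self:
  assumes "orthonormal e n"
  shows "ip (\<lambda>x. \<Sum>i<n. a i * e i x) (\<lambda>x. \<Sum>i<n. a i * e i x) = (\<Sum>i<n. (a i)\<^sup>2)"
proof -
  let ?s = "\<lambda>x. \<Sum>i<n. a i * e i x"
  have e: "\<forall>i<n. e i \<in> W" using assms by (auto simp: orthonormal_def)
  have "ip ?s ?s = (\<Sum>i<n. a i * ip (e i) ?s)" by (rule ip_sum[OF e sum_mem[OF e]])
  also have "\<dots> = (\<Sum>i<n. (a i)\<^sup>2)"
    using e ip_sum_orthonormal[OF assms, of _ a] ip_sym[OF _ sum_mem[OF e]]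
    by (intro sum.cong) (auto simp: power2_eq_square)
  finally show ?thesis .
qed

lemma residual_orthogonal:
  assumes "orthonormal e n" "f \<in> W" "j < n"
  shows "ip (\<lambda>x. f x - (\<Sum>i<n. ip f (e i) * e i x)) (e j) = 0"
proof -
  have e: "\<forall>i<n. e i \<in> W" using assms by (auto simp: orthonormal_def)
  show ?thesis
    using e assms(3)
    by (subst ip_diff[OF assms(2) sum_mem[OF e]]) (auto simp: ip_sum_orthonormal[OF assms(1,3)])
qed

lemma positive_form_Cauchy_Schwarz:
  assumes Q: "\<And>f. f \<in> W \<Longrightarrow> Q f \<in> W"
    and lin: "\<And>f g a b. f \<in> W \<Longrightarrow> g \<in> W \<Longrightarrow>
                Q (\<lambda>x. a * f x + b * g x) = (\<lambda>x. a * Q f x + b * Q g x)"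
    and sym: "\<And>f g. f \<in> W \<Longrightarrow> g \<in> W \<Longrightarrow> ip (Q f) g = ip f (Q g)"
    and pos: "\<And>f. f \<in> W \<Longrightarrow> 0 \<le> ip (Q f) f"
    and f: "f \<in> W" and g: "g \<in> W"
  shows "(ip (Q f) g)\<^sup>2 \<le> ip (Q f) f * ip (Q g) g"
proof (rule quadratic_form_Cauchy_Schwarz)
  fix s
  let ?v = "\<lambda>x. 1 * f x + s * g x"
  have v: "?v \<in> W" by (rule lin_mem[OF f g])
  have half: "ip (Q h) ?v = ip (Q h) f + s * ip (Q h) g" if h: "h \<in> W" for h
    using ip_lin[OF f g Q[OF h], of 1 s] ip_sym[OF _ Q[OF h]] f g v by simp
  have "0 \<le> ip (Q ?v) ?v" by (rule pos[OF v])
  also have "\<dots> = ip (Q f) ?v + s * ip (Q g) ?v"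
    unfolding lin[OF f g] using ip_lin[OF Q[OF f] Q[OF g] v, of 1 s] by simp
  also have "\<dots> = ip (Q f) f + 2 * s * ip (Q f) g + s\<^sup>2 * ip (Q g) g"
    using half[OF f] half[OF g] sym[OF g f] ip_sym[OF g Q[OF f]]
    by (simp add: algebra_simps power2_eq_square)
  finally show "0 \<le> ip (Q f) f + 2 * s * ip (Q f) g + s\<^sup>2 * ip (Q g) g" .
qed (use pos f g in auto)

text \<open>A bound on point evaluations bounds the diagonal of the kernel of any orthonormal system:
  test the bound on \<open>\<Sum>i. e i x * e i\<close>.\<close>

lemma orthonormal_diagonal_le:
  assumes "orthonormal e n" "0 \<le> C" and ev: "\<And>f. f \<in> W \<Longrightarrow> (f x)\<^sup>2 \<le> C * ip f f"
  shows "(\<Sum>i<n. (e i x)\<^sup>2) \<le> C"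
proof -
  let ?s = "\<Sum>i<n. (e i x)\<^sup>2"
  have "(\<lambda>y. \<Sum>i<n. e i x * e i y) \<in> W"
    using assms by (intro sum_mem) (auto simp: orthonormal_def)
  from ev[OF this] have "?s\<^sup>2 \<le> C * ?s"
    by (simp add: ip_sum_self[OF assms(1)]) (simp add: power2_eq_square)
  moreover have "?s \<ge> 0" by (intro sum_nonneg) auto
  ultimately show ?thesis
    by (metis assms(2) mult_le_cancel_right power2_eq_square order_le_less not_less)
qed

text \<open>An orthonormal system of maximal size is a basis, since otherwise a normalised residual
  would extend it.\<close>

lemma maximal_orthonormal_expansion:
  assumes on: "orthonormal e n" and max: "\<And>e' n'. orthonormal e' n' \<Longrightarrow> n' \<le> n" and f: "f \<in> W"
  shows "f x = (\<Sum>i<n. ip f (e i) * e i x)"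
proof (rule ccontr)
  define r where "r = (\<lambda>x. f x - (\<Sum>i<n. ip f (e i) * e i x))"
  assume "f x \<noteq> (\<Sum>i<n. ip f (e i) * e i x)"
  then have "r \<noteq> (\<lambda>x. 0)" by (auto simp: r_def fun_eq_iff)
  have e: "\<forall>i<n. e i \<in> W" using on by (auto simp: orthonormal_def)
  have r: "r \<in> W" unfolding r_def by (intro diff_mem f sum_mem e)
  have orth: "j < n \<Longrightarrow> ip r (e j) = 0" for j
    unfolding r_def by (rule residual_orthogonal[OF on f])
  have pos: "ip r r > 0" using ip_nonneg[OF r] ip_definite[OF r] \<open>r \<noteq> _\<close> by fastforce
  define u where "u = (\<lambda>x. (1 / sqrt (ip r r)) * r x)"
  have u: "u \<in> W" unfolding u_def by (rule scale_mem[OF r])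
  have uh: "h \<in> W \<Longrightarrow> ip u h = (1 / sqrt (ip r r)) * ip r h" for h
    unfolding u_def by (rule ip_scale[OF r])
  have uu: "ip u u = 1"
    using pos uh[OF u] ip_sym[OF r u] uh[OF r] by (simp add: field_simps)
  have "orthonormal (e(n := u)) (Suc n)"
    using on u uu e orth uh ip_sym[OF u] unfolding orthonormal_def by (auto simp: less_Suc_eq)
  with max show False by fastforce
qed

lemma exists_maximal_orthonormal:
  assumes "\<And>e n. orthonormal e n \<Longrightarrow> n \<le> K"
  obtains e n where "orthonormal e n" "\<And>e' n'. orthonormal e' n' \<Longrightarrow> n' \<le> n"
proof -
  have "\<exists>e. orthonormal e 0" by (auto simp: orthonormal_def)
  then have "\<exists>e. orthonormal e (GREATEST n. \<exists>e. orthonormal e n)"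
    by (rule GreatestI_nat[where b = K]) (auto dest: assms)
  moreover have "n' \<le> (GREATEST n. \<exists>e. orthonormal e n)" if "orthonormal e' n'" for e' n'
    using that by (intro Greatest_le_nat[where b = K]) (auto dest: assms)
  ultimately show ?thesis using that by blast
qed

end

section \<open>Linear differential equations\<close>

text \<open>The sum \<open>w\<close> of the squares of \<open>y 0, \<dots>, y (m - 1)\<close> satisfies \<open>\<bar>w'\<bar> \<le> C * w\<close>. Hence
  \<open>w * exp (- C t)\<close> decreases to the right of \<open>t0\<close> and \<open>w * exp (C t)\<close> increases to its left,
  and \<open>w\<close> cannot leave the value zero.\<close>

lemma linear_ode_unique:
  fixes y :: "nat \<Rightarrow> real \<Rightarrow> real"
  assumes der: "\<And>j t. j < m \<Longrightarrow> t \<in> {a<..<b} \<Longrightarrow> (y j has_real_derivative y (Suc j) t) (at t)"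
    and ode: "\<And>t. t \<in> {a<..<b} \<Longrightarrow> y m t = (\<Sum>j<m. \<beta> j * y j t)"
    and t0: "t0 \<in> {a<..<b}" and init: "\<And>j. j < m \<Longrightarrow> y j t0 = 0" and t: "t \<in> {a<..<b}"
  shows "y 0 t = 0"
proof -
  define w where "w t = (\<Sum>j<m. (y j t)\<^sup>2)" for t
  define w' where "w' t = (\<Sum>j<m. 2 * y j t * y (Suc j) t)" for t
  define B where "B = (\<Sum>j<m. (\<beta> j)\<^sup>2)"
  define C where "C = real m * (2 + B)"
  have B0: "B \<ge> 0" unfolding B_def by (intro sum_nonneg) auto
  have wder: "(w has_real_derivative w' t) (at t)" if "t \<in> {a<..<b}" for t
    unfolding w_def w'_def
    by (rule derivative_eq_intros der that refl | simp add: that | rule sum.cong)+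
  have w0: "w t \<ge> 0" for t unfolding w_def by (intro sum_nonneg) auto
  have yk: "(y k t)\<^sup>2 \<le> (1 + B) * w t" if "t \<in> {a<..<b}" "k \<le> m" for k t
  proof (cases "k = m")
    case True
    have "(y m t)\<^sup>2 \<le> B * w t"
      unfolding ode[OF that(1)] B_def w_def by (rule Cauchy_Schwarz_ineq_sum)
    with True w0[of t] show ?thesis by (simp add: algebra_simps)
  next
    case False
    then have "(y k t)\<^sup>2 \<le> w t" unfolding w_def using that by (intro member_le_sum) auto
    with B0 w0[of t] show ?thesis by (simp add: algebra_simps add_increasing2)
  qed
  have w'bd: "\<bar>w' t\<bar> \<le> C * w t" if t: "t \<in> {a<..<b}" for t
  proof -
    have "\<bar>w' t\<bar> \<le> (\<Sum>j<m. \<bar>2 * y j t * y (Suc j) t\<bar>)" unfolding w'_def by (rule sum_abs)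
    also have "\<dots> \<le> (\<Sum>j<m. (2 + B) * w t)"
    proof (rule sum_mono)
      fix j assume j: "j \<in> {..<m}"
      have "\<bar>2 * y j t * y (Suc j) t\<bar> \<le> (y j t)\<^sup>2 + (y (Suc j) t)\<^sup>2"
        using sum_squares_bound[of "\<bar>y j t\<bar>" "\<bar>y (Suc j) t\<bar>"] by (simp add: abs_mult)
      moreover have "(y j t)\<^sup>2 \<le> w t" unfolding w_def using j by (intro member_le_sum) auto
      moreover have "(y (Suc j) t)\<^sup>2 \<le> (1 + B) * w t" using yk[OF t] j by auto
      ultimately show "\<bar>2 * y j t * y (Suc j) t\<bar> \<le> (2 + B) * w t" by (simp add: algebra_simps)
    qed
    also have "\<dots> = C * w t" by (simp add: C_def)
    finally show ?thesis .
  qed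
  have wt0: "w t0 = 0" by (simp add: w_def init)
  have "w t \<le> 0"
  proof (cases "t0 \<le> t")
    case True
    have "w t * exp (- C * t) \<le> w t0 * exp (- C * t0)"
    proof (rule DERIV_nonpos_imp_nonincreasing[OF True])
      fix x assume "t0 \<le> x" "x \<le> t"
      then have x: "x \<in> {a<..<b}" using t0 t by auto
      have "((\<lambda>t. w t * exp (- C * t)) has_real_derivative (w' x - C * w x) * exp (- C * x)) (at x)"
        by (rule derivative_eq_intros wder[OF x] refl | simp add: algebra_simps)+
      moreover have "(w' x - C * w x) * exp (- C * x) \<le> 0"
        using w'bd[OF x] by (intro mult_nonpos_nonneg) auto
      ultimately show "\<exists>y. ((\<lambda>t. w t * exp (- C * t)) has_real_derivative y) (at x) \<and> y \<le> 0" by blast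
    qed
    then show ?thesis using wt0 by (simp add: mult_le_0_iff)
  next
    case False
    then have le: "t \<le> t0" by simp
    have "w t * exp (C * t) \<le> w t0 * exp (C * t0)"
    proof (rule DERIV_nonneg_imp_nondecreasing[OF le])
      fix x assume "t \<le> x" "x \<le> t0"
      then have x: "x \<in> {a<..<b}" using t0 t by auto
      have "((\<lambda>t. w t * exp (C * t)) has_real_derivative (w' x + C * w x) * exp (C * x)) (at x)"
        by (rule derivative_eq_intros wder[OF x] refl | simp add: algebra_simps)+
      moreover have "(w' x + C * w x) * exp (C * x) \<ge> 0"
        using w'bd[OF x] by (intro mult_nonneg_nonneg) auto
      ultimately show "\<exists>y. ((\<lambda>t. w t * exp (C * t)) has_real_derivative y) (at x) \<and> y \<ge> 0" by blast
    qed
    then show ?thesis using wt0 by (simp add: mult_le_0_iff)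
  qed
  show ?thesis
  proof (cases "m = 0")
    case True then show ?thesis using ode[OF t] by simp
  next
    case False
    then have "(y 0 t)\<^sup>2 \<le> w t" unfolding w_def by (intro member_le_sum) auto
    with \<open>w t \<le> 0\<close> show ?thesis by (metis dual_order.trans power2_eq_iff power2_less_eq_zero_iff zero_eq_power2)
  qed
qed

text \<open>By Rolle's theorem there is a zero of the derivative between the limit point and any zero
  near it.\<close>

lemma zeros_accumulate_derivative:
  fixes f f' :: "real \<Rightarrow> real"
  assumes der: "\<And>t. t \<in> {a<..<b} \<Longrightarrow> (f has_real_derivative f' t) (at t)"
    and t0: "t0 \<in> {a<..<b}" and lim: "t0 islimpt {t\<in>{a<..<b}. f t = 0}"
  shows "f t0 = 0" "t0 islimpt {t\<in>{a<..<b}. f' t = 0}"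
proof -
  have cont: "continuous_on {a<..<b} f"
    using der by (meson DERIV_isCont continuous_at_imp_continuous_on)
  show f0: "f t0 = 0"
  proof (rule ccontr)
    assume "f t0 \<noteq> 0"
    then have m: "t0 \<in> {a<..<b} \<inter> f -` (- {0})" using t0 by auto
    have o: "open ({a<..<b} \<inter> f -` (- {0}))"
      by (rule continuous_open_preimage[OF cont]) auto
    show False
      by (rule islimptE[OF lim m o]) auto
  qed
  have "\<exists>z\<in>{t\<in>{a<..<b}. f' t = 0}. z \<noteq> t0 \<and> dist z t0 < e" if e: "e > 0" for e :: real
  proof -
    obtain x where x: "a < x" "x < b" "f x = 0" "x \<noteq> t0" "dist x t0 < e"
      using lim[unfolded islimpt_approachable, rule_format, OF e] by auto
    define l where "l = min x t0" define u where "u = max x t0"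
    have lu: "l < u" "a < l" "u < b" "f l = f u"
      using x t0 f0 by (auto simp: l_def u_def min_def max_def)
    have "\<exists>z>l. z < u \<and> (\<lambda>v. f' z * v) = (\<lambda>v. 0)"
    proof (rule Rolle_deriv[OF lu(1,4)])
      show "continuous_on {l..u} f" using lu by (intro continuous_on_subset[OF cont]) auto
      show "(f has_derivative (\<lambda>v. f' z * v)) (at z)" if "l < z" "z < u" for z
        using der[of z] lu that by (simp add: has_field_derivative_def)
    qed
    then obtain z where z: "l < z" "z < u" "(\<lambda>v. f' z * v) = (\<lambda>v. 0)" by blast
    from fun_cong[OF z(3), of 1] have "f' z = 0" by simp
    moreover have "dist z t0 < e" "z \<noteq> t0"
      using z(1,2) x by (auto simp: l_def u_def dist_real_def min_def max_def split: if_splits)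
    ultimately show ?thesis using lu z by (intro bexI[of _ z]) auto
  qed
  then show "t0 islimpt {t\<in>{a<..<b}. f' t = 0}" unfolding islimpt_approachable by blast
qed

text \<open>Accumulating zeros pass to every derivative by Rolle's theorem, and then the initial data
  vanish at the accumulation point.\<close>

lemma linear_ode_countable_zeros:
  fixes y :: "nat \<Rightarrow> real \<Rightarrow> real"
  assumes der: "\<And>j t. j < m \<Longrightarrow> t \<in> {a<..<b} \<Longrightarrow> (y j has_real_derivative y (Suc j) t) (at t)"
    and ode: "\<And>t. t \<in> {a<..<b} \<Longrightarrow> y m t = (\<Sum>j<m. \<beta> j * y j t)"
    and s: "s \<in> {a<..<b}" "y 0 s \<noteq> 0"
  shows "countable {t\<in>{a<..<b}. y 0 t = 0}"
proof -
  let ?Z = "\<lambda>j. {t\<in>{a<..<b}. y j t = 0}"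
  have m: "m \<noteq> 0" using ode[OF s(1)] s(2) by (intro notI) simp
  have noacc: "\<not> t0 islimpt ?Z 0" if t0: "t0 \<in> {a<..<b}" for t0
  proof
    assume lim: "t0 islimpt ?Z 0"
    have step: "j < m \<Longrightarrow> t0 islimpt ?Z j" for j
    proof (induction j)
      case (Suc j)
      then show ?case using zeros_accumulate_derivative(2)[of a b "y j" "y (Suc j)"] der t0
        by (meson Suc_lessD)
    qed (rule lim)
    have "j < m \<Longrightarrow> y j t0 = 0" for j
      using zeros_accumulate_derivative(1)[of a b "y j" "y (Suc j)"] der t0 step by blast
    from linear_ode_unique[OF der ode t0 this s(1)] s(2) show False by blast
  qed
  \<comment> \<open>The open interval may contain infinitely many zeros, but compact parts of it contain
    finitely many.\<close>
  have fin: "finite (?Z 0 \<inter> {a + 1 / Suc n .. b - 1 / Suc n})" for n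
  proof (rule ccontr)
    assume "infinite (?Z 0 \<inter> {a + 1 / Suc n .. b - 1 / Suc n})"
    then obtain t0 where "t0 \<in> {a + 1 / Suc n .. b - 1 / Suc n}"
      "t0 islimpt (?Z 0 \<inter> {a + 1 / Suc n .. b - 1 / Suc n})"
      using compact_eq_Bolzano_Weierstrass[of "{a + 1 / Suc n .. b - 1 / Suc n}"] by auto
    moreover from calculation have "t0 \<in> {a<..<b}"
      by (smt (verit) atLeastAtMost_iff divide_pos_pos greaterThanLessThan_iff of_nat_0_less_iff zero_less_Suc)
    ultimately show False using noacc islimpt_subset by blast
  qed
  have "?Z 0 \<subseteq> (\<Union>n. ?Z 0 \<inter> {a + 1 / Suc n .. b - 1 / Suc n})"
  proof
    fix t assume t: "t \<in> ?Z 0"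
    then have "0 < min (t - a) (b - t)" by auto
    then obtain n where "1 / real (Suc n) < min (t - a) (b - t)"
      using nat_approx_posE by blast
    then show "t \<in> (\<Union>n. ?Z 0 \<inter> {a + 1 / Suc n .. b - 1 / Suc n})"
      using t by (intro UN_I[of n]) auto
  qed
  moreover have "countable (\<Union>n. ?Z 0 \<inter> {a + 1 / Suc n .. b - 1 / Suc n})"
    by (intro countable_UN[OF countableI_type] countable_finite fin)
  ultimately show ?thesis by (rule countable_subset)
qed

section \<open>Kernels of finite rank\<close>

text \<open>The vectors \<open>\<integral> F * \<eta>\<close> with polynomial multiples \<open>\<eta>\<close> of \<open>p\<close> form a subspace. If \<open>F s\<close> were
  not in it, its component \<open>v\<close> orthogonal to the subspace would be nonzero. The function
  \<open>\<Sum>i<N. v i * F i\<close> is then orthogonal to all \<open>\<eta>\<close>, so it vanishes where \<open>p\<close> does not, by the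
  Weierstrass theorem. At \<open>s\<close> its value is the inner product of \<open>v\<close> and \<open>F s\<close>, which is the square
  of the norm of \<open>v\<close>.\<close>

lemma point_value_as_weighted_integral:
  fixes F :: "nat \<Rightarrow> real \<Rightarrow> real" and p :: "real poly"
  assumes F: "\<And>i. i < N \<Longrightarrow> continuous_on {a..b} (F i)"
    and s: "s \<in> {a<..<b}" and p: "poly p s \<noteq> 0"
  shows "\<exists>q. \<forall>i<N. F i s = integral {a..b} (\<lambda>t. F i t * poly (p * q) t)"
proof -
  define L where "L q = (\<lambda>i. if i < N then integral {a..b} (\<lambda>t. F i t * poly (p * q) t) else 0)" for q
  define ip where "ip u v = (\<Sum>i<N. u i * v i)" for u v :: "nat \<Rightarrow> real"
  have int: "(\<lambda>t. F i t * poly r t) integrable_on {a..b}" if "i < N" for i r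
    using F[OF that] by (intro integrable_continuous_interval continuous_intros) auto
  have Llin: "L (smult c q + smult c' q') = (\<lambda>i. c * L q i + c' * L q' i)" for c c' q q'
  proof
    fix i
    show "L (smult c q + smult c' q') i = c * L q i + c' * L q' i"
    proof (cases "i < N")
      case True
      have "integral {a..b} (\<lambda>t. F i t * poly (p * (smult c q + smult c' q')) t)
          = integral {a..b} (\<lambda>t. c * (F i t * poly (p * q) t) + c' * (F i t * poly (p * q') t))"
        by (rule arg_cong[where f = "integral _"]) (auto simp: algebra_simps)
      also have "\<dots> = c * integral {a..b} (\<lambda>t. F i t * poly (p * q) t)
                     + c' * integral {a..b} (\<lambda>t. F i t * poly (p * q') t)"
        using int[OF True]
        by (subst integral_add) (auto intro: integrable_on_mult_right simp del: poly_mult)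
      finally show ?thesis using True by (simp add: L_def)
    qed (simp add: L_def)
  qed
  have zero: "ip f f = 0 \<Longrightarrow> f = (\<lambda>i. 0)" if "f \<in> range L" for f
  proof -
    assume "ip f f = 0"
    then have "\<forall>i<N. f i * f i = 0"
      unfolding ip_def by (subst (asm) sum_nonneg_eq_0_iff) auto
    then show ?thesis using that by (auto simp: L_def fun_eq_iff)
  qed
  interpret inner_function_space "range L" ip
  proof
    have "L 0 = (\<lambda>x. 0)" by (simp add: L_def fun_eq_iff)
    then show "(\<lambda>x. 0) \<in> range L" by (metis rangeI)
    show "(\<lambda>x. c * f x + c' * g x) \<in> range L" if fg: "f \<in> range L" "g \<in> range L" for f g c c'
    proof -
      from fg obtain q q' where "f = L q" "g = L q'" by blast
      then show ?thesis using Llin[of c q c' q', symmetric] by simp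
    qed
    show "ip (\<lambda>x. c * f x + c' * g x) h = c * ip f h + c' * ip g h" for f g h c c'
      by (simp add: ip_def distrib_right sum.distrib sum_distrib_left mult.assoc)
    show "ip f g = ip g f" for f g by (simp add: ip_def mult.commute)
    show "0 \<le> ip f f" for f by (auto simp: ip_def intro: sum_nonneg)
  qed (use zero in blast)
  have "n \<le> N" if on: "orthonormal e n" for e n
  proof -
    have "(\<Sum>k<n. (e k i)\<^sup>2) \<le> 1" if "i < N" for i
    proof (rule orthonormal_diagonal_le[OF on])
      fix f assume "f \<in> range L"
      show "(f i)\<^sup>2 \<le> 1 * ip f f"
        using member_le_sum[of i "{..<N}" "\<lambda>i. f i * f i"] that
        by (auto simp: ip_def power2_eq_square)
    qed auto
    then have "(\<Sum>i<N. \<Sum>k<n. (e k i)\<^sup>2) \<le> (\<Sum>i<N. 1)" by (intro sum_mono) auto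
    moreover have "(\<Sum>i<N. \<Sum>k<n. (e k i)\<^sup>2) = (\<Sum>k<n. ip (e k) (e k))"
      unfolding ip_def by (subst sum.swap) (simp add: power2_eq_square)
    moreover have "(\<Sum>k<n. ip (e k) (e k)) = real n"
      using on by (simp add: orthonormal_def)
    ultimately show ?thesis by simp
  qed
  then obtain e n where on: "orthonormal e n" and max: "\<And>e' n'. orthonormal e' n' \<Longrightarrow> n' \<le> n"
    using exists_maximal_orthonormal by metis
  have eL: "k < n \<Longrightarrow> e k \<in> range L" for k using on by (auto simp: orthonormal_def)
  \<comment> \<open>The vector \<open>F s\<close> and its component \<open>v\<close> orthogonal to \<open>range L\<close>.\<close>
  define P where "P i = (if i < N then F i s else 0)" for i
  define v where "v = (\<lambda>i. P i - (\<Sum>k<n. ip P (e k) * e k i))"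
  have ip_comb: "ip (\<lambda>i. \<Sum>k<n. c k * e k i) f = (\<Sum>k<n. c k * ip (e k) f)" for c f
    unfolding ip_def sum_distrib_left sum_distrib_right by (subst sum.swap) (simp add: mult.assoc)
  have ipv: "ip v f = ip P f - (\<Sum>k<n. ip P (e k) * ip (e k) f)" for f
    unfolding ip_comb[symmetric] by (simp add: ip_def v_def left_diff_distrib sum_subtractf)
  have vorth: "ip v f = 0" if f: "f \<in> range L" for f
  proof -
    have "f = (\<lambda>i. \<Sum>k<n. ip f (e k) * e k i)"
      by (rule ext, rule maximal_orthonormal_expansion[OF on _ f]) (rule max)
    then have "ip P f = ip (\<lambda>i. \<Sum>k<n. ip f (e k) * e k i) P"
      by (simp add: ip_def mult.commute)
    also have "\<dots> = (\<Sum>k<n. ip P (e k) * ip (e k) f)"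
      unfolding ip_comb by (simp add: ip_def mult.commute)
    finally show ?thesis by (simp add: ipv)
  qed
  define f where "f t = (\<Sum>i<N. v i * F i t)" for t
  have fc: "continuous_on {a..b} f" unfolding f_def using F by (intro continuous_intros) auto
  have f_orth: "integral {a..b} (\<lambda>t. f t * poly p t * poly q t) = 0" for q
  proof -
    have "integral {a..b} (\<lambda>t. f t * poly p t * poly q t)
        = integral {a..b} (\<lambda>t. \<Sum>i<N. v i * (F i t * poly (p * q) t))"
      by (rule arg_cong[where f = "integral _"]) (simp add: f_def fun_eq_iff sum_distrib_left mult_ac)
    also have "\<dots> = (\<Sum>i<N. v i * integral {a..b} (\<lambda>t. F i t * poly (p * q) t))"
      using int by (subst integral_sum) (simp_all only: finite_lessThan lessThan_iff
          integrable_on_mult_right integral_mult_right)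
    also have "\<dots> = ip v (L q)" by (simp add: ip_def L_def)
    finally show ?thesis using vorth by simp
  qed
  define h where "h t = f t * poly p t" for t
  have hc: "continuous_on {a..b} h" unfolding h_def
    by (rule continuous_on_mult[OF fc continuous_on_poly[OF continuous_on_id]])
  \<comment> \<open>\<open>h\<close> is orthogonal to all polynomials, and polynomials approximate \<open>h\<close> itself.\<close>
  have hh: "integral {a..b} (\<lambda>t. h t * h t) = 0"
  proof -
    have "\<bar>integral {a..b} (\<lambda>t. h t * h t)\<bar> \<le> e * integral {a..b} (\<lambda>t. \<bar>h t\<bar>)" if "e > 0" for e
    proof -
      obtain g where g: "real_polynomial_function g" "\<And>x. x \<in> {a..b} \<Longrightarrow> \<bar>h x - g x\<bar> < e"
        using Stone_Weierstrass_real_polynomial_function[OF compact_Icc hc \<open>e > 0\<close>] by metis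
      obtain c m where gp: "g = (\<lambda>x. \<Sum>i\<le>m. c i * x ^ i)"
        using g(1) unfolding real_polynomial_function_iff_sum by blast
      define q where "q = (\<Sum>i\<le>m. monom (c i) i)"
      have q: "g x = poly q x" for x by (simp add: gp q_def poly_sum poly_monom)
      have i1: "(\<lambda>t. h t * poly q t) integrable_on {a..b}" "(\<lambda>t. h t * h t) integrable_on {a..b}"
        "(\<lambda>t. \<bar>h t\<bar>) integrable_on {a..b}"
        using hc by (auto intro!: integrable_continuous_interval continuous_intros)
      have "integral {a..b} (\<lambda>t. h t * h t)
          = integral {a..b} (\<lambda>t. h t * h t) - integral {a..b} (\<lambda>t. h t * poly q t)"
        using f_orth[of q] by (simp add: h_def)
      also have "\<dots> = integral {a..b} (\<lambda>t. h t * (h t - poly q t))"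
        using i1 by (subst integral_diff[symmetric]) (auto simp: algebra_simps)
      also have "\<bar>\<dots>\<bar> \<le> integral {a..b} (\<lambda>t. e * \<bar>h t\<bar>)"
        unfolding real_norm_def[symmetric]
      proof (rule integral_norm_bound_integral)
        show "(\<lambda>t. h t * (h t - poly q t)) integrable_on {a..b}"
          using hc by (intro integrable_continuous_interval continuous_intros)
        show "(\<lambda>t. e * norm (h t)) integrable_on {a..b}"
          using i1 by (auto intro: integrable_on_mult_right)
        fix x assume "x \<in> {a..b}"
        then show "norm (h x * (h x - poly q x)) \<le> e * norm (h x)"
          using mult_right_mono[of "\<bar>h x - poly q x\<bar>" e "\<bar>h x\<bar>"] g(2)[of x]
          by (simp add: q abs_mult mult.commute)
      qed
      finally show ?thesis by (simp only: integral_mult_right)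
    qed
    note bound = this
    define H where "H = integral {a..b} (\<lambda>t. \<bar>h t\<bar>)"
    have *: "\<bar>integral {a..b} (\<lambda>t. h t * h t)\<bar> \<le> e * H" if "e > 0" for e
      using bound[OF that] by (simp add: H_def)
    have "(\<lambda>t. \<bar>h t\<bar>) integrable_on {a..b}"
      by (rule integrable_continuous_interval[OF continuous_on_rabs[OF hc]])
    then have H0: "H \<ge> 0" unfolding H_def by (rule integral_nonneg) auto
    show ?thesis
    proof (rule ccontr)
      assume "integral {a..b} (\<lambda>t. h t * h t) \<noteq> 0"
      then have J: "\<bar>integral {a..b} (\<lambda>t. h t * h t)\<bar> > 0" (is "?J > 0") by simp
      then have "?J / (2 * (H + 1)) > 0" using H0 by auto
      from *[OF this] have "?J * (2 * (H + 1)) \<le> ?J * H"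
        using H0 by (simp add: pos_le_divide_eq)
      then show False using J H0 by (simp add: mult_le_cancel_left_pos)
    qed
  qed
  have "h s * h s = 0"
  proof -
    have c: "continuous_on {a..b} (\<lambda>t. h t * h t)" by (rule continuous_on_mult[OF hc hc])
    have "((\<lambda>t. h t * h t) has_integral 0) (cbox a b)"
      unfolding has_integral_iff cbox_interval
      using hh integrable_continuous_interval[OF c] by blast
    moreover have "\<And>x. x \<in> cbox a b \<Longrightarrow> 0 \<le> h x * h x" by auto
    moreover have "continuous_on (cbox a b) (\<lambda>t. h t * h t)" using c by simp
    moreover have "s \<in> cbox a b" "box a b \<noteq> {}" using s by auto
    ultimately show ?thesis
      by (intro has_integral_0_cbox_imp_0[of a b "\<lambda>t. h t * h t" s]) auto
  qed
  then have "f s = 0" using p by (simp add: h_def)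
  then have vP: "ip v P = 0" by (simp add: f_def ip_def P_def)
  have vv: "ip v v = 0"
  proof -
    have "ip v v = ip P v - (\<Sum>k<n. ip P (e k) * ip (e k) v)" by (rule ipv)
    moreover have "ip f v = ip v f" for f by (simp add: ip_def mult.commute)
    then have "ip P v = 0" "\<And>k. k < n \<Longrightarrow> ip (e k) v = 0" using vP vorth eL by metis+
    ultimately show ?thesis by simp
  qed
  then have "\<forall>i<N. v i * v i = 0"
    unfolding ip_def by (subst (asm) sum_nonneg_eq_0_iff) auto
  then have v0: "\<forall>i<N. v i = 0" by simp
  have "(\<lambda>i. \<Sum>k<n. ip P (e k) * e k i) \<in> range L"
    using eL by (intro sum_mem) blast
  then obtain q where q: "(\<lambda>i. \<Sum>k<n. ip P (e k) * e k i) = L q" by blast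
  have "F i s = integral {a..b} (\<lambda>t. F i t * poly (p * q) t)" if "i < N" for i
  proof -
    have "F i s = P i" using that by (simp add: P_def)
    also have "\<dots> = (\<Sum>k<n. ip P (e k) * e k i)" using v0 that by (simp add: v_def)
    also have "\<dots> = L q i" by (rule fun_cong[OF q])
    finally show ?thesis using that by (simp only: L_def if_True)
  qed
  then show ?thesis by blast
qed

lemma power_dvd_pderiv:
  fixes p :: "real poly"
  assumes "p ^ Suc m dvd q"
  shows "p ^ m dvd pderiv q"
proof -
  obtain r where q: "q = p ^ Suc m * r" using assms by (rule dvdE)
  have "pderiv q = p ^ Suc m * pderiv r + smult (of_nat (Suc m)) (p ^ m) * pderiv p * r"
    unfolding q pderiv_mult pderiv_power_Suc by (simp add: mult_ac)
  also have "\<dots> = p ^ m * (p * pderiv r + smult (of_nat (Suc m)) (pderiv p * r))"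
    by (simp add: distrib_left mult_ac)
  finally show ?thesis by (metis dvd_triv_left)
qed

text \<open>With weights \<open>\<eta>\<close> that vanish to high order at the ends of a short interval, the function
  \<open>t \<mapsto> z (t - s)\<close> equals \<open>\<integral> z (t - u) * \<eta> u\<close>, so it can be differentiated by moving the
  derivatives to \<open>\<eta>\<close>. All these derivatives lie in the span of \<open>F 0, \<dots>, F (N - 1)\<close>,
  which yields a linear differential equation with constant coefficients.\<close>

lemma countable_zeros_finite_rank_initial:
  fixes F :: "nat \<Rightarrow> real \<Rightarrow> real"
  assumes D: "0 < D" and F: "\<And>i. i < N \<Longrightarrow> continuous_on {0..D} (F i)"
    and z: "\<And>s t. s \<in> {0..D} \<Longrightarrow> t \<in> {0..D} \<Longrightarrow> (\<Sum>i<N. F i s * F i t) = z \<bar>s - t\<bar>"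
    and z0: "z 0 \<noteq> 0" and s: "0 < s" "2 * s < D"
  shows "countable {t\<in>{0<..<D}. z \<bar>t - s\<bar> = 0}"
proof -
  define a where "a = 2 * s"
  have a: "0 < a" "a < D" "s \<in> {0<..<a}" using s by (auto simp: a_def)
  \<comment> \<open>\<open>x * (a - x)\<close> vanishes at both ends of the interval, but not at its centre \<open>s\<close>.\<close>
  define p :: "real poly" where "p = [:0, a, -1:]"
  have pz: "poly p 0 = 0" "poly p a = 0" "poly p s \<noteq> 0"
    using s by (auto simp: p_def a_def algebra_simps)
  obtain q where q: "\<And>i. i < N \<Longrightarrow> F i s = integral {0..a} (\<lambda>t. F i t * poly (p ^ Suc N * q) t)"
  proof -
    have "continuous_on {0..a} (F i)" if "i < N" for i
      using F[OF that] a by (intro continuous_on_subset[OF F[OF that]]) auto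
    moreover have "poly (p ^ Suc N) s \<noteq> 0" using pz(3) by simp
    ultimately show ?thesis using point_value_as_weighted_integral[OF _ a(3)] that by blast
  qed
  define R where "R j = (pderiv ^^ j) (p ^ Suc N * q)" for j
  have Rder: "(poly (R j) has_real_derivative poly (R (Suc j)) x) (at x)" for j x
    using poly_DERIV[of "R j" x] by (simp add: R_def)
  have Rdvd: "j \<le> Suc N \<Longrightarrow> p ^ (Suc N - j) dvd R j" for j
  proof (induction j)
    case (Suc j)
    then have "p ^ Suc (N - j) dvd R j" by (simp add: Suc_diff_le)
    from power_dvd_pderiv[OF this] show ?case by (simp add: R_def)
  qed (simp add: R_def)
  have Rend: "poly (R j) 0 = 0" "poly (R j) a = 0" if j: "j \<le> N" for j
  proof -
    have "p dvd R j" using Rdvd[of j] j by (auto intro: dvd_trans[OF _ Rdvd] simp: Suc_diff_le)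
    then show "poly (R j) 0 = 0" "poly (R j) a = 0" using pz by (auto elim!: dvdE)
  qed
  \<comment> \<open>An even continuous extension of \<open>z\<close> to the line, since \<open>z\<close> itself is constrained on
    \<open>{0..D}\<close> only.\<close>
  define ze where "ze x = (\<Sum>i<N. F i 0 * F i (min \<bar>x\<bar> D))" for x
  have ze: "ze x = z \<bar>x\<bar>" if "\<bar>x\<bar> \<le> D" for x
    using z[of 0 "\<bar>x\<bar>"] that D by (simp add: ze_def)
  have zec: "continuous_on S ze" for S
    unfolding ze_def
  proof (rule continuous_on_sum, rule continuous_on_mult[OF continuous_on_const])
    fix i assume i: "i \<in> {..<N}"
    have c: "continuous_on S (\<lambda>x. min \<bar>x\<bar> D)"
      by (intro continuous_on_min continuous_on_rabs continuous_on_id continuous_on_const)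
    show "continuous_on S (\<lambda>x. F i (min \<bar>x\<bar> D))"
      by (rule continuous_on_compose2[OF F[of i] c]) (use i D in auto)
  qed
  define l where "l = 2 * D"
  obtain Z where Z: "\<And>x. x \<in> {-l..l} \<Longrightarrow> (Z has_vector_derivative ze x) (at x within {-l..l})"
    using antiderivative_continuous[OF zec[of "{-l..l}"]] by metis
  have Zd: "(Z has_real_derivative ze x) (at x)" if "x \<in> {-l<..<l}" for x
    using Z[of x] that at_within_Icc_at[of "-l" x l]
    by (simp add: has_real_derivative_iff_has_vector_derivative)
  have lD: "t - u \<in> {-l<..<l}" if "t \<in> {0<..<D}" "u \<in> {0..a}" for t u
    using that a D by (auto simp: l_def)
  \<comment> \<open>As \<open>z\<close> is only continuous, differentiate under the integral after an integration by
    parts that replaces it by its antiderivative \<open>Z\<close>.\<close>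
  define y where "y j t = integral {0..a} (\<lambda>u. ze (t - u) * poly (R j) u)" for j t
  have contR: "continuous_on S (\<lambda>u. poly (R j) u)" for S j
    by (rule continuous_on_poly[OF continuous_on_id])
  have contze: "continuous_on S (\<lambda>u. ze (t - u))" for S t
    by (rule continuous_on_compose2[OF zec[of UNIV]]) (auto intro!: continuous_intros)
  have "continuous_on {-l<..<l} Z"
    using Zd DERIV_isCont by (intro continuous_at_imp_continuous_on) blast
  then have contZ: "continuous_on {0..a} (\<lambda>u. Z (t - u))" if "t \<in> {0<..<D}" for t
    by (rule continuous_on_compose2[OF _ continuous_on_diff[OF continuous_on_const continuous_on_id]])
       (use lD[OF that] in blast)
  have parts: "y j t = integral {0..a} (\<lambda>u. Z (t - u) * poly (R (Suc j)) u)"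
    if t: "t \<in> {0<..<D}" and j: "j \<le> N" for j t
  proof -
    let ?g = "\<lambda>u. Z (t - u) * poly (R j) u"
    let ?g' = "\<lambda>u. Z (t - u) * poly (R (Suc j)) u - ze (t - u) * poly (R j) u"
    have "(?g' has_integral (?g a - ?g 0)) {0..a}"
    proof (rule fundamental_theorem_of_calculus)
      fix u assume u: "u \<in> {0..a}"
      have "((\<lambda>u. Z (t - u)) has_real_derivative ze (t - u) * (0 - 1)) (at u)"
        using Zd[OF lD[OF t u]]
        by (rule DERIV_chain2[where f = Z and g = "\<lambda>u. t - u"]) (auto intro!: derivative_eq_intros)
      from DERIV_mult[OF this Rder[of j u]]
      have "(?g has_real_derivative ?g' u) (at u)" by (simp add: algebra_simps)
      then show "(?g has_vector_derivative ?g' u) (at u within {0..a})"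
        by (simp add: has_real_derivative_iff_has_vector_derivative has_vector_derivative_at_within)
    qed (use a in simp)
    then have "integral {0..a} ?g' = 0" using Rend[OF j] by (simp add: integral_unique)
    moreover have "integral {0..a} ?g' = integral {0..a} (\<lambda>u. Z (t - u) * poly (R (Suc j)) u)
        - integral {0..a} (\<lambda>u. ze (t - u) * poly (R j) u)"
      by (rule integral_diff; rule integrable_continuous_interval; rule continuous_on_mult)
         (rule contZ[OF t] contR contze)+
    ultimately show ?thesis by (simp add: y_def)
  qed
  have yder: "(y j has_real_derivative y (Suc j) t) (at t)"
    if t: "t \<in> {0<..<D}" and j: "j \<le> N" for j t
  proof -
    have cR: "continuous_on ({0<..<D} \<times> cbox 0 a) (\<lambda>(t, u). ze (t - u) * poly (R (Suc j)) u)"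
      unfolding case_prod_beta
      by (rule continuous_on_mult
            [OF continuous_on_compose2[OF zec[of UNIV] continuous_on_diff
                [OF continuous_on_fst[OF continuous_on_id] continuous_on_snd[OF continuous_on_id]]]
              continuous_on_compose2[OF contR[of UNIV] continuous_on_snd[OF continuous_on_id]]])
         simp_all
    have "((\<lambda>t. integral (cbox 0 a) (\<lambda>u. Z (t - u) * poly (R (Suc j)) u)) has_real_derivative
        integral (cbox 0 a) (\<lambda>u. ze (t - u) * poly (R (Suc j)) u)) (at t within {0<..<D})"
    proof (rule leibniz_rule_field_derivative[OF _ _ cR t])
      fix t u assume tu: "t \<in> {0<..<D}" "u \<in> cbox 0 a"
      have "((\<lambda>t. Z (t - u)) has_real_derivative ze (t - u) * (1 - 0)) (at t)"
        by (rule DERIV_chain2[where f = Z and g = "\<lambda>t. t - u"], rule Zd[OF lD])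
           (use tu in \<open>auto intro!: derivative_eq_intros\<close>)
      from DERIV_cmult_right[OF this, of "poly (R (Suc j)) u"]
      show "((\<lambda>t. Z (t - u) * poly (R (Suc j)) u) has_real_derivative ze (t - u) * poly (R (Suc j)) u)
          (at t within {0<..<D})"
        by (simp add: has_field_derivative_at_within)
    next
      fix t assume t: "t \<in> {0<..<D}"
      from contZ[OF this]
      show "(\<lambda>u. Z (t - u) * poly (R (Suc j)) u) integrable_on cbox 0 a"
        unfolding cbox_interval by (intro integrable_continuous_interval continuous_on_mult contR)
    qed auto
    then have "((\<lambda>t. integral {0..a} (\<lambda>u. Z (t - u) * poly (R (Suc j)) u)) has_real_derivative
        y (Suc j) t) (at t)"
      using at_within_open[OF t] unfolding y_def cbox_interval by simp
    then show ?thesis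
      by (rule has_field_derivative_transform_within_open[OF _ open_greaterThanLessThan t])
         (rule parts[OF _ j, symmetric])
  qed
  define c where "c j i = integral {0..a} (\<lambda>u. F i u * poly (R j) u)" for j i
  have ysum: "y j t = (\<Sum>i<N. F i t * c j i)" if t: "t \<in> {0<..<D}" for j t
  proof -
    have "y j t = integral {0..a} (\<lambda>u. \<Sum>i<N. F i t * (F i u * poly (R j) u))"
      unfolding y_def
    proof (rule integral_cong)
      fix u assume "u \<in> {0..a}"
      then have u: "u \<in> {0..D}" "\<bar>t - u\<bar> \<le> D" using a t by auto
      then have "ze (t - u) = (\<Sum>i<N. F i t * F i u)" using ze z[of t u] t by simp
      then show "ze (t - u) * poly (R j) u = (\<Sum>i<N. F i t * (F i u * poly (R j) u))"
        by (simp add: sum_distrib_right mult.assoc)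
    qed
    also have "\<dots> = (\<Sum>i<N. integral {0..a} (\<lambda>u. F i t * (F i u * poly (R j) u)))"
    proof (rule integral_sum)
      fix i assume "i \<in> {..<N}"
      then have "continuous_on {0..a} (F i)" using F a by (intro continuous_on_subset[OF F]) auto
      then show "(\<lambda>u. F i t * (F i u * poly (R j) u)) integrable_on {0..a}"
        by (intro integrable_on_mult_right integrable_continuous_interval continuous_on_mult contR)
    qed simp
    finally show ?thesis by (simp add: c_def)
  qed
  \<comment> \<open>\<open>N + 1\<close> derivatives in the span of \<open>N\<close> functions are linearly dependent.\<close>
  obtain \<alpha> where al: "\<exists>j\<in>{..N}. \<alpha> j \<noteq> 0" "\<forall>i<N. (\<Sum>j\<in>{..N}. \<alpha> j * c j i) = 0"
    using exists_linear_dependence[of "{..N}" N c] by auto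
  define m where "m = Max {j\<in>{..N}. \<alpha> j \<noteq> 0}"
  have "m \<in> {j\<in>{..N}. \<alpha> j \<noteq> 0}" unfolding m_def using al(1) by (intro Max_in) auto
  then have m: "m \<le> N" "\<alpha> m \<noteq> 0" by auto
  have above: "\<alpha> j = 0" if "m < j" "j \<le> N" for j
  proof (rule ccontr)
    assume "\<alpha> j \<noteq> 0"
    then have "j \<le> m" unfolding m_def using that by (intro Max_ge) auto
    then show False using that by simp
  qed
  have rel: "(\<Sum>j\<le>m. \<alpha> j * y j t) = 0" if t: "t \<in> {0<..<D}" for t
  proof -
    have "(\<Sum>j\<le>m. \<alpha> j * y j t) = (\<Sum>j\<le>N. \<alpha> j * y j t)"
      using m(1) above by (intro sum.mono_neutral_left) auto
    also have "\<dots> = (\<Sum>i<N. F i t * (\<Sum>j\<le>N. \<alpha> j * c j i))"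
      unfolding ysum[OF t] sum_distrib_left by (subst sum.swap) (simp add: mult_ac)
    finally show ?thesis using al(2) by simp
  qed
  have ode: "y m t = (\<Sum>j<m. (- \<alpha> j / \<alpha> m) * y j t)" if t: "t \<in> {0<..<D}" for t
  proof -
    have "\<alpha> m * y m t = - (\<Sum>j<m. \<alpha> j * y j t)"
      using rel[OF t] by (simp add: lessThan_Suc_atMost[symmetric])
    also have "\<dots> = \<alpha> m * (\<Sum>j<m. (- \<alpha> j / \<alpha> m) * y j t)"
      using m(2) by (simp add: sum_distrib_left sum_negf)
    finally show ?thesis using m(2) by simp
  qed
  have y0: "y 0 t = z \<bar>t - s\<bar>" if t: "t \<in> {0<..<D}" for t
  proof -
    have "y 0 t = (\<Sum>i<N. F i t * F i s)"
      unfolding ysum[OF t] by (intro sum.cong refl) (simp add: c_def R_def q)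
    then show ?thesis using z[of t s] t s by simp
  qed
  have "countable {t\<in>{0<..<D}. y 0 t = 0}"
  proof (rule linear_ode_countable_zeros[of m 0 D y "\<lambda>j. - \<alpha> j / \<alpha> m" s])
    show "(y j has_real_derivative y (Suc j) t) (at t)" if "j < m" "t \<in> {0<..<D}" for j t
      using yder[OF that(2), of j] that(1) m(1) by simp
    show "y 0 s \<noteq> 0" using y0[of s] s z0 by simp
  qed (use ode s in auto)
  moreover have "{t\<in>{0<..<D}. y 0 t = 0} = {t\<in>{0<..<D}. z \<bar>t - s\<bar> = 0}"
    using y0 by auto
  ultimately show ?thesis by simp
qed

text \<open>A zero \<open>r < D\<close> of \<open>z\<close> corresponds to the zero \<open>r + s\<close> of \<open>t \<mapsto> z \<bar>t - s\<bar>\<close> for every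
  \<open>s < D - r\<close>; the shifts \<open>s = D / (n + 3)\<close> are small enough for all \<open>r\<close> and satisfy
  \<open>2 * s < D\<close>.\<close>

lemma countable_zeros_finite_rank:
  fixes F :: "nat \<Rightarrow> real \<Rightarrow> real"
  assumes F: "\<And>i. i < N \<Longrightarrow> continuous_on {0..D} (F i)"
    and z: "\<And>s t. s \<in> {0..D} \<Longrightarrow> t \<in> {0..D} \<Longrightarrow> (\<Sum>i<N. F i s * F i t) = z \<bar>s - t\<bar>"
    and z0: "z 0 \<noteq> 0"
  shows "countable {r\<in>{0<..<D}. z r = 0}"
proof -
  have "{r\<in>{0<..<D}. z r = 0}
      \<subseteq> (\<Union>n. (\<lambda>t. t - D / real (n + 3)) ` {t\<in>{0<..<D}. z \<bar>t - D / real (n + 3)\<bar> = 0})"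
  proof
    fix r assume "r \<in> {r\<in>{0<..<D}. z r = 0}"
    then have r: "0 < r" "r < D" "z r = 0" by auto
    obtain n where n: "1 / real (Suc n) < (D - r) / D"
      using nat_approx_posE[of "(D - r) / D"] r by auto
    have "D / real (n + 3) \<le> D * (1 / real (Suc n))" using r by (simp add: frac_le)
    also have "\<dots> < D * ((D - r) / D)" using r n by (intro mult_strict_left_mono) auto
    finally have "D / real (n + 3) < D - r" using r by simp
    then show "r \<in> (\<Union>n. (\<lambda>t. t - D / real (n + 3)) ` {t\<in>{0<..<D}. z \<bar>t - D / real (n + 3)\<bar> = 0})"
      using r by (intro UN_I[of n] image_eqI[of _ _ "r + D / real (n + 3)"]) (auto intro: add_pos_pos)
  qed
  moreover have "countable {t\<in>{0<..<D}. z \<bar>t - D / real (n + 3)\<bar> = 0}" for n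
  proof (cases "0 < D")
    case True
    then show ?thesis
      by (intro countable_zeros_finite_rank_initial[OF True F z z0]) (auto simp: field_simps intro: add_pos_nonneg)
  qed auto
  ultimately show ?thesis
    by (meson countableI_type countable_UN countable_image countable_subset)
qed

section \<open>Ball averages on two-point homogeneous metric measure spaces\<close>

text \<open>All that is used of a compact two-point homogeneous Riemannian manifold with its isometries,
  its distance and its measure. The polynomial lower bound for the volume of small balls
  ensures that spheres are null sets.\<close>

locale homogeneous_metric_measure =
  fixes d :: "'a::{t2_space,second_countable_topology} \<Rightarrow> 'a \<Rightarrow> real"
    and \<mu> :: "'a measure" and G :: "('a \<Rightarrow> 'a) set"
  assumes compact_UNIV: "compact (UNIV :: 'a set)"
    and d_continuous: "continuous_on UNIV (\<lambda>p. d (fst p) (snd p))"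
    and d_eq_0: "d x y = 0 \<longleftrightarrow> x = y"
    and d_sym: "d x y = d y x"
    and d_tri: "d x z \<le> d x y + d y z"
    and sets_\<mu>: "sets \<mu> = sets borel"
    and finite_\<mu>: "emeasure \<mu> UNIV < \<infinity>"
    and G_continuous: "h \<in> G \<Longrightarrow> continuous_on UNIV h"
    and G_distr: "h \<in> G \<Longrightarrow> distr \<mu> borel h = \<mu>"
    and G_isometry: "h \<in> G \<Longrightarrow> d (h x) (h y) = d x y"
    and two_point: "d x y = d x' y' \<Longrightarrow> \<exists>h\<in>G. h x = x' \<and> h y = y'"
    and geodesic: "\<exists>\<gamma>. \<gamma> 0 = x \<and> \<gamma> (d x y) = y \<and>
                     (\<forall>s\<in>{0..d x y}. \<forall>t\<in>{0..d x y}. d (\<gamma> s) (\<gamma> t) = \<bar>s - t\<bar>)"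
    and volume_lower_bound:
      "\<exists>c>0. \<exists>n. \<exists>r0>0. \<exists>x. \<forall>r. 0 < r \<and> r < r0 \<longrightarrow> c * r ^ n \<le> measure \<mu> {y. d x y < r}"
begin

lemma space_\<mu>[simp]: "space \<mu> = UNIV"
  using sets_eq_imp_space_eq[OF sets_\<mu>] by simp

lemmas [measurable_cong] = sets_\<mu>

lemma measurable_\<mu>: "measurable \<mu> N = measurable borel N"
  by (rule measurable_cong_sets[OF sets_\<mu> refl])

sublocale finite_measure \<mu>
  by standard (use finite_\<mu> in auto)

subsection \<open>Topology of the metric\<close>

lemma d_nonneg: "0 \<le> d x y"
  using d_tri[of x x y] d_sym[of x y] d_eq_0[of x x] by simp

lemma d_self [simp]: "d x x = 0"
  by (simp add: d_eq_0)

lemma d_pos: "x \<noteq> y \<Longrightarrow> 0 < d x y"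
  using d_nonneg[of x y] d_eq_0[of x y] by linarith

lemma continuous_d_right: "continuous_on S (d x)"
  by (rule continuous_on_compose2[OF d_continuous, of S "\<lambda>y. (x, y)", simplified])
     (intro continuous_on_Pair continuous_on_const continuous_on_id)

lemma open_level_sets: "open {y. d x y < t}" "open {y. t < d x y}"
  using open_Collect_less[OF continuous_d_right[of UNIV x] continuous_on_const, of t]
    open_Collect_less[OF continuous_on_const continuous_d_right[of UNIV x], of t] by auto

lemma d_measurable [measurable]: "d x \<in> borel_measurable borel"
  by (rule borel_measurable_continuous_onI[OF continuous_d_right])

lemma uniformly_continuous:
  fixes f :: "'a \<Rightarrow> real"
  assumes f: "continuous_on UNIV f" and e: "e > 0"
  shows "\<exists>\<delta>>0. \<forall>x y. d x y < \<delta> \<longrightarrow> \<bar>f x - f y\<bar> < e"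
proof -
  let ?K = "{p :: 'a \<times> 'a. e \<le> \<bar>f (fst p) - f (snd p)\<bar>}"
  have fc: "continuous_on UNIV (\<lambda>p::'a\<times>'a. f (fst p))" "continuous_on UNIV (\<lambda>p::'a\<times>'a. f (snd p))"
    by (rule continuous_on_compose2[OF f]; auto intro: continuous_on_fst continuous_on_snd continuous_on_id)+
  have "closed ?K"
    by (rule closed_Collect_le[OF continuous_on_const continuous_on_rabs[OF continuous_on_diff[OF fc]]])
  moreover have "compact (UNIV :: ('a \<times> 'a) set)"
    using compact_Times[OF compact_UNIV compact_UNIV] by simp
  ultimately have K: "compact ?K" using compact_Int_closed by fastforce
  show ?thesis
  proof (cases "?K = {}")
    case True
    then show ?thesis by (intro exI[of _ 1]) (auto simp: not_le[symmetric])
  next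
    case False
    from continuous_attains_inf[OF K False continuous_on_subset[OF d_continuous]]
    obtain p where p: "p \<in> ?K" "\<And>q. q \<in> ?K \<Longrightarrow> d (fst p) (snd p) \<le> d (fst q) (snd q)" by auto
    from p(1) e have "fst p \<noteq> snd p" by auto
    then have "0 < d (fst p) (snd p)" by (rule d_pos)
    moreover have "\<bar>f x - f y\<bar> < e" if "d x y < d (fst p) (snd p)" for x y
      using p(2)[of "(x, y)"] that by fastforce
    ultimately show ?thesis by blast
  qed
qed

lemma continuous_if_uniformly:
  fixes f :: "'a \<Rightarrow> real"
  assumes "\<And>e. e > 0 \<Longrightarrow> \<exists>\<delta>>0. \<forall>x y. d x y < \<delta> \<longrightarrow> \<bar>f x - f y\<bar> \<le> e"
  shows "continuous_on UNIV f"
  unfolding continuous_on_eq_continuous_at[OF open_UNIV]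
proof (rule ballI, unfold isCont_def tendsto_iff, intro allI impI)
  fix x :: 'a and e :: real assume "e > 0"
  then obtain \<delta> where \<delta>: "\<delta> > 0" "\<And>x y. d x y < \<delta> \<Longrightarrow> \<bar>f x - f y\<bar> \<le> e / 2"
    using assms[of "e / 2"] by auto
  have "eventually (\<lambda>y. y \<in> {y. d x y < \<delta>}) (at x)"
    using \<delta>(1) by (intro eventually_at_topological[THEN iffD2] exI[of _ "{y. d x y < \<delta>}"])
      (auto intro: open_level_sets)
  then show "\<forall>\<^sub>F y in at x. dist (f y) (f x) < e"
  proof eventually_elim
    case (elim y)
    then show ?case using \<delta>(2)[of x y] \<open>e > 0\<close> by (auto simp: dist_real_def abs_minus_commute)
  qed
qed

lemma continuous_bounded:
  fixes f :: "'a \<Rightarrow> real"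
  assumes "continuous_on UNIV f"
  shows "\<exists>M\<ge>0. \<forall>x. \<bar>f x\<bar> \<le> M"
proof -
  have "bounded (range f)"
    by (rule compact_imp_bounded[OF compact_continuous_image[OF assms compact_UNIV]])
  then obtain M where "\<And>x. \<bar>f x\<bar> \<le> M" by (auto simp: bounded_iff)
  then show ?thesis by (meson abs_ge_zero order_trans)
qed

lemma level_sets_measurable [simp]:
  "{y. d x y < t} \<in> sets \<mu>" "{y. d x y = t} \<in> sets \<mu>"
  "{y. s < d x y \<and> d x y < t} \<in> sets \<mu>" "{y. s \<le> d x y \<and> d x y < t} \<in> sets \<mu>"
  unfolding sets_\<mu> by measurable

definition diam :: real where
  "diam = (SUP (p, q)\<in>UNIV. d p q)"

lemma diam_attained: "\<exists>p q. d p q = diam" and d_le_diam: "d x y \<le> diam"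
proof -
  have c: "compact (UNIV :: ('a \<times> 'a) set)"
    using compact_Times[OF compact_UNIV compact_UNIV] by simp
  have "\<exists>p\<in>UNIV. \<forall>q\<in>UNIV. d (fst q) (snd q) \<le> d (fst p) (snd p)"
    by (rule continuous_attains_sup[OF c UNIV_not_empty d_continuous])
  then obtain p where p: "\<And>q. d (fst q) (snd q) \<le> d (fst p) (snd p)" by blast
  have D: "diam = d (fst p) (snd p)"
    unfolding diam_def case_prod_beta by (rule cSup_eq_maximum) (use p in auto)
  show "\<exists>p q. d p q = diam" using D by metis
  show "d x y \<le> diam" using p[of "(x, y)"] D by simp
qed

subsection \<open>Invariance and balls\<close>

lemma G_measurable [measurable]: "h \<in> G \<Longrightarrow> h \<in> borel_measurable borel"
  by (rule borel_measurable_continuous_onI[OF G_continuous])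

lemma measure_vimage:
  assumes "h \<in> G" "S \<in> sets borel"
  shows "measure \<mu> (h -` S) = measure \<mu> S"
proof -
  have "measure (distr \<mu> borel h) S = measure \<mu> (h -` S \<inter> space \<mu>)"
    using assms by (intro measure_distr) (auto simp: measurable_\<mu>)
  then show ?thesis using G_distr[OF assms(1)] by simp
qed

lemma integral_compose:
  fixes f :: "'a \<Rightarrow> real"
  assumes "h \<in> G" "f \<in> borel_measurable borel"
  shows "(\<integral>y. f (h y) \<partial>\<mu>) = (\<integral>y. f y \<partial>\<mu>)"
proof -
  have "h \<in> measurable \<mu> borel" using G_measurable[OF assms(1)] by (simp add: measurable_\<mu>)
  from integral_distr[OF this assms(2)] show ?thesis using G_distr[OF assms(1)] by simp
qed

lemma transitive: "\<exists>h\<in>G. h x = y"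
  using two_point[of x x y y] by auto

lemma measure_level_set:
  assumes "S \<in> sets borel"
  shows "measure \<mu> {y. d x y \<in> S} = measure \<mu> {y. d x' y \<in> S}"
proof -
  obtain h where h: "h \<in> G" "h x = x'" using transitive by blast
  have "{y. d x' y \<in> S} \<in> sets borel" using assms by measurable
  from measure_vimage[OF h(1) this] show ?thesis
    using G_isometry[OF h(1), of x] h(2) by (simp add: vimage_def)
qed

text \<open>The centre is arbitrary, as isometries act transitively.\<close>

definition ball_volume :: "real \<Rightarrow> real" where
  "ball_volume t = measure \<mu> {y. d (SOME x. True) y < t}"

lemma measure_ball: "measure \<mu> {y. d x y < t} = ball_volume t"
  using measure_level_set[of "{..<t}" x "SOME x. True"] by (simp add: ball_volume_def)

lemma ball_volume_lower: "\<exists>c>0. \<exists>n. \<exists>r0>0. \<forall>r. 0 < r \<and> r < r0 \<longrightarrow> c * r ^ n \<le> ball_volume r"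
  using volume_lower_bound by (simp add: measure_ball)

lemma ball_volume_mono: "s \<le> t \<Longrightarrow> ball_volume s \<le> ball_volume t"
  unfolding ball_volume_def by (intro finite_measure_mono) auto

lemma ball_volume_pos: "0 < r \<Longrightarrow> 0 < ball_volume r"
proof -
  assume r: "0 < r"
  obtain c n r0 where c: "c > 0" "r0 > 0" "\<And>r. 0 < r \<Longrightarrow> r < r0 \<Longrightarrow> c * r ^ n \<le> ball_volume r"
    using ball_volume_lower by blast
  let ?s = "min r (r0 / 2)"
  have "0 < c * ?s ^ n" using c r by simp
  also have "\<dots> \<le> ball_volume ?s" using c r by (intro c(3)) auto
  also have "\<dots> \<le> ball_volume r" by (rule ball_volume_mono) simp
  finally show ?thesis .
qed

abbreviation vol :: real where "vol \<equiv> measure \<mu> UNIV"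

lemma vol_pos: "0 < vol"
  using ball_volume_pos[of 1] finite_measure_mono[of "{y. d (SOME x. True) y < 1}" UNIV]
  by (simp add: ball_volume_def)

subsection \<open>Spheres are null sets\<close>

text \<open>Otherwise the volumes of the balls of radius \<open>\<rho> / 4 ^ k\<close> would decay faster than
  \<open>(\<rho> / 4 ^ k) ^ n\<close>.\<close>

lemma frequently_doubling: "\<exists>C>0. \<forall>r1>0. \<exists>r>0. r < r1 \<and> ball_volume (2 * r) \<le> C * ball_volume (r / 2)"
proof -
  obtain c n r0 where c: "c > 0" "r0 > 0" "\<And>r. 0 < r \<Longrightarrow> r < r0 \<Longrightarrow> c * r ^ n \<le> ball_volume r"
    using ball_volume_lower by blast
  define K :: real where "K = 2 * 4 ^ n"
  have K: "0 < K" by (simp add: K_def)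
  have "\<exists>r>0. r < r1 \<and> ball_volume (2 * r) \<le> K * ball_volume (r / 2)" if r1: "r1 > 0" for r1
  proof (rule ccontr)
    assume "\<not> ?thesis"
    then have less: "K * ball_volume (r / 2) < ball_volume (2 * r)" if "0 < r" "r < r1" for r
      using that by (meson not_le)
    define \<rho> where "\<rho> = min r0 r1 / 2"
    have \<rho>: "0 < \<rho>" "\<rho> < r0" "\<rho> < r1" using c r1 by (auto simp: \<rho>_def)
    have small: "0 < \<rho> / 4 ^ k" "\<rho> / 4 ^ k < r0" "\<rho> / 4 ^ k < r1" for k :: nat
    proof -
      have "\<rho> / 4 ^ k \<le> \<rho> / 1" using \<rho>(1) by (intro divide_left_mono) auto
      then show "\<rho> / 4 ^ k < r0" "\<rho> / 4 ^ k < r1" using \<rho> by auto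
    qed (use \<rho> in auto)
    have up: "ball_volume (\<rho> / 4 ^ k) * K ^ k \<le> ball_volume \<rho>" for k
    proof (induction k)
      case (Suc k)
      have "K * ball_volume (\<rho> / 4 ^ k / 2 / 2) < ball_volume (2 * (\<rho> / 4 ^ k / 2))"
        using small[of k] by (intro less) auto
      then have "K * ball_volume (\<rho> / 4 ^ Suc k) \<le> ball_volume (\<rho> / 4 ^ k)"
        by (simp add: mult.commute)
      then have "K * ball_volume (\<rho> / 4 ^ Suc k) * K ^ k \<le> ball_volume (\<rho> / 4 ^ k) * K ^ k"
        by (rule mult_right_mono) (use K in simp)
      also note Suc
      finally show ?case by (simp add: mult_ac)
    qed simp
    have lo: "c * \<rho> ^ n * 2 ^ k \<le> ball_volume (\<rho> / 4 ^ k) * K ^ k" for k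
    proof -
      have "c * (\<rho> / 4 ^ k) ^ n * K ^ k \<le> ball_volume (\<rho> / 4 ^ k) * K ^ k"
        using small[of k] c(3) K by (intro mult_right_mono) auto
      moreover have "c * (\<rho> / 4 ^ k) ^ n * K ^ k = c * \<rho> ^ n * 2 ^ k"
        by (simp add: K_def power_divide power_mult_distrib power_mult[symmetric] mult.commute[of k n])
      ultimately show ?thesis by simp
    qed
    obtain k where "ball_volume \<rho> / (c * \<rho> ^ n) < 2 ^ k"
      using real_arch_pow[of 2] by auto
    moreover have "c * \<rho> ^ n > 0" using c \<rho> by simp
    ultimately have "ball_volume \<rho> < c * \<rho> ^ n * 2 ^ k"
      by (simp add: pos_divide_less_eq mult.commute)
    with up[of k] lo[of k] show False by linarith
  qed
  with K show ?thesis by blast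
qed

lemma point_at_distance:
  assumes "0 \<le> s" "s \<le> d x y"
  obtains z where "d x z = s" "d z y = d x y - s"
proof -
  obtain \<gamma> where \<gamma>: "\<gamma> 0 = x" "\<gamma> (d x y) = y"
    "\<And>s t. s \<in> {0..d x y} \<Longrightarrow> t \<in> {0..d x y} \<Longrightarrow> d (\<gamma> s) (\<gamma> t) = \<bar>s - t\<bar>"
    using geodesic[of x y] by blast
  from \<gamma>(3)[of 0 s] \<gamma>(3)[of s "d x y"] show ?thesis
    using assms \<gamma>(1,2) by (intro that[of "\<gamma> s"]) auto
qed

text \<open>Take a maximal subset \<open>X\<close> of the sphere with pairwise distances at least \<open>2 * r\<close>. The balls
  of radius \<open>2 * r\<close> around \<open>X\<close> cover the sphere. Moving each point of \<open>X\<close> by \<open>r / 2\<close> towards \<open>x\<close>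
  gives as many disjoint balls of radius \<open>r / 2\<close> in the shell between the radii \<open>t - r\<close> and \<open>t\<close>.
  For radii with the doubling property the sphere is therefore at most \<open>C\<close> times as large as
  the shell, whose measure tends to zero.\<close>

lemma sphere_null:
  assumes t: "0 < t"
  shows "measure \<mu> {y. d x y = t} = 0"
proof -
  let ?S = "{y. d x y = t}"
  let ?A = "\<lambda>r. {y. t - r < d x y \<and> d x y < t}"
  obtain C where C: "C > 0" "\<And>r1. r1 > 0 \<Longrightarrow> \<exists>r>0. r < r1 \<and> ball_volume (2 * r) \<le> C * ball_volume (r / 2)"
    using frequently_doubling by blast
  have packing: "\<exists>N::nat. measure \<mu> ?S \<le> N * ball_volume (2 * r) \<and> N * ball_volume (r / 2) \<le> measure \<mu> (?A r)"
    if r: "0 < r" "r < t" for r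
  proof -
    define P where "P X \<longleftrightarrow> finite X \<and> X \<subseteq> ?S \<and> (\<forall>a\<in>X. \<forall>b\<in>X. a \<noteq> b \<longrightarrow> 2 * r \<le> d a b)" for X
    have pk: "card X * ball_volume (r / 2) \<le> measure \<mu> (?A r)" if X: "P X" for X
    proof -
      have "\<exists>z. d x z = t - r / 2 \<and> d z a = r / 2" if "a \<in> X" for a
        using point_at_distance[of "t - r / 2" x a] that X r by (force simp: P_def)
      then obtain z where z: "\<And>a. a \<in> X \<Longrightarrow> d x (z a) = t - r / 2" "\<And>a. a \<in> X \<Longrightarrow> d (z a) a = r / 2"
        by metis
      let ?B = "\<lambda>a. {y. d (z a) y < r / 2}"
      have "disjoint_family_on ?B X"
        unfolding disjoint_family_on_def
      proof (intro ballI impI)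
        fix a b assume ab: "a \<in> X" "b \<in> X" "a \<noteq> b"
        have False if "d (z a) y < r / 2" "d (z b) y < r / 2" for y
        proof -
          have "d a b \<le> d a (z a) + (d (z a) y + (d y (z b) + d (z b) b))"
            using d_tri[of a b "z a"] d_tri[of "z a" b y] d_tri[of y b "z b"] by linarith
          also have "\<dots> < 2 * r"
            using z(2)[OF ab(1)] z(2)[OF ab(2)] that d_sym[of a "z a"] d_sym[of y "z b"] by linarith
          finally show False using X ab unfolding P_def by (meson not_le)
        qed
        then show "?B a \<inter> ?B b = {}" by blast
      qed
      then have "measure \<mu> (\<Union>a\<in>X. ?B a) = (\<Sum>a\<in>X. measure \<mu> (?B a))"
        using X by (intro finite_measure_finite_Union) (auto simp: P_def)
      then have "card X * ball_volume (r / 2) = measure \<mu> (\<Union>a\<in>X. ?B a)"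
        by (simp only: measure_ball sum_constant)
      also have "\<dots> \<le> measure \<mu> (?A r)"
      proof (rule finite_measure_mono)
        have "t - r < d x y" "d x y < t" if a: "a \<in> X" "d (z a) y < r / 2" for a y
          using d_tri[of x y "z a"] d_tri[of x "z a" y] d_sym[of y "z a"] z[OF a(1)] a(2) by linarith+
        then show "(\<Union>a\<in>X. ?B a) \<subseteq> ?A r" by blast
      qed simp
      finally show ?thesis .
    qed
    have "card X \<le> nat \<lceil>vol / ball_volume (r / 2)\<rceil>" if "P X" for X
    proof -
      have "card X * ball_volume (r / 2) \<le> vol"
        using pk[OF that] finite_measure_mono[of "?A r" UNIV] by simp
      then have "card X \<le> vol / ball_volume (r / 2)"
        using ball_volume_pos[of "r / 2"] r by (simp add: pos_le_divide_eq)
      then show ?thesis by linarith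
    qed
    moreover have "P {}" by (simp add: P_def)
    ultimately have "\<exists>X. P X \<and> (\<forall>Y. P Y \<longrightarrow> card Y \<le> card X)"
      by (intro ex_has_greatest_nat[of P "{}" card "Suc (nat \<lceil>vol / ball_volume (r / 2)\<rceil>)"])
         (auto simp: less_Suc_eq_le)
    then obtain X where X: "P X" "\<And>Y. P Y \<Longrightarrow> card Y \<le> card X" by blast
    have "?S \<subseteq> (\<Union>a\<in>X. {y. d a y < 2 * r})"
    proof (rule ccontr)
      assume "\<not> ?thesis"
      then obtain y where "y \<in> ?S" "y \<notin> (\<Union>a\<in>X. {y. d a y < 2 * r})" by blast
      then have y: "d x y = t" "\<And>a. a \<in> X \<Longrightarrow> 2 * r \<le> d a y" by (auto simp: not_less)
      have "P (insert y X)"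
        using X(1) y d_sym[of y] unfolding P_def by auto
      moreover have "y \<notin> X" using y(2)[of y] r by auto
      moreover have "finite X" using X(1) by (simp add: P_def)
      ultimately show False using X(2)[of "insert y X"] by simp
    qed
    moreover have fX: "finite X" using X(1) by (simp add: P_def)
    then have U: "(\<Union>a\<in>X. {y. d a y < 2 * r}) \<in> sets \<mu>" by (intro sets.finite_UN) simp_all
    ultimately have "measure \<mu> ?S \<le> measure \<mu> (\<Union>a\<in>X. {y. d a y < 2 * r})"
      by (rule finite_measure_mono)
    moreover have "measure \<mu> (\<Union>a\<in>X. {y. d a y < 2 * r}) \<le> (\<Sum>a\<in>X. measure \<mu> {y. d a y < 2 * r})"
      by (rule finite_measure_subadditive_finite[OF fX]) auto
    moreover have "(\<Sum>a\<in>X. measure \<mu> {y. d a y < 2 * r}) = card X * ball_volume (2 * r)"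
      by (simp only: measure_ball sum_constant)
    ultimately have "measure \<mu> ?S \<le> card X * ball_volume (2 * r)" by linarith
    then show ?thesis using pk[OF X(1)] by (intro exI[of _ "card X"] conjI)
  qed
  have bound: "\<exists>r>0. r < r1 \<and> measure \<mu> ?S \<le> C * measure \<mu> (?A r)" if r1: "r1 > 0" for r1
  proof -
    have "0 < min r1 t" using r1 t by simp
    from C(2)[OF this] obtain r where r: "0 < r" "r < min r1 t"
      "ball_volume (2 * r) \<le> C * ball_volume (r / 2)" by blast
    from r(2) have "r < t" by simp
    from packing[OF r(1) this] obtain N :: nat where N: "measure \<mu> ?S \<le> N * ball_volume (2 * r)"
      "N * ball_volume (r / 2) \<le> measure \<mu> (?A r)" by blast
    have "N * ball_volume (2 * r) \<le> N * (C * ball_volume (r / 2))"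
      using r by (intro mult_left_mono) auto
    also have "\<dots> = C * (N * ball_volume (r / 2))" by simp
    also have "\<dots> \<le> C * measure \<mu> (?A r)" using N C(1) by (intro mult_left_mono) auto
    finally have "measure \<mu> ?S \<le> C * measure \<mu> (?A r)" using N(1) by linarith
    with r show ?thesis by (intro exI[of _ r]) simp
  qed
  have le: "measure \<mu> ?S \<le> C * measure \<mu> (?A (1 / Suc k))" for k
  proof -
    have "0 < 1 / real (Suc k)" by simp
    from bound[OF this] obtain r where r: "0 < r" "r < 1 / Suc k"
      "measure \<mu> ?S \<le> C * measure \<mu> (?A r)" by blast
    have "measure \<mu> (?A r) \<le> measure \<mu> (?A (1 / Suc k))"
      using r by (intro finite_measure_mono) auto
    from mult_left_mono[OF this, of C] r(3) C(1) show ?thesis by linarith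
  qed
  have "(\<lambda>k. measure \<mu> (?A (1 / Suc k))) \<longlonglongrightarrow> measure \<mu> (\<Inter>k. ?A (1 / Suc k))"
  proof (rule finite_Lim_measure_decseq)
    show "decseq (\<lambda>k. ?A (1 / Suc k))"
    proof (rule decseq_SucI)
      fix k
      have "1 / real (Suc (Suc k)) \<le> 1 / real (Suc k)" by (intro frac_le) auto
      then show "?A (1 / Suc (Suc k)) \<subseteq> ?A (1 / Suc k)" by auto
    qed
  qed auto
  moreover have "y \<notin> (\<Inter>k. ?A (1 / Suc k))" for y
  proof
    assume y: "y \<in> (\<Inter>k. ?A (1 / Suc k))"
    then have "0 < t - d x y" by auto
    then obtain k where k: "1 / Suc k < t - d x y" by (rule nat_approx_posE)
    from y have "t - 1 / Suc k < d x y" by blast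
    with k show False by linarith
  qed
  then have "(\<Inter>k. ?A (1 / Suc k)) = {}" by blast
  ultimately have "(\<lambda>k. C * measure \<mu> (?A (1 / Suc k))) \<longlonglongrightarrow> C * 0"
    by (intro tendsto_mult tendsto_const) simp
  then have "measure \<mu> ?S \<le> C * 0"
    by (rule LIMSEQ_le_const) (use le in auto)
  then show ?thesis by (simp add: measure_le_0_iff)
qed

text \<open>The shells shrink to the sphere, and by homogeneity the radius does not depend on the centre.\<close>

lemma shell_small:
  assumes t: "0 < t" and e: "0 < e"
  shows "\<exists>\<delta>>0. \<forall>x. measure \<mu> {y. t - \<delta> \<le> d x y \<and> d x y < t + \<delta>} < e"
proof -
  fix x0 :: 'a
  let ?A = "\<lambda>k::nat. {y. t - 1 / Suc k \<le> d x0 y \<and> d x0 y < t + 1 / Suc k}"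
  have "(\<lambda>k. measure \<mu> (?A k)) \<longlonglongrightarrow> measure \<mu> (\<Inter>k. ?A k)"
  proof (rule finite_Lim_measure_decseq)
    show "decseq ?A"
    proof (rule decseq_SucI)
      fix k
      have "1 / real (Suc (Suc k)) \<le> 1 / real (Suc k)" by (intro frac_le) auto
      then show "?A (Suc k) \<subseteq> ?A k" by auto
    qed
  qed auto
  moreover have "(\<Inter>k. ?A k) \<subseteq> {y. d x0 y = t}"
  proof safe
    fix y assume y: "y \<in> (\<Inter>k. ?A k)"
    show "d x0 y = t"
    proof (rule ccontr)
      assume "d x0 y \<noteq> t"
      then have "0 < \<bar>t - d x0 y\<bar>" by simp
      then obtain k where k: "1 / Suc k < \<bar>t - d x0 y\<bar>" by (rule nat_approx_posE)
      from y have "t - 1 / Suc k \<le> d x0 y" "d x0 y < t + 1 / Suc k" by blast+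
      with k show False by linarith
    qed
  qed
  then have "measure \<mu> (\<Inter>k. ?A k) \<le> measure \<mu> {y. d x0 y = t}"
    by (intro finite_measure_mono) auto
  then have "measure \<mu> (\<Inter>k. ?A k) = 0" using sphere_null[OF t, of x0] by (simp add: measure_le_0_iff)
  ultimately have "(\<lambda>k. measure \<mu> (?A k)) \<longlonglongrightarrow> 0" by simp
  from order_tendstoD(2)[OF this e]
  have "eventually (\<lambda>k. measure \<mu> (?A k) < e) sequentially" .
  then obtain k where "measure \<mu> (?A k) < e" by (auto simp: eventually_sequentially)
  moreover have eq: "measure \<mu> {y. t - \<delta> \<le> d x y \<and> d x y < t + \<delta>} = measure \<mu> {y. t - \<delta> \<le> d x0 y \<and> d x0 y < t + \<delta>}"
    for x \<delta> using measure_level_set[of "{t - \<delta>..<t + \<delta>}" x x0] by simp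
  ultimately have "\<forall>x. measure \<mu> {y. t - 1 / Suc k \<le> d x y \<and> d x y < t + 1 / Suc k} < e"
    by (metis eq)
  then show ?thesis by (intro exI[of _ "1 / Suc k"]) simp
qed


subsection \<open>The inner product\<close>

text \<open>The functions to which the averaging operators apply: continuous functions and indicator
  functions of balls are among them, and all their products are integrable.\<close>

definition bm :: "('a \<Rightarrow> real) \<Rightarrow> bool" where
  "bm f \<longleftrightarrow> f \<in> borel_measurable borel \<and> (\<exists>M. \<forall>x. \<bar>f x\<bar> \<le> M)"

definition ip :: "('a \<Rightarrow> real) \<Rightarrow> ('a \<Rightarrow> real) \<Rightarrow> real" where
  "ip f g = (\<integral>x. f x * g x \<partial>\<mu>)"

lemma bm_measurable: "bm f \<Longrightarrow> f \<in> borel_measurable borel"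
  by (simp add: bm_def)

lemma bm_integrable: "bm f \<Longrightarrow> integrable \<mu> f"
proof -
  assume "bm f"
  then obtain M where "f \<in> borel_measurable borel" "\<And>x. \<bar>f x\<bar> \<le> M" by (auto simp: bm_def)
  then show ?thesis by (intro integrable_const_bound[of f M]) (auto simp: measurable_\<mu>)
qed

lemma bm_continuous: "continuous_on UNIV f \<Longrightarrow> bm f"
  using continuous_bounded[of f] by (auto simp: bm_def intro: borel_measurable_continuous_onI)

lemma bm_const: "bm (\<lambda>x. c)"
  by (auto simp: bm_def)

lemma bm_mult: "bm f \<Longrightarrow> bm g \<Longrightarrow> bm (\<lambda>x. f x * g x)"
proof -
  assume "bm f" "bm g"
  then obtain M N where m: "f \<in> borel_measurable borel" "g \<in> borel_measurable borel"
    and M: "\<And>x. \<bar>f x\<bar> \<le> M" "\<And>x. \<bar>g x\<bar> \<le> N" by (auto simp: bm_def)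
  have "\<bar>f x * g x\<bar> \<le> M * N" for x
    unfolding abs_mult using M[of x] by (intro mult_mono) auto
  with m show ?thesis by (auto simp: bm_def)
qed

lemma bm_add: "bm f \<Longrightarrow> bm g \<Longrightarrow> bm (\<lambda>x. f x + g x)"
proof -
  assume "bm f" "bm g"
  then obtain M N where m: "f \<in> borel_measurable borel" "g \<in> borel_measurable borel"
    and M: "\<And>x. \<bar>f x\<bar> \<le> M" "\<And>x. \<bar>g x\<bar> \<le> N" by (auto simp: bm_def)
  have "\<bar>f x + g x\<bar> \<le> M + N" for x
    using M[of x] by linarith
  with m show ?thesis by (auto simp: bm_def)
qed

lemma bm_lin: "bm f \<Longrightarrow> bm g \<Longrightarrow> bm (\<lambda>x. a * f x + b * g x)"
  by (intro bm_add bm_mult bm_const)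

lemma bm_diff: "bm f \<Longrightarrow> bm g \<Longrightarrow> bm (\<lambda>x. f x - g x)"
  using bm_lin[of f g 1 "-1"] by simp

lemma bm_indicator: "S \<in> sets borel \<Longrightarrow> bm (\<lambda>x. indicator S x)"
  by (auto simp: bm_def indicator_def intro!: exI[of _ 1])

lemma bm_ball: "bm (indicator {y. d x y < t})"
  using bm_indicator[of "{y. d x y < t}"] level_sets_measurable(1)[of x t] by (simp add: sets_\<mu>)

lemma integral_lin: "bm f \<Longrightarrow> bm g \<Longrightarrow>
    (\<integral>x. a * f x + b * g x \<partial>\<mu>) = a * (\<integral>x. f x \<partial>\<mu>) + b * (\<integral>x. g x \<partial>\<mu>)"
  by (simp add: bm_integrable)

lemma ip_commute: "ip f g = ip g f"
  by (simp add: ip_def mult.commute)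

lemma ip_linear: "bm f \<Longrightarrow> bm g \<Longrightarrow> bm h \<Longrightarrow>
    ip (\<lambda>x. a * f x + b * g x) h = a * ip f h + b * ip g h"
  using integral_lin[OF bm_mult[of f h] bm_mult[of g h], of a b]
  by (simp add: ip_def distrib_right mult.assoc)

lemma ip_scale_left: "ip (\<lambda>x. a * f x) h = a * ip f h"
  by (simp add: ip_def mult.assoc)

lemma ip_scale_right: "ip h (\<lambda>x. a * f x) = a * ip h f"
  using ip_scale_left[of a f h] by (simp add: ip_commute)

lemma ip_ge_0: "0 \<le> ip f f"
  by (auto simp: ip_def intro: integral_nonneg)

lemma ip_compose: "bm f \<Longrightarrow> bm g \<Longrightarrow> h \<in> G \<Longrightarrow> ip (\<lambda>x. f (h x)) (\<lambda>x. g (h x)) = ip f g"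
  unfolding ip_def by (rule integral_compose) (auto simp: bm_def)

lemma ip_Cauchy_Schwarz:
  assumes "bm f" "bm g"
  shows "(ip f g)\<^sup>2 \<le> ip f f * ip g g"
proof (rule quadratic_form_Cauchy_Schwarz)
  fix s
  have b: "bm (\<lambda>x. 1 * f x + s * g x)" using assms by (rule bm_lin)
  have "0 \<le> ip (\<lambda>x. 1 * f x + s * g x) (\<lambda>x. 1 * f x + s * g x)" by (rule ip_ge_0)
  also have "\<dots> = 1 * ip f (\<lambda>x. 1 * f x + s * g x) + s * ip g (\<lambda>x. 1 * f x + s * g x)"
    by (rule ip_linear[OF assms b])
  also have "\<dots> = ip f f + 2 * s * ip f g + s\<^sup>2 * ip g g"
    unfolding ip_commute[of f "\<lambda>x. 1 * f x + s * g x"] ip_commute[of g "\<lambda>x. 1 * f x + s * g x"]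
      ip_linear[OF assms assms(1)] ip_linear[OF assms assms(2)] ip_commute[of g f]
    by (simp add: algebra_simps power2_eq_square)
  finally show "0 \<le> ip f f + 2 * s * ip f g + s\<^sup>2 * ip g g" .
qed (rule ip_ge_0)+

lemma ip_le_sup:
  assumes "bm f" "\<And>x. (f x)\<^sup>2 \<le> M"
  shows "ip f f \<le> M * vol"
proof -
  have "ip f f \<le> (\<integral>x. M \<partial>\<mu>)"
    unfolding ip_def using assms
    by (intro integral_mono bm_integrable bm_mult bm_const) (auto simp: power2_eq_square)
  then show ?thesis by (simp add: mult.commute)
qed

lemma ip_eq_0:
  assumes f: "continuous_on UNIV f" and 0: "ip f f = 0"
  shows "f = (\<lambda>x. 0)"
proof (rule ccontr)
  assume "f \<noteq> (\<lambda>x. 0)"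
  then obtain x where x: "f x \<noteq> 0" by auto
  then have "0 < \<bar>f x\<bar> / 2" by simp
  from uniformly_continuous[OF f this] obtain \<delta> where \<delta>: "\<delta> > 0"
    "\<And>u y. d u y < \<delta> \<Longrightarrow> \<bar>f u - f y\<bar> < \<bar>f x\<bar> / 2" by blast
  have "(\<integral>y. (\<bar>f x\<bar> / 2)\<^sup>2 * indicator {y. d x y < \<delta>} y \<partial>\<mu>) \<le> ip f f"
    unfolding ip_def
  proof (intro integral_mono bm_integrable bm_mult bm_const bm_ball bm_continuous f)
    fix y
    show "(\<bar>f x\<bar> / 2)\<^sup>2 * indicator {y. d x y < \<delta>} y \<le> f y * f y"
    proof (cases "d x y < \<delta>")
      case True
      then have "\<bar>f x\<bar> / 2 \<le> \<bar>f y\<bar>" using \<delta>(2)[OF True] by linarith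
      from power_mono[OF this, of 2] True show ?thesis by (simp add: power2_eq_square)
    qed simp
  qed
  then have "(\<bar>f x\<bar> / 2)\<^sup>2 * ball_volume \<delta> \<le> 0" using 0 by (simp add: measure_ball)
  then show False using x ball_volume_pos[OF \<delta>(1)] by (simp add: mult_le_0_iff)
qed

subsection \<open>Integrals over balls\<close>

text \<open>The Pompeiu property of the balls of radius \<open>t\<close> says that \<open>T t\<close> is injective on continuous
  functions.\<close>

definition T :: "real \<Rightarrow> ('a \<Rightarrow> real) \<Rightarrow> 'a \<Rightarrow> real" where
  "T t f x = (\<integral>y. indicator {y. d x y < t} y * f y \<partial>\<mu>)"

lemma T_linear: "bm f \<Longrightarrow> bm g \<Longrightarrow> T t (\<lambda>x. a * f x + b * g x) x = a * T t f x + b * T t g x"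
  using integral_lin[OF bm_mult[OF bm_ball[of x t], of f] bm_mult[OF bm_ball[of x t], of g], of a b]
  by (simp add: T_def algebra_simps)

lemma T_scale: "T t (\<lambda>x. a * f x) x = a * T t f x"
proof -
  have "T t (\<lambda>x. a * f x) x = (\<integral>y. a * (indicator {y. d x y < t} y * f y) \<partial>\<mu>)"
    unfolding T_def by (rule Bochner_Integration.integral_cong) auto
  then show ?thesis by (simp add: T_def)
qed

lemma T_diff: "bm f \<Longrightarrow> bm g \<Longrightarrow> T t (\<lambda>x. f x - g x) x = T t f x - T t g x"
  using T_linear[of f g t 1 "-1" x] by simp

lemma T_compose:
  assumes "bm f" "h \<in> G"
  shows "T t (\<lambda>x. f (h x)) x = T t f (h x)"
proof -
  have "T t (\<lambda>x. f (h x)) x = (\<integral>y. indicator {y. d (h x) y < t} (h y) * f (h y) \<partial>\<mu>)"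
    unfolding T_def using G_isometry[OF assms(2), of x] by (simp add: indicator_def)
  also have "\<dots> = T t f (h x)"
    unfolding T_def using assms bm_mult[OF bm_ball assms(1)]
    by (intro integral_compose[where f = "\<lambda>y. indicator {y. d (h x) y < t} y * f y"]) (auto simp: bm_def)
  finally show ?thesis .
qed

text \<open>By the Cauchy-Schwarz inequality for the difference of the two indicator functions, both
  centre and radius can be varied as long as the balls differ by a set of small measure.\<close>

lemma T_difference:
  assumes f: "bm f" and S: "S \<in> sets \<mu>"
    and diff: "\<And>y. (d x y < s) \<noteq> (d x' y < t) \<Longrightarrow> y \<in> S"
  shows "(T s f x - T t f x')\<^sup>2 \<le> measure \<mu> S * ip f f"
proof -
  let ?k = "\<lambda>y. indicator {y. d x y < s} y - indicator {y. d x' y < t} y :: real"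
  have k: "bm ?k" by (intro bm_diff bm_ball)
  have "T s f x - T t f x' = ip ?k f"
    unfolding T_def ip_def
    using Bochner_Integration.integral_diff[OF bm_integrable[OF bm_mult[OF bm_ball f]] bm_integrable[OF bm_mult[OF bm_ball f]]]
    by (simp add: left_diff_distrib)
  then have "(T s f x - T t f x')\<^sup>2 \<le> ip ?k ?k * ip f f"
    using ip_Cauchy_Schwarz[OF k f] by simp
  also have "ip ?k ?k \<le> (\<integral>y. indicator S y \<partial>\<mu>)"
    unfolding ip_def using S k
    by (intro integral_mono bm_integrable bm_mult bm_indicator)
       (use diff in \<open>auto simp: indicator_def sets_\<mu>\<close>)
  also have "(\<integral>y. indicator S y \<partial>\<mu>) = measure \<mu> S" using S by simp
  finally show ?thesis using ip_ge_0[of f] by (simp add: mult_right_mono)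
qed

lemma T_bound: "bm f \<Longrightarrow> (T t f x)\<^sup>2 \<le> vol * ip f f"
  using T_difference[of f UNIV x t x 0] d_nonneg[of x]
  by (simp add: T_def not_less[THEN iffD2])

text \<open>The bound is uniform in \<open>f\<close>; this makes \<open>T t\<close> a compact operator.\<close>

lemma T_equicontinuous:
  assumes t: "0 < t" and e: "0 < e"
  shows "\<exists>\<delta>>0. \<forall>f x x' s. bm f \<longrightarrow> d x x' < \<delta> \<longrightarrow> \<bar>s - t\<bar> < \<delta> \<longrightarrow> (T s f x' - T t f x)\<^sup>2 \<le> e * ip f f"
proof -
  obtain \<delta> where \<delta>: "\<delta> > 0" "\<And>x. measure \<mu> {y. t - \<delta> \<le> d x y \<and> d x y < t + \<delta>} < e"
    using shell_small[OF t e] by blast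
  have "(T s f x' - T t f x)\<^sup>2 \<le> e * ip f f" if f: "bm f" and x: "d x x' < \<delta> / 2" "\<bar>s - t\<bar> < \<delta> / 2" for f x x' s
  proof -
    have "(T s f x' - T t f x)\<^sup>2 \<le> measure \<mu> {y. t - \<delta> \<le> d x y \<and> d x y < t + \<delta>} * ip f f"
    proof (rule T_difference[OF f level_sets_measurable(4)])
      fix y assume "(d x' y < s) \<noteq> (d x y < t)"
      moreover have "s < t + \<delta> / 2" "t < s + \<delta> / 2" using x(2) by linarith+
      ultimately have "t - \<delta> \<le> d x y" "d x y < t + \<delta>"
        using d_tri[of x y x'] d_tri[of x' y x] d_sym[of x x'] x(1) by linarith+
      then show "y \<in> {y. t - \<delta> \<le> d x y \<and> d x y < t + \<delta>}" by simp
    qed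
    also have "\<dots> \<le> e * ip f f"
      using \<delta>(2)[of x] ip_ge_0[of f] by (intro mult_right_mono) auto
    finally show ?thesis .
  qed
  then show ?thesis using \<delta>(1) by (intro exI[of _ "\<delta> / 2"]) auto
qed

lemma T_continuous:
  assumes f: "bm f" and t: "0 < t"
  shows "continuous_on UNIV (T t f)"
proof (rule continuous_if_uniformly)
  fix e :: real assume e: "0 < e"
  define c where "c = e\<^sup>2 / (ip f f + 1)"
  have c: "0 < c" using e ip_ge_0[of f] by (simp add: c_def add_nonneg_pos)
  have ce: "c * ip f f \<le> e\<^sup>2"
    using ip_ge_0[of f] by (simp add: c_def field_simps)
  obtain \<delta> where \<delta>: "\<delta> > 0"
    "\<And>x x' s. d x x' < \<delta> \<Longrightarrow> \<bar>s - t\<bar> < \<delta> \<Longrightarrow> (T s f x' - T t f x)\<^sup>2 \<le> c * ip f f"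
    using T_equicontinuous[OF t c] f by blast
  have "\<bar>T t f x - T t f y\<bar> \<le> e" if "d x y < \<delta>" for x y
  proof -
    have "(T t f y - T t f x)\<^sup>2 \<le> e\<^sup>2" using \<delta>(2)[OF that, of t] \<delta>(1) ce by simp
    then show ?thesis using e by (simp add: abs_le_square_iff[symmetric] abs_minus_commute)
  qed
  then show "\<exists>\<delta>>0. \<forall>x y. d x y < \<delta> \<longrightarrow> \<bar>T t f x - T t f y\<bar> \<le> e" using \<delta>(1) by blast
qed

lemma T_continuous_radius:
  assumes f: "bm f"
  shows "continuous_on {0<..} (\<lambda>t. T t f x)"
  unfolding continuous_on_iff
proof (intro ballI allI impI)
  fix t e :: real assume t: "t \<in> {0<..}" and e: "0 < e"
  define c where "c = (e / 2)\<^sup>2 / (ip f f + 1)"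
  have c: "0 < c" using e ip_ge_0[of f] by (simp add: c_def add_nonneg_pos)
  have ce: "c * ip f f \<le> (e / 2)\<^sup>2"
    using ip_ge_0[of f] by (simp add: c_def field_simps)
  obtain \<delta> where \<delta>: "\<delta> > 0"
    "\<And>x x' s. d x x' < \<delta> \<Longrightarrow> \<bar>s - t\<bar> < \<delta> \<Longrightarrow> (T s f x' - T t f x)\<^sup>2 \<le> c * ip f f"
    using T_equicontinuous[OF _ c, of t] t f by auto
  have "dist (T s f x) (T t f x) < e" if "dist s t < \<delta>" for s
  proof -
    have "(T s f x - T t f x)\<^sup>2 \<le> (e / 2)\<^sup>2" using \<delta>(2)[of x x s] \<delta>(1) ce that by (simp add: dist_real_def)
    then have "\<bar>T s f x - T t f x\<bar> \<le> e / 2" using e by (simp add: abs_le_square_iff[symmetric])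
    then show ?thesis using e by (simp add: dist_real_def)
  qed
  then show "\<exists>\<delta>>0. \<forall>s\<in>{0<..}. dist s t < \<delta> \<longrightarrow> dist (T s f x) (T t f x) < e" using \<delta>(1) by blast
qed

lemma bm_T: "bm f \<Longrightarrow> 0 < t \<Longrightarrow> bm (T t f)"
  by (rule bm_continuous[OF T_continuous])

sublocale pair: pair_sigma_finite \<mu> \<mu> ..

lemma pair_measurable: "borel_measurable (\<mu> \<Otimes>\<^sub>M \<mu>) = borel_measurable (borel :: ('a \<times> 'a) measure)"
proof (rule measurable_cong_sets[OF _ refl])
  have "sets (\<mu> \<Otimes>\<^sub>M \<mu>) = sets (borel \<Otimes>\<^sub>M (borel :: 'a measure))"
    by (intro sets_pair_measure_cong sets_\<mu>)
  then show "sets (\<mu> \<Otimes>\<^sub>M \<mu>) = sets (borel :: ('a \<times> 'a) measure)" by (simp only: borel_prod)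
qed

lemma kernel_measurable:
  "(\<lambda>p::'a\<times>'a. indicator {y. d (fst p) y < t} (snd p) :: real) \<in> borel_measurable borel"
proof -
  have "open {p::'a\<times>'a. d (fst p) (snd p) < t}"
    by (rule open_Collect_less[OF d_continuous continuous_on_const])
  then have "(\<lambda>p. indicator {p::'a\<times>'a. d (fst p) (snd p) < t} p :: real) \<in> borel_measurable borel"
    by (intro borel_measurable_indicator) auto
  then show ?thesis by (simp add: indicator_def)
qed

lemma Fubini_bounded:
  fixes k :: "'a \<Rightarrow> 'a \<Rightarrow> real"
  assumes "(\<lambda>p. k (fst p) (snd p)) \<in> borel_measurable borel" "\<And>x y. \<bar>k x y\<bar> \<le> M"
  shows "(\<integral>y. (\<integral>x. k x y \<partial>\<mu>) \<partial>\<mu>) = (\<integral>x. (\<integral>y. k x y \<partial>\<mu>) \<partial>\<mu>)"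
proof (rule pair.Fubini_integral)
  interpret P: finite_measure "\<mu> \<Otimes>\<^sub>M \<mu>"
    by (rule finite_measure_pair_measure) (rule finite_measure_axioms)+
  show "integrable (\<mu> \<Otimes>\<^sub>M \<mu>) (case_prod k)"
    using assms by (intro P.integrable_const_bound[of _ M]) (auto simp: pair_measurable case_prod_beta)
qed

lemma fst_snd_measurable:
  "f \<in> borel_measurable borel \<Longrightarrow> (\<lambda>p::'a\<times>'a. f (fst p) :: real) \<in> borel_measurable borel"
  "f \<in> borel_measurable borel \<Longrightarrow> (\<lambda>p::'a\<times>'a. f (snd p) :: real) \<in> borel_measurable borel"
  unfolding borel_prod[symmetric]
  by (rule measurable_compose[OF measurable_fst], assumption,
      rule measurable_compose[OF measurable_snd], assumption)

lemma T_symmetric: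
  assumes f: "bm f" and g: "bm g"
  shows "ip (T t f) g = ip f (T t g)"
proof -
  from f g obtain M N where m: "f \<in> borel_measurable borel" "g \<in> borel_measurable borel"
    and M: "\<And>x. \<bar>f x\<bar> \<le> M" "\<And>x. \<bar>g x\<bar> \<le> N" by (auto simp: bm_def)
  let ?k = "\<lambda>x y. indicator {y. d x y < t} y * (g x * f y)"
  have "ip (T t f) g = (\<integral>x. (\<integral>y. ?k x y \<partial>\<mu>) \<partial>\<mu>)"
    unfolding ip_def T_def
    by (simp add: mult_ac flip: Bochner_Integration.integral_mult_left_zero Bochner_Integration.integral_mult_right_zero)
  also have "\<dots> = (\<integral>y. (\<integral>x. ?k x y \<partial>\<mu>) \<partial>\<mu>)"
  proof (rule Fubini_bounded[symmetric])
    show "(\<lambda>p. ?k (fst p) (snd p)) \<in> borel_measurable borel"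
      by (intro borel_measurable_times kernel_measurable fst_snd_measurable m)
    show "\<bar>?k x y\<bar> \<le> N * M" for x y
      using mult_mono[OF M(2)[of x] M(1)[of y]] M(2)[of x] M(1)[of y]
      by (auto simp: indicator_def abs_mult intro: order_trans)
  qed
  also have "\<dots> = ip f (T t g)"
    unfolding ip_def T_def
    by (intro Bochner_Integration.integral_cong refl)
       (simp add: indicator_def d_sym mult_ac flip: Bochner_Integration.integral_mult_right_zero)
  finally show ?thesis .
qed

text \<open>The kernel of \<open>T s \<circ> T t\<close> at \<open>(x, z)\<close> is the measure of the intersection of the ball of
  radius \<open>s\<close> around \<open>x\<close> and the ball of radius \<open>t\<close> around \<open>z\<close>.  It is symmetric in \<open>s\<close> and \<open>t\<close>,
  because an isometry exchanges \<open>x\<close> and \<open>z\<close>.\<close>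

lemma T_T_kernel:
  assumes f: "bm f"
  shows "T s (T t f) x = (\<integral>z. f z * measure \<mu> ({y. d x y < s} \<inter> {y. d z y < t}) \<partial>\<mu>)"
proof -
  from f obtain M where m: "f \<in> borel_measurable borel" and M: "\<And>x. \<bar>f x\<bar> \<le> M" by (auto simp: bm_def)
  let ?k = "\<lambda>y z. indicator {y. d x y < s} y * (indicator {z. d y z < t} z * f z)"
  have "T s (T t f) x = (\<integral>y. (\<integral>z. ?k y z \<partial>\<mu>) \<partial>\<mu>)"
    unfolding T_def by (simp flip: Bochner_Integration.integral_mult_right_zero)
  also have "\<dots> = (\<integral>z. (\<integral>y. ?k y z \<partial>\<mu>) \<partial>\<mu>)"
  proof (rule Fubini_bounded[symmetric])
    have "(\<lambda>y. indicator {y. d x y < s} y :: real) \<in> borel_measurable borel"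
      using bm_ball[of x s] by (simp add: bm_def)
    then show "(\<lambda>p. ?k (fst p) (snd p)) \<in> borel_measurable borel"
      by (intro borel_measurable_times kernel_measurable fst_snd_measurable m)
    show "\<bar>?k y z\<bar> \<le> M" for y z
      using M[of z] by (auto simp: indicator_def abs_mult intro: order_trans[OF abs_ge_zero])
  qed
  also have "\<dots> = (\<integral>z. f z * measure \<mu> ({y. d x y < s} \<inter> {y. d z y < t}) \<partial>\<mu>)"
  proof (intro Bochner_Integration.integral_cong refl)
    fix z
    have "?k y z = f z * indicator ({y. d x y < s} \<inter> {y. d z y < t}) y" for y
      by (auto simp: indicator_def d_sym)
    then have "(\<integral>y. ?k y z \<partial>\<mu>) = (\<integral>y. f z * indicator ({y. d x y < s} \<inter> {y. d z y < t}) y \<partial>\<mu>)"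
      by presburger
    then show "(\<integral>y. ?k y z \<partial>\<mu>) = f z * measure \<mu> ({y. d x y < s} \<inter> {y. d z y < t})" by simp
  qed
  finally show ?thesis .
qed

lemma T_commute: "bm f \<Longrightarrow> T s (T t f) x = T t (T s f) x"
proof -
  assume f: "bm f"
  have "measure \<mu> ({y. d x y < s} \<inter> {y. d z y < t}) = measure \<mu> ({y. d x y < t} \<inter> {y. d z y < s})" for z
  proof -
    obtain h where h: "h \<in> G" "h x = z" "h z = x" using two_point[of x z z x] d_sym[of x z] by auto
    have "{y. d x y < t} \<inter> {y. d z y < s} \<in> sets borel"
      using level_sets_measurable(1)[of x t] level_sets_measurable(1)[of z s] unfolding sets_\<mu> by simp
    from measure_vimage[OF h(1) this]
    show ?thesis using G_isometry[OF h(1), of x] G_isometry[OF h(1), of z] h(2,3)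
      by (simp add: vimage_def Int_def conj_commute)
  qed
  then show ?thesis by (simp add: T_T_kernel[OF f])
qed


subsection \<open>Compactness of the averaging operators\<close>

lemma countable_dense_subset: "\<exists>R :: 'a set. countable R \<and> (\<forall>x. \<forall>\<delta>>0. \<exists>r\<in>R. d r x < \<delta>)"
proof -
  obtain R :: "'a set" where R: "countable R" "\<And>X. open X \<Longrightarrow> X \<noteq> {} \<Longrightarrow> \<exists>r\<in>R. r \<in> X"
    using countable_dense_setE by blast
  have "\<exists>r\<in>R. d r x < \<delta>" if "\<delta> > 0" for x \<delta>
    using R(2)[OF open_level_sets(1)[of x \<delta>]] that d_self[of x] d_sym[of x] by (metis (mono_tags) empty_iff mem_Collect_eq)
  with R(1) show ?thesis by blast
qed

text \<open>The theorem of Arzela and Ascoli: a subsequence converges on a countable dense set, and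
  equicontinuity makes it uniformly Cauchy.\<close>

lemma equicontinuous_convergent_subsequence:
  fixes F :: "nat \<Rightarrow> 'a \<Rightarrow> real"
  assumes bd: "\<And>n x. \<bar>F n x\<bar> \<le> M"
    and eq: "\<And>e. e > 0 \<Longrightarrow> \<exists>\<delta>>0. \<forall>n x y. d x y < \<delta> \<longrightarrow> \<bar>F n x - F n y\<bar> \<le> e"
  shows "\<exists>k g. strict_mono k \<and> uniform_limit UNIV (\<lambda>n. F (k n)) g sequentially"
proof -
  obtain R :: "'a set" where R: "countable R" "\<And>x \<delta>. \<delta> > 0 \<Longrightarrow> \<exists>r\<in>R. d r x < \<delta>"
    using countable_dense_subset by blast
  obtain k where k: "strict_mono (k :: nat \<Rightarrow> nat)" "\<And>x. x \<in> R \<Longrightarrow> \<exists>l. (\<lambda>n. F (k n) x) \<longlonglongrightarrow> l"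
    by (rule function_convergent_subsequence[OF R(1), of F M]) (use bd in auto)
  have "uniformly_Cauchy_on UNIV (\<lambda>n. F (k n))"
  proof (rule uniformly_Cauchy_onI)
    fix e :: real assume e: "e > 0"
    then have "e / 4 > 0" by simp
    from eq[OF this] obtain \<delta> where \<delta>: "\<delta> > 0" "\<And>n x y. d x y < \<delta> \<Longrightarrow> \<bar>F n x - F n y\<bar> \<le> e / 4"
      by blast
    have op: "\<And>r. r \<in> R \<Longrightarrow> open {x. d r x < \<delta>}" by (rule open_level_sets)
    have cov: "UNIV \<subseteq> (\<Union>r\<in>R. {x. d r x < \<delta>})" using R(2)[OF \<delta>(1)] by auto
    obtain R' where R'0: "R' \<subseteq> R" "finite R'" "UNIV \<subseteq> (\<Union>r\<in>R'. {x. d r x < \<delta>})"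
      using compactE_image[OF compact_UNIV op cov] by metis
    have R': "R' \<subseteq> R" "finite R'" "\<And>x. \<exists>r\<in>R'. d r x < \<delta>"
      using R'0 by auto
    have "\<exists>N. \<forall>m\<ge>N. \<forall>n\<ge>N. \<bar>F (k m) r - F (k n) r\<bar> < e / 4" if "r \<in> R'" for r
    proof -
      have "Cauchy (\<lambda>n. F (k n) r)"
        using k(2)[of r] that R'(1) LIMSEQ_imp_Cauchy by blast
      from CauchyD[OF this, of "e / 4"] e show ?thesis by simp
    qed
    then obtain N where N: "\<And>r m n. r \<in> R' \<Longrightarrow> m \<ge> N r \<Longrightarrow> n \<ge> N r \<Longrightarrow> \<bar>F (k m) r - F (k n) r\<bar> < e / 4"
      by metis
    have "dist (F (k m) x) (F (k n) x) < e" if "m \<ge> Max (N ` R')" "n \<ge> Max (N ` R')" for x m n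
    proof -
      obtain r where r: "r \<in> R'" "d r x < \<delta>" using R'(3) by blast
      have "N r \<le> Max (N ` R')" using R'(2) r(1) by simp
      then have "\<bar>F (k m) r - F (k n) r\<bar> < e / 4" using that by (intro N[OF r(1)]) auto
      moreover have "\<bar>F (k m) r - F (k m) x\<bar> \<le> e / 4" "\<bar>F (k n) r - F (k n) x\<bar> \<le> e / 4"
        using \<delta>(2)[OF r(2)] by auto
      ultimately show ?thesis using e unfolding dist_real_def by linarith
    qed
    then show "\<exists>M. \<forall>x\<in>UNIV. \<forall>m\<ge>M. \<forall>n\<ge>M. dist (F (k m) x) (F (k n) x) < e" by blast
  qed
  then show ?thesis
    using k(1) Cauchy_uniformly_convergent unfolding uniformly_convergent_on_def by blast
qed

text \<open>Closed subspaces of the Banach space of continuous functions that the averages preserve.\<close>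

definition invariant_subspace :: "('a \<Rightarrow> real) set \<Rightarrow> bool" where
  "invariant_subspace V \<longleftrightarrow>
     (\<forall>f\<in>V. continuous_on UNIV f) \<and> (\<lambda>x. 0) \<in> V \<and>
     (\<forall>f\<in>V. \<forall>g\<in>V. \<forall>a b. (\<lambda>x. a * f x + b * g x) \<in> V) \<and>
     (\<forall>f\<in>V. \<forall>t>0. T t f \<in> V) \<and>
     (\<forall>F g. (\<forall>n. F n \<in> V) \<and> uniform_limit UNIV F g sequentially \<longrightarrow> g \<in> V)"

lemma invariant_subspaceD:
  assumes "invariant_subspace V"
  shows "f \<in> V \<Longrightarrow> continuous_on UNIV f" "(\<lambda>x. 0) \<in> V"
    "f \<in> V \<Longrightarrow> g \<in> V \<Longrightarrow> (\<lambda>x. a * f x + b * g x) \<in> V"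
    "f \<in> V \<Longrightarrow> 0 < t \<Longrightarrow> T t f \<in> V"
    "(\<And>n. F n \<in> V) \<Longrightarrow> uniform_limit UNIV F g sequentially \<Longrightarrow> g \<in> V"
    "f \<in> V \<Longrightarrow> bm f"
  using assms bm_continuous unfolding invariant_subspace_def by blast+

lemma invariant_subspace_inner_function_space:
  assumes "invariant_subspace V"
  shows "inner_function_space V ip"
proof
  note VD = invariant_subspaceD[OF assms]
  show "ip (\<lambda>x. a * f x + b * g x) h = a * ip f h + b * ip g h" if "f \<in> V" "g \<in> V" "h \<in> V" for f g h a b
    by (rule ip_linear[OF VD(6)[OF that(1)] VD(6)[OF that(2)] VD(6)[OF that(3)]])
  show "(\<lambda>x. a * f x + b * g x) \<in> V" if "f \<in> V" "g \<in> V" for f g a b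
    by (rule VD(3)[OF that])
  show "f = (\<lambda>x. 0)" if "f \<in> V" "ip f f = 0" for f
    by (rule ip_eq_0[OF VD(1)[OF that(1)] that(2)])
qed (rule invariant_subspaceD(2)[OF assms] ip_commute ip_ge_0)+

lemma invariant_subspace_all: "invariant_subspace {f. continuous_on UNIV f}"
  unfolding invariant_subspace_def
proof (intro conjI ballI allI impI; (elim conjE)?)
  fix F g assume "\<forall>n. F n \<in> {f. continuous_on UNIV f}" "uniform_limit UNIV F g sequentially"
  then show "g \<in> {f. continuous_on UNIV f}"
    by (auto intro!: uniform_limit_theorem[where F = sequentially and f = F])
qed (auto intro!: T_continuous bm_continuous continuous_on_add continuous_on_mult continuous_on_const)

lemma T_uniform_limit:
  assumes F: "\<And>n. bm (F n)" and g: "bm g" and lim: "uniform_limit UNIV F g sequentially"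
  shows "uniform_limit UNIV (\<lambda>n. T t (F n)) (T t g) sequentially"
  unfolding uniform_limit_sequentially_iff
proof (intro allI impI)
  fix e :: real assume e: "e > 0"
  define c where "c = e / (2 * (vol + 1))"
  have c: "c > 0" using e vol_pos by (simp add: c_def)
  obtain N where N: "\<And>n x. n \<ge> N \<Longrightarrow> dist (F n x) (g x) < c"
    using lim c by (force simp: uniform_limit_sequentially_iff)
  have "dist (T t (F n) x) (T t g x) < e" if n: "n \<ge> N" for n x
  proof -
    have b: "bm (\<lambda>x. F n x - g x)" by (intro bm_diff F g)
    have "ip (\<lambda>x. F n x - g x) (\<lambda>x. F n x - g x) \<le> c\<^sup>2 * vol"
    proof (rule ip_le_sup[OF b])
      fix x
      have "\<bar>F n x - g x\<bar> \<le> c" using N[OF n, of x] by (simp add: dist_real_def)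
      from power_mono[OF this, of 2] show "(F n x - g x)\<^sup>2 \<le> c\<^sup>2" by simp
    qed
    then have "vol * ip (\<lambda>x. F n x - g x) (\<lambda>x. F n x - g x) \<le> vol * (c\<^sup>2 * vol)"
      by (intro mult_left_mono) (auto simp: measure_nonneg)
    with T_bound[OF b, of t x] have "(T t (F n) x - T t g x)\<^sup>2 \<le> (c * vol)\<^sup>2"
      by (simp add: T_diff[OF F g] power2_eq_square mult_ac)
    then have "\<bar>T t (F n) x - T t g x\<bar> \<le> c * vol"
      using c by (simp add: abs_le_square_iff[symmetric])
    also have "c * vol < e"
    proof -
      have "e * vol < e * (2 * (vol + 1))" using e vol_pos by (intro mult_strict_left_mono) auto
      then show ?thesis using vol_pos by (simp add: c_def pos_divide_less_eq)
    qed
    finally show ?thesis by (simp add: dist_real_def)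
  qed
  then show "\<exists>N. \<forall>n\<ge>N. \<forall>x\<in>UNIV. dist (T t (F n) x) (T t g x) < e" by blast
qed

lemma invariant_subspace_eigenspace_of:
  assumes V: "invariant_subspace V"
    and lin: "\<And>f g a b. f \<in> V \<Longrightarrow> g \<in> V \<Longrightarrow>
                P (\<lambda>x. a * f x + b * g x) = (\<lambda>x. a * P f x + b * P g x)"
    and comm: "\<And>f s. f \<in> V \<Longrightarrow> 0 < s \<Longrightarrow> P (T s f) = T s (P f)"
    and cont: "\<And>F f. (\<And>n. F n \<in> V) \<Longrightarrow> f \<in> V \<Longrightarrow> uniform_limit UNIV F f sequentially \<Longrightarrow>
                uniform_limit UNIV (\<lambda>n. P (F n)) (P f) sequentially"
  shows "invariant_subspace {f \<in> V. \<forall>x. P f x = c * f x}"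
proof -
  note VD = invariant_subspaceD[OF V]
  show ?thesis
    unfolding invariant_subspace_def
  proof (intro conjI ballI allI impI; (elim conjE)?)
    fix F g assume F: "\<forall>n. F n \<in> {f \<in> V. \<forall>x. P f x = c * f x}"
      and lim: "uniform_limit UNIV F g sequentially"
    then have FV: "\<And>n. F n \<in> V" by blast
    then have g: "g \<in> V" using VD(5) lim by blast
    have "P g x = c * g x" for x
    proof (rule LIMSEQ_unique)
      show "(\<lambda>n. P (F n) x) \<longlonglongrightarrow> P g x"
        by (rule tendsto_uniform_limitI[OF cont[OF FV g lim]]) simp
      have "(\<lambda>n. F n x) \<longlonglongrightarrow> g x" by (rule tendsto_uniform_limitI[OF lim]) simp
      then have "(\<lambda>n. c * F n x) \<longlonglongrightarrow> c * g x" by (intro tendsto_mult tendsto_const)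
      then show "(\<lambda>n. P (F n) x) \<longlonglongrightarrow> c * g x" using F by simp
    qed
    with g show "g \<in> {f \<in> V. \<forall>x. P f x = c * f x}" by simp
  next
    fix f s assume f: "f \<in> {f \<in> V. \<forall>x. P f x = c * f x}" and s: "0 < (s::real)"
    then have "P f = (\<lambda>x. c * f x)" by auto
    then have "P (T s f) x = c * T s f x" for x
      using comm[of f s] f s by (simp add: T_scale)
    then show "T s f \<in> {f \<in> V. \<forall>x. P f x = c * f x}" using f VD(4)[OF _ s] by auto
  next
    show "(\<lambda>x. 0) \<in> {f \<in> V. \<forall>x. P f x = c * f x}" using VD(2) lin[OF VD(2) VD(2), of 0 0] by simp
  next
    fix f g a b assume "f \<in> {f \<in> V. \<forall>x. P f x = c * f x}" "g \<in> {f \<in> V. \<forall>x. P f x = c * f x}"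
    then show "(\<lambda>x. a * f x + b * g x) \<in> {f \<in> V. \<forall>x. P f x = c * f x}"
      using VD(3) lin by (simp add: distrib_left mult.left_commute)
  qed (use VD(1) in auto)
qed

lemma invariant_subspace_eigenspace:
  assumes V: "invariant_subspace V"
  shows "invariant_subspace {f \<in> V. \<forall>x. T t f x = c * f x}"
proof (rule invariant_subspace_eigenspace_of[OF V])
  note bm = invariant_subspaceD(6)[OF V]
  show "T t (\<lambda>x. a * f x + b * g x) = (\<lambda>x. a * T t f x + b * T t g x)" if "f \<in> V" "g \<in> V" for f g a b
    using T_linear[OF bm[OF that(1)] bm[OF that(2)]] by blast
  show "T t (T s f) = T s (T t f)" if "f \<in> V" for f s
    using T_commute[OF bm[OF that]] by blast
qed (intro T_uniform_limit invariant_subspaceD(6)[OF V])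

lemma invariant_subspace_Inter:
  assumes "K \<noteq> {}" "\<And>i. i \<in> K \<Longrightarrow> invariant_subspace (V i)"
  shows "invariant_subspace (\<Inter>i\<in>K. V i)"
proof -
  note D = invariant_subspaceD[OF assms(2)]
  show ?thesis
    unfolding invariant_subspace_def
  proof (intro conjI ballI allI impI; (elim conjE)?)
    fix F g assume "\<forall>n. F n \<in> (\<Inter>i\<in>K. V i)" "uniform_limit UNIV F g sequentially"
    then show "g \<in> (\<Inter>i\<in>K. V i)" using D(5)[of _ F g] by blast
  qed (use assms(1) D(1-4) in auto)
qed

text \<open>Maximise the quadratic form on the unit sphere. The Cauchy-Schwarz inequality for the
  defect form shows that a maximising sequence consists of approximate eigenvectors.\<close>

lemma exists_positive_eigenvector:
  fixes a b \<sigma> :: real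
  defines "R \<equiv> \<lambda>f x. \<sigma> * T a (T b f) x"
  assumes V: "invariant_subspace V" and ab: "0 < a" "0 < b"
    and f0: "f0 \<in> V" "0 < ip (R f0) f0"
  shows "\<exists>\<rho>>0. \<exists>g\<in>V. g \<noteq> (\<lambda>x. 0) \<and> (\<forall>x. R g x = \<rho> * g x)"
proof -
  note VD = invariant_subspaceD[OF V]
  interpret V: inner_function_space V ip by (rule invariant_subspace_inner_function_space[OF V])
  have RV: "R f \<in> V" if "f \<in> V" for f
    unfolding R_def by (rule V.scale_mem[OF VD(4)[OF VD(4)[OF that ab(2)] ab(1)]])
  have Rlin: "R (\<lambda>x. c * f x + c' * g x) = (\<lambda>x. c * R f x + c' * R g x)" if "f \<in> V" "g \<in> V" for f g c c'
  proof -
    have "T b (\<lambda>x. c * f x + c' * g x) = (\<lambda>x. c * T b f x + c' * T b g x)"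
      using T_linear[OF VD(6)[OF that(1)] VD(6)[OF that(2)]] by blast
    then have "T a (T b (\<lambda>x. c * f x + c' * g x)) x = c * T a (T b f) x + c' * T a (T b g) x" for x
      by (simp only: T_linear[OF bm_T[OF VD(6)[OF that(1)] ab(2)] bm_T[OF VD(6)[OF that(2)] ab(2)]])
    then show ?thesis unfolding R_def by (simp only: distrib_left mult.left_commute)
  qed
  have Rdiff: "R (\<lambda>x. f x - g x) = (\<lambda>x. R f x - R g x)" if "f \<in> V" "g \<in> V" for f g
    using Rlin[OF that, of 1 "-1"] by simp
  have Rscale: "R (\<lambda>x. c * f x) = (\<lambda>x. c * R f x)" if "f \<in> V" for f c
    using Rlin[OF that that, of c 0] by simp
  have Rsym: "ip (R f) g = ip f (R g)" if "f \<in> V" "g \<in> V" for f g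
  proof -
    have bm: "bm f" "bm g" "bm (T b f)" "bm (T a g)" "bm (T b g)" using that VD(6) bm_T ab by auto
    have "ip (T a (T b f)) g = ip f (T b (T a g))"
      using T_symmetric[OF bm(3,2)] T_symmetric[OF bm(1,4)] by simp
    also have "T b (T a g) = T a (T b g)" using T_commute[OF bm(2)] by blast
    finally show ?thesis unfolding R_def by (simp add: ip_scale_left ip_scale_right)
  qed
  \<comment> \<open>\<open>R\<close> is bounded and compact as a map from the norm of \<open>ip\<close> to the supremum norm.\<close>
  define K where "K = \<sigma>\<^sup>2 * (vol * (vol * vol))"
  have K0: "0 \<le> K" by (simp add: K_def)
  have Tb: "ip (T b f) (T b f) \<le> vol * ip f f * vol" if "bm f" for f
    by (rule ip_le_sup[OF bm_T[OF that ab(2)] T_bound[OF that]])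
  have Rbd: "(R f x)\<^sup>2 \<le> K * ip f f" if f: "f \<in> V" for f x
  proof -
    have "(T a (T b f) x)\<^sup>2 \<le> vol * ip (T b f) (T b f)" by (rule T_bound[OF bm_T[OF VD(6)[OF f] ab(2)]])
    also have "\<dots> \<le> vol * (vol * ip f f * vol)"
      by (intro mult_left_mono Tb VD(6)[OF f]) simp
    finally have "\<sigma>\<^sup>2 * (T a (T b f) x)\<^sup>2 \<le> \<sigma>\<^sup>2 * (vol * (vol * ip f f * vol))"
      by (intro mult_left_mono) auto
    then show ?thesis by (simp add: R_def K_def power_mult_distrib mult_ac)
  qed
  have Requi: "\<exists>\<delta>>0. \<forall>f x y. f \<in> V \<longrightarrow> ip f f \<le> 1 \<longrightarrow> d x y < \<delta> \<longrightarrow> \<bar>R f x - R f y\<bar> \<le> e" if e: "e > 0" for e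
  proof -
    define c where "c = e\<^sup>2 / (\<sigma>\<^sup>2 * (vol * vol) + 1)"
    have den: "0 < \<sigma>\<^sup>2 * (vol * vol) + 1" by (intro add_nonneg_pos) auto
    have c: "c > 0" using e den by (simp add: c_def)
    have ce: "\<sigma>\<^sup>2 * (c * (vol * vol)) \<le> e\<^sup>2"
    proof -
      have "\<sigma>\<^sup>2 * (c * (vol * vol)) = c * (\<sigma>\<^sup>2 * (vol * vol))" by simp
      also have "\<dots> \<le> c * (\<sigma>\<^sup>2 * (vol * vol) + 1)" using c by (intro mult_left_mono) auto
      also have "\<dots> = e\<^sup>2" using den by (simp add: c_def)
      finally show ?thesis .
    qed
    obtain \<delta> where \<delta>: "\<delta> > 0"
      "\<And>f x x' s. bm f \<Longrightarrow> d x x' < \<delta> \<Longrightarrow> \<bar>s - a\<bar> < \<delta> \<Longrightarrow> (T s f x' - T a f x)\<^sup>2 \<le> c * ip f f"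
      using T_equicontinuous[OF ab(1) c] by blast
    have "\<bar>R f x - R f y\<bar> \<le> e" if f: "f \<in> V" "ip f f \<le> 1" "d x y < \<delta>" for f x y
    proof -
      have bf: "bm f" using VD(6) f(1) by blast
      have "(T a (T b f) y - T a (T b f) x)\<^sup>2 \<le> c * ip (T b f) (T b f)"
        using \<delta>(1) by (intro \<delta>(2) bm_T bf ab f) auto
      also have "\<dots> \<le> c * (vol * ip f f * vol)" using c by (intro mult_left_mono Tb bf) auto
      also have "\<dots> \<le> c * (vol * 1 * vol)" using c f(2) by (intro mult_left_mono mult_right_mono) auto
      finally have "\<sigma>\<^sup>2 * (T a (T b f) y - T a (T b f) x)\<^sup>2 \<le> \<sigma>\<^sup>2 * (c * (vol * vol))"
        by (intro mult_left_mono) auto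
      then have "(\<sigma> * (T a (T b f) y - T a (T b f) x))\<^sup>2 \<le> e\<^sup>2"
        using ce by (simp add: power_mult_distrib)
      moreover have "R f x - R f y = - (\<sigma> * (T a (T b f) y - T a (T b f) x))"
        by (simp add: R_def algebra_simps)
      ultimately have "(R f x - R f y)\<^sup>2 \<le> e\<^sup>2" by (metis power2_minus)
      then show ?thesis using e by (simp add: abs_le_square_iff[symmetric])
    qed
    with \<delta>(1) show ?thesis by blast
  qed
  have ipR: "ip (R f) (R f) \<le> K * ip f f * vol" if "f \<in> V" for f
    by (rule ip_le_sup[OF VD(6)[OF RV[OF that]] Rbd[OF that]])
  define \<kappa> where "\<kappa> = sqrt (K * vol)"
  have quad: "\<bar>ip (R f) f\<bar> \<le> \<kappa> * ip f f" if f: "f \<in> V" for f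
  proof -
    have "(ip (R f) f)\<^sup>2 \<le> ip (R f) (R f) * ip f f"
      by (rule ip_Cauchy_Schwarz[OF VD(6)[OF RV[OF f]] VD(6)[OF f]])
    also have "\<dots> \<le> (K * ip f f * vol) * ip f f" by (intro mult_right_mono ipR f ip_ge_0)
    also have "\<dots> = (\<kappa> * ip f f)\<^sup>2" using K0 by (simp add: \<kappa>_def power_mult_distrib power2_eq_square)
    finally show ?thesis
      using K0 ip_ge_0[of f] by (simp add: abs_le_square_iff[symmetric] \<kappa>_def abs_of_nonneg)
  qed
  define U where "U = {f \<in> V. ip f f = 1}"
  define \<rho> where "\<rho> = Sup ((\<lambda>f. ip (R f) f) ` U)"
  have bdd: "bdd_above ((\<lambda>f. ip (R f) f) ` U)"
  proof (rule bdd_aboveI2)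
    fix f assume "f \<in> U"
    then show "ip (R f) f \<le> \<kappa>" using quad[of f] by (simp add: U_def)
  qed
  have f0p: "0 < ip f0 f0"
  proof -
    have "ip f0 f0 \<noteq> 0" using quad[OF f0(1)] f0(2) by auto
    then show ?thesis using ip_ge_0[of f0] by simp
  qed
  define u0 where "u0 = (\<lambda>x. (1 / sqrt (ip f0 f0)) * f0 x)"
  have u0: "u0 \<in> V" unfolding u0_def by (rule V.scale_mem[OF f0(1)])
  have u0U: "u0 \<in> U"
    using u0 f0p unfolding U_def u0_def by (simp only: ip_scale_left ip_scale_right mem_Collect_eq) simp
  have "ip (R u0) u0 = (1 / sqrt (ip f0 f0)) * ((1 / sqrt (ip f0 f0)) * ip (R f0) f0)"
    unfolding u0_def Rscale[OF f0(1)] by (simp only: ip_scale_left ip_scale_right)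
  then have "0 < ip (R u0) u0" using f0(2) f0p by simp
  also have "\<dots> \<le> \<rho>" unfolding \<rho>_def using u0U bdd by (intro cSup_upper) auto
  finally have \<rho>0: "0 < \<rho>" .
  have qle: "ip (R f) f \<le> \<rho> * ip f f" if f: "f \<in> V" for f
  proof (cases "ip f f = 0")
    case True then show ?thesis using quad[OF f] by simp
  next
    case False
    then have p: "0 < ip f f" using ip_ge_0[of f] by simp
    define u where "u = (\<lambda>x. (1 / sqrt (ip f f)) * f x)"
    have "u \<in> V" unfolding u_def by (rule V.scale_mem[OF f])
    then have "u \<in> U"
      using p unfolding U_def u_def by (simp only: ip_scale_left ip_scale_right mem_Collect_eq) simp
    then have "ip (R u) u \<le> \<rho>" unfolding \<rho>_def using bdd by (intro cSup_upper) auto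
    moreover have "ip (R u) u = (1 / sqrt (ip f f)) * ((1 / sqrt (ip f f)) * ip (R f) f)"
      unfolding u_def Rscale[OF f] by (simp only: ip_scale_left ip_scale_right)
    ultimately show ?thesis using p by (simp add: field_simps)
  qed
  have "\<exists>f\<in>U. \<rho> - 1 / real (Suc n) < ip (R f) f" for n
  proof -
    have "\<rho> - 1 / real (Suc n) < Sup ((\<lambda>f. ip (R f) f) ` U)" by (simp add: \<rho>_def)
    then show ?thesis using less_cSup_iff[OF _ bdd] u0U by blast
  qed
  then obtain f where f: "\<And>n. f n \<in> U" "\<And>n. \<rho> - 1 / real (Suc n) < ip (R (f n)) (f n)" by metis
  have fV: "f n \<in> V" and f1: "ip (f n) (f n) = 1" for n using f(1) by (auto simp: U_def)
  \<comment> \<open>The defect form \<open>ip (Q f) f\<close> is nonnegative because \<open>\<rho>\<close> is the supremum.\<close>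
  define Q where "Q f = (\<lambda>x. \<rho> * f x + (-1) * R f x)" for f
  have QV: "Q f \<in> V" if "f \<in> V" for f
    unfolding Q_def by (rule V.lin_mem[OF that RV[OF that]])
  have ipQ: "ip (Q f) h = \<rho> * ip f h - ip (R f) h" if "f \<in> V" "h \<in> V" for f h
    unfolding Q_def using V.ip_lin[OF that(1) RV[OF that(1)] that(2), of \<rho> "-1"] by simp
  have Qpos: "0 \<le> ip (Q f) f" if "f \<in> V" for f
    using qle[OF that] ipQ[OF that that] by simp
  have defect: "(ip (Q g) h)\<^sup>2 \<le> ip (Q g) g * ip (Q h) h" if "g \<in> V" "h \<in> V" for g h
  proof (rule V.positive_form_Cauchy_Schwarz[OF QV _ _ Qpos that])
    show "Q (\<lambda>x. a * f x + b * g x) = (\<lambda>x. a * Q f x + b * Q g x)" if "f \<in> V" "g \<in> V" for f g a b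
      unfolding Q_def Rlin[OF that] by (simp add: algebra_simps)
    show "ip (Q f) g = ip f (Q g)" if "f \<in> V" "g \<in> V" for f g
      using ipQ[OF that] ipQ[OF that(2,1)] Rsym[OF that] by (simp add: ip_commute)
  qed
  define w where "w n = Q (f n)" for n
  have wV: "w n \<in> V" for n unfolding w_def by (rule QV[OF fV])
  have ww: "ip (w n) (w n) \<le> (\<rho> + \<kappa>) / real (Suc n)" for n
  proof -
    let ?W = "ip (w n) (w n)"
    have "?W\<^sup>2 \<le> ip (w n) (f n) * ip (Q (w n)) (w n)"
      using defect[OF fV wV, of n n] by (simp add: w_def)
    also have "\<dots> \<le> (1 / real (Suc n)) * ((\<rho> + \<kappa>) * ?W)"
    proof (rule mult_mono)
      show "ip (w n) (f n) \<le> 1 / real (Suc n)" unfolding w_def using ipQ[OF fV fV] f(2)[of n] f1 by simp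
      show "ip (Q (w n)) (w n) \<le> (\<rho> + \<kappa>) * ?W"
        using quad[OF wV[of n]] ipQ[OF wV wV, of n n] unfolding distrib_right by linarith
    qed (use Qpos[OF wV] in auto)
    finally have "?W * ?W \<le> ((\<rho> + \<kappa>) / real (Suc n)) * ?W" by (simp add: power2_eq_square)
    moreover have "0 \<le> (\<rho> + \<kappa>) / real (Suc n)" using \<rho>0 K0 by (simp add: \<kappa>_def)
    ultimately show ?thesis using ip_ge_0[of "w n"]
      by (metis mult_le_cancel_right order_le_less not_less)
  qed
  define M where "M = sqrt K"
  have "\<bar>R (f n) x\<bar> \<le> M" for n x
    using Rbd[OF fV, of n x] f1 real_sqrt_le_mono[of "(R (f n) x)\<^sup>2" K] by (simp add: M_def)
  moreover have "\<exists>\<delta>>0. \<forall>n x y. d x y < \<delta> \<longrightarrow> \<bar>R (f n) x - R (f n) y\<bar> \<le> e" if "e > 0" for e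
    using Requi[OF that] fV f1 by (metis order_refl)
  ultimately obtain k g where k: "strict_mono k" and lim: "uniform_limit UNIV (\<lambda>n. R (f (k n))) g sequentially"
    using equicontinuous_convergent_subsequence[of "\<lambda>n. R (f n)" M] by blast
  have gV: "g \<in> V" by (rule VD(5)[OF RV[OF fV] lim])
  have ww0: "(\<lambda>n. ip (w (k n)) (w (k n))) \<longlonglongrightarrow> 0"
  proof (rule tendsto_sandwich[OF _ _ tendsto_const])
    have "(\<lambda>n. (\<rho> + \<kappa>) / real (Suc n)) \<longlonglongrightarrow> 0"
      using tendsto_mult[OF tendsto_const LIMSEQ_inverse_real_of_nat, of "\<rho> + \<kappa>"]
      by (simp add: field_class.field_divide_inverse)
    then show "(\<lambda>n. (\<rho> + \<kappa>) / real (Suc (k n))) \<longlonglongrightarrow> 0"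
      using k LIMSEQ_subseq_LIMSEQ[of _ 0 k] by (force simp: o_def)
    show "\<forall>\<^sub>F n in sequentially. ip (w (k n)) (w (k n)) \<le> (\<rho> + \<kappa>) / real (Suc (k n))"
      using ww by simp
  qed (simp add: ip_ge_0)
  \<comment> \<open>\<open>R (w n) = \<rho> * R (f n) - R (R (f n))\<close> tends to zero and to \<open>\<rho> * g - R g\<close>.\<close>
  have eig: "R g x = \<rho> * g x" for x
  proof -
    have gl: "(\<lambda>n. R (f (k n)) x) \<longlonglongrightarrow> g x" by (rule tendsto_uniform_limitI[OF lim]) simp
    have Rw0: "(\<lambda>n. R (w (k n)) x) \<longlonglongrightarrow> 0"
    proof (rule tendsto_norm_zero_cancel, rule tendsto_sandwich[OF _ _ tendsto_const])
      have "(\<lambda>n. sqrt (K * ip (w (k n)) (w (k n)))) \<longlonglongrightarrow> sqrt (K * 0)"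
        by (intro tendsto_real_sqrt tendsto_mult tendsto_const ww0)
      then show "(\<lambda>n. sqrt (K * ip (w (k n)) (w (k n)))) \<longlonglongrightarrow> 0" by simp
      have "norm (R (w n) x) \<le> sqrt (K * ip (w n) (w n))" for n
        using real_sqrt_le_mono[OF Rbd[OF wV, of n x]] by simp
      then show "\<forall>\<^sub>F n in sequentially. norm (R (w (k n)) x) \<le> sqrt (K * ip (w (k n)) (w (k n)))" by simp
    qed simp
    have bmRf: "bm (R (f (k n)))" and bmg: "bm g" for n by (rule VD(6)[OF RV[OF fV]], rule VD(6)[OF gV])
    have "uniform_limit UNIV (\<lambda>n. T a (T b (R (f (k n))))) (T a (T b g)) sequentially"
      by (intro T_uniform_limit bm_T ab bmRf bmg lim)
    then have "(\<lambda>n. T a (T b (R (f (k n)))) x) \<longlonglongrightarrow> T a (T b g) x"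
      by (rule tendsto_uniform_limitI) simp
    then have RR: "(\<lambda>n. R (R (f (k n))) x) \<longlonglongrightarrow> R g x"
      unfolding R_def by (intro tendsto_mult tendsto_const)
    have "R (w n) x = \<rho> * R (f n) x - R (R (f n)) x" for n
      using fun_cong[OF Rlin[OF fV RV[OF fV], of \<rho> n "-1" n], of x] by (simp add: w_def Q_def)
    then have "(\<lambda>n. R (w (k n)) x) \<longlonglongrightarrow> \<rho> * g x - R g x"
      using tendsto_diff[OF tendsto_mult[OF tendsto_const gl] RR, of \<rho>] by simp
    from LIMSEQ_unique[OF this Rw0] show ?thesis by simp
  qed
  \<comment> \<open>\<open>R (f n)\<close> cannot become small, because \<open>ip (R (f n)) (f n)\<close> tends to \<open>\<rho>\<close>.\<close>
  have "g \<noteq> (\<lambda>x. 0)"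
  proof
    assume g0: "g = (\<lambda>x. 0)"
    define c where "c = \<rho> / (2 * (vol + 1))"
    have c: "c > 0" using \<rho>0 vol_pos by (simp add: c_def)
    obtain N where N: "\<And>n x. n \<ge> N \<Longrightarrow> dist (R (f (k n)) x) (g x) < c"
      using lim c by (force simp: uniform_limit_sequentially_iff)
    obtain n0 where n0: "1 / real (Suc n0) < \<rho> / 2" using nat_approx_posE[of "\<rho> / 2"] \<rho>0 by auto
    define n where "n = max N n0"
    have "n0 \<le> k n" using seq_suble[OF k, of n] by (simp add: n_def)
    then have "1 / real (Suc (k n)) \<le> 1 / real (Suc n0)" by (intro frac_le) auto
    then have q: "\<rho> / 2 < ip (R (f (k n))) (f (k n))" using f(2)[of "k n"] n0 by simp
    have "(ip (R (f (k n))) (f (k n)))\<^sup>2 \<le> ip (R (f (k n))) (R (f (k n))) * ip (f (k n)) (f (k n))"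
      by (rule ip_Cauchy_Schwarz[OF VD(6)[OF RV[OF fV]] VD(6)[OF fV]])
    also have "\<dots> = ip (R (f (k n))) (R (f (k n)))" using f1 by simp
    also have "\<dots> \<le> c\<^sup>2 * vol"
    proof (rule ip_le_sup[OF VD(6)[OF RV[OF fV]]])
      fix x
      have "\<bar>R (f (k n)) x\<bar> \<le> c" using N[of n x] g0 by (simp add: n_def dist_real_def)
      from power_mono[OF this, of 2] show "(R (f (k n)) x)\<^sup>2 \<le> c\<^sup>2" by simp
    qed
    also have "\<dots> \<le> (\<rho> / 2)\<^sup>2"
    proof -
      have "c\<^sup>2 * vol \<le> c\<^sup>2 * (vol + 1)\<^sup>2"
        using vol_pos by (intro mult_left_mono) (auto simp: power2_eq_square algebra_simps)
      also have "\<dots> = (c * (vol + 1))\<^sup>2" by (simp add: power_mult_distrib)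
      also have "c * (vol + 1) = \<rho> / 2"
      proof -
        have "\<rho> / (2 * X) * X = \<rho> / 2" if "X \<noteq> 0" for X :: real using that by simp
        from this[of "vol + 1"] show ?thesis using vol_pos by (simp only: c_def)
      qed
      finally show ?thesis .
    qed
    finally have "ip (R (f (k n))) (f (k n)) \<le> \<rho> / 2"
      by (rule power2_le_imp_le) (use \<rho>0 in simp)
    with q show False by simp
  qed
  with \<rho>0 gV eig show ?thesis by blast
qed


subsection \<open>Simultaneous eigenfunctions\<close>

lemma orthonormal_card:
  assumes V: "invariant_subspace V" and on: "inner_function_space.orthonormal V ip e n"
  shows "real n = (\<integral>x. (\<Sum>i<n. (e i x)\<^sup>2) \<partial>\<mu>)"
proof -
  interpret V: inner_function_space V ip by (rule invariant_subspace_inner_function_space[OF V])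
  have bme: "i < n \<Longrightarrow> bm (e i)" for i
    using on invariant_subspaceD(6)[OF V] by (auto simp: V.orthonormal_def)
  have "real n = (\<Sum>i<n. ip (e i) (e i))" using on by (simp add: V.orthonormal_def)
  also have "\<dots> = (\<integral>x. (\<Sum>i<n. (e i x)\<^sup>2) \<partial>\<mu>)"
    unfolding ip_def power2_eq_square
    by (subst Bochner_Integration.integral_sum) (auto intro!: bm_integrable bm_mult bme)
  finally show ?thesis .
qed

text \<open>Continuous point evaluations force finite dimension, as integrating the bound for the
  diagonal of the kernel \<open>\<Sum>i. e i x * e i y\<close> shows.\<close>

lemma exists_basis:
  assumes V: "invariant_subspace V" and C: "0 \<le> C" and ev: "\<And>f x. f \<in> V \<Longrightarrow> (f x)\<^sup>2 \<le> C * ip f f"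
  shows "\<exists>e n. inner_function_space.orthonormal V ip e n \<and>
           (\<forall>e' n'. inner_function_space.orthonormal V ip e' n' \<longrightarrow> n' \<le> n)"
proof -
  interpret V: inner_function_space V ip by (rule invariant_subspace_inner_function_space[OF V])
  have "n \<le> nat \<lceil>C * vol\<rceil>" if on: "V.orthonormal e n" for e n
  proof -
    have "real n \<le> (\<integral>x. C \<partial>\<mu>)"
      unfolding orthonormal_card[OF V on]
    proof (rule integral_mono)
      have "bm (e i)" if "i < n" for i
        using on that invariant_subspaceD(6)[OF V] by (auto simp: V.orthonormal_def)
      then show "integrable \<mu> (\<lambda>x. \<Sum>i<n. (e i x)\<^sup>2)"
        unfolding power2_eq_square by (intro Bochner_Integration.integrable_sum bm_integrable bm_mult) auto
      show "(\<Sum>i<n. (e i x)\<^sup>2) \<le> C" for x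
        by (rule V.orthonormal_diagonal_le[OF on C ev])
    qed (rule bm_integrable[OF bm_const])
    then have "real n \<le> C * vol" by (simp add: mult.commute)
    then show ?thesis by linarith
  qed
  then show ?thesis using V.exists_maximal_orthonormal[of "nat \<lceil>C * vol\<rceil>"] by metis
qed

text \<open>Among the nonzero invariant subspaces choose one of minimal dimension. An eigenspace of
  one averaging operator in it is again an invariant subspace, hence everything.\<close>

lemma exists_simultaneous_eigenfunction:
  assumes E: "invariant_subspace E" and f0: "f0 \<in> E" "f0 \<noteq> (\<lambda>x. 0)"
    and C: "0 \<le> C" and ev: "\<And>f x. f \<in> E \<Longrightarrow> (f x)\<^sup>2 \<le> C * ip f f"
  shows "\<exists>f\<in>E. f \<noteq> (\<lambda>x. 0) \<and> (\<exists>\<Lambda>. \<forall>t>0. \<forall>x. T t f x = \<Lambda> t * f x)"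
proof -
  define sub where "sub W \<longleftrightarrow> invariant_subspace W \<and> W \<subseteq> E \<and> W \<noteq> {\<lambda>x. 0}" for W
  define basis where "basis W e n \<longleftrightarrow> inner_function_space.orthonormal W ip e n \<and>
      (\<forall>e' n'. inner_function_space.orthonormal W ip e' n' \<longrightarrow> n' \<le> n)" for W e n
  have exb: "\<exists>e n. basis W e n" if W: "sub W" for W
    unfolding basis_def by (rule exists_basis[OF _ C ev]) (use W in \<open>auto simp: sub_def\<close>)
  have "sub E" using E f0 by (auto simp: sub_def)
  then have "\<exists>n. \<exists>W e. sub W \<and> basis W e n" using exb by blast
  note ex = this
  define n where "n = (LEAST n. \<exists>W e. sub W \<and> basis W e n)"
  have least: "n \<le> m" if "\<exists>W e. sub W \<and> basis W e m" for m
    using that unfolding n_def by (rule Least_le[of "\<lambda>n. \<exists>W e. sub W \<and> basis W e n"])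
  have "\<exists>W e. sub W \<and> basis W e n" unfolding n_def by (rule LeastI_ex[OF ex])
  then obtain W e where W: "sub W" and b: "basis W e n" by blast
  have Winv: "invariant_subspace W" and WE: "W \<subseteq> E" using W by (auto simp: sub_def)
  note WD = invariant_subspaceD[OF Winv]
  interpret W: inner_function_space W ip by (rule invariant_subspace_inner_function_space[OF Winv])
  have W0: "\<exists>f\<in>W. f \<noteq> (\<lambda>x. 0)" using W WD(2) by (auto simp: sub_def)
  have scalar: "\<exists>c. \<forall>f\<in>W. \<forall>x. T t f x = c * f x" if t: "0 < t" for t
  proof -
    have "\<exists>c. \<exists>g\<in>W. g \<noteq> (\<lambda>x. 0) \<and> (\<forall>x. T t g x = c * g x)"
    proof (cases "\<forall>f\<in>W. T t f = (\<lambda>x. 0)")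
      case True
      then show ?thesis using W0 by (intro exI[of _ 0]) auto
    next
      case False
      then obtain f where f: "f \<in> W" "T t f \<noteq> (\<lambda>x. 0)" by blast
      have bf: "bm f" "bm (T t f)" using WD(6)[OF f(1)] bm_T t by auto
      have "ip (\<lambda>x. 1 * T t (T t f) x) f = ip (T t f) (T t f)"
        using T_symmetric[OF bf(2,1)] by simp
      moreover have "ip (T t f) (T t f) \<noteq> 0"
        using ip_eq_0[OF T_continuous[OF bf(1) t]] f(2) by blast
      ultimately have "0 < ip (\<lambda>x. 1 * T t (T t f) x) f" using ip_ge_0[of "T t f"] by linarith
      from exists_positive_eigenvector[OF Winv t t f(1) this]
      obtain \<rho> g where g: "\<rho> > 0" "g \<in> W" "g \<noteq> (\<lambda>x. 0)" "\<And>x. T t (T t g) x = \<rho> * g x" by auto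
      \<comment> \<open>\<open>T\<^sup>2 g = \<rho> g\<close>, so \<open>T g + sqrt \<rho> g\<close> is an eigenvector for \<open>sqrt \<rho>\<close>, or it is zero and
        \<open>g\<close> is one for \<open>- sqrt \<rho>\<close>.\<close>
      define s where "s = sqrt \<rho>"
      have s: "s * s = \<rho>" using g(1) by (simp add: s_def)
      define g' where "g' = (\<lambda>x. 1 * T t g x + s * g x)"
      have g'W: "g' \<in> W" unfolding g'_def by (rule WD(3)[OF WD(4)[OF g(2) t] g(2)])
      have Tg': "T t g' x = s * g' x" for x
        unfolding g'_def T_linear[OF bm_T[OF WD(6)[OF g(2)] t] WD(6)[OF g(2)]] g(4)
        by (simp add: s[symmetric] algebra_simps)
      show ?thesis
      proof (cases "g' = (\<lambda>x. 0)")
        case True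
        have "1 * T t g x + s * g x = 0" for x
          using fun_cong[OF True, of x] unfolding g'_def .
        then have "T t g x = (- s) * g x" for x by (simp add: eq_neg_iff_add_eq_0)
        then show ?thesis using g(2,3) by blast
      next
        case False
        then show ?thesis using Tg' g'W by blast
      qed
    qed
    then obtain c g where g: "g \<in> W" "g \<noteq> (\<lambda>x. 0)" "\<And>x. T t g x = c * g x" by blast
    define W' where "W' = {f \<in> W. \<forall>x. T t f x = c * f x}"
    have W'inv: "invariant_subspace W'" unfolding W'_def by (rule invariant_subspace_eigenspace[OF Winv])
    have "sub W'" unfolding sub_def using W'inv WE g by (auto simp: W'_def)
    interpret W': inner_function_space W' ip by (rule invariant_subspace_inner_function_space[OF W'inv])
    obtain e' n' where b': "basis W' e' n'" using exb[OF \<open>sub W'\<close>] by blast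
    then have "n \<le> n'" using least \<open>sub W'\<close> by blast
    have on': "W'.orthonormal e' n'" using b' by (simp add: basis_def)
    then have on: "W.orthonormal e' n'"
      unfolding W.orthonormal_def W'.orthonormal_def by (auto simp: W'_def)
    then have "n' \<le> n" using b by (simp add: basis_def)
    have max: "m \<le> n'" if "W.orthonormal u m" for u m
      using that b \<open>n \<le> n'\<close> by (force simp: basis_def)
    have "f \<in> W'" if f: "f \<in> W" for f
    proof -
      have "f = (\<lambda>x. \<Sum>i<n'. ip f (e' i) * e' i x)"
        by (rule ext, rule W.maximal_orthonormal_expansion[OF on _ f]) (rule max)
      moreover have "(\<lambda>x. \<Sum>i<n'. ip f (e' i) * e' i x) \<in> W'"
        using on' by (intro W'.sum_mem) (auto simp: W'.orthonormal_def)
      ultimately show ?thesis by simp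
    qed
    then show ?thesis by (auto simp: W'_def)
  qed
  then obtain \<Lambda> where "\<And>t f x. 0 < t \<Longrightarrow> f \<in> W \<Longrightarrow> T t f x = \<Lambda> t * f x" by metis
  then show ?thesis using W0 WE by blast
qed

definition eigenspace :: "(real \<Rightarrow> real) \<Rightarrow> ('a \<Rightarrow> real) set" where
  "eigenspace \<Lambda> = {f. continuous_on UNIV f \<and> (\<forall>t>0. \<forall>x. T t f x = \<Lambda> t * f x)}"

text \<open>A simultaneous eigenfunction has one eigenvalue for every radius. Fixing the values at
  nonpositive radii makes two elements of the spectrum differ at some positive radius.\<close>

definition spectrum :: "(real \<Rightarrow> real) set" where
  "spectrum = {\<Lambda>. (\<forall>t\<le>0. \<Lambda> t = 0) \<and> eigenspace \<Lambda> \<noteq> {\<lambda>x. 0}}"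

lemma zero_in_eigenspace: "(\<lambda>x. 0) \<in> eigenspace \<Lambda>"
  by (simp add: eigenspace_def T_def)

text \<open>The eigenvectors of \<open>T a \<circ> T b\<close> for a nonzero eigenvalue form an invariant subspace with
  continuous point evaluations, because \<open>T a \<circ> T b\<close> bounds the supremum norm by the norm of
  \<open>ip\<close>. A simultaneous eigenfunction in it keeps the sign of the eigenvalue.\<close>

lemma exists_spectrum_sign:
  fixes a b \<sigma> :: real
  assumes V: "invariant_subspace V" and ab: "0 < a" "0 < b"
    and f0: "f0 \<in> V" "0 < ip (\<lambda>x. \<sigma> * T a (T b f0) x) f0"
  shows "\<exists>\<Lambda>\<in>spectrum. 0 < \<sigma> * (\<Lambda> a * \<Lambda> b) \<and> (\<exists>f\<in>V. f \<noteq> (\<lambda>x. 0) \<and> f \<in> eigenspace \<Lambda>)"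
proof -
  note VD = invariant_subspaceD[OF V]
  obtain \<rho> g where g: "\<rho> > 0" "g \<in> V" "g \<noteq> (\<lambda>x. 0)" "\<And>x. \<sigma> * T a (T b g) x = \<rho> * g x"
    using exists_positive_eigenvector[OF V ab f0] by blast
  have \<sigma>: "\<sigma> \<noteq> 0" using g by auto
  have eq: "T a (T b f) x = (\<rho> / \<sigma>) * f x \<longleftrightarrow> \<sigma> * T a (T b f) x = \<rho> * f x" for f x
    using \<sigma> by (simp add: field_simps)
  define E where "E = {f \<in> V. \<forall>x. T a (T b f) x = (\<rho> / \<sigma>) * f x}"
  have E: "invariant_subspace E"
    unfolding E_def
  proof (rule invariant_subspace_eigenspace_of[OF V])
    fix f h c c' assume f: "f \<in> V" and h: "h \<in> V"
    have "T b (\<lambda>x. c * f x + c' * h x) = (\<lambda>x. c * T b f x + c' * T b h x)"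
      using T_linear[OF VD(6)[OF f] VD(6)[OF h]] by blast
    then show "T a (T b (\<lambda>x. c * f x + c' * h x)) = (\<lambda>x. c * T a (T b f) x + c' * T a (T b h) x)"
      using T_linear[OF bm_T[OF VD(6)[OF f] ab(2)] bm_T[OF VD(6)[OF h] ab(2)]] by presburger
  next
    fix f s assume f: "f \<in> V"
    have "T b (T s f) = T s (T b f)" using T_commute[OF VD(6)[OF f]] by blast
    then show "T a (T b (T s f)) = T s (T a (T b f))"
      using T_commute[OF bm_T[OF VD(6)[OF f] ab(2)]] by presburger
  qed (intro T_uniform_limit bm_T ab VD(6))
  have gE: "g \<in> E" using g eq by (simp add: E_def)
  have "(f x)\<^sup>2 \<le> ((\<sigma> / \<rho>)\<^sup>2 * (vol * (vol * vol))) * ip f f" if f: "f \<in> E" for f x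
  proof -
    have bf: "bm f" using f VD(6) by (simp add: E_def)
    have "T a (T b f) x = (\<rho> / \<sigma>) * f x" using f by (simp add: E_def)
    then have fx: "f x = (\<sigma> / \<rho>) * T a (T b f) x" using g(1) \<sigma> by (simp add: field_simps)
    have "(T a (T b f) x)\<^sup>2 \<le> vol * ip (T b f) (T b f)" by (rule T_bound[OF bm_T[OF bf ab(2)]])
    also have "\<dots> \<le> vol * (vol * ip f f * vol)"
      by (intro mult_left_mono ip_le_sup bm_T bf ab T_bound) simp
    finally have "(\<sigma> / \<rho>)\<^sup>2 * (T a (T b f) x)\<^sup>2 \<le> (\<sigma> / \<rho>)\<^sup>2 * (vol * (vol * ip f f * vol))"
      by (intro mult_left_mono) auto
    then show ?thesis unfolding fx power_mult_distrib by (simp add: mult_ac)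
  qed
  from exists_simultaneous_eigenfunction[OF E gE g(3) _ this]
  obtain f \<Lambda> where f: "f \<in> E" "f \<noteq> (\<lambda>x. 0)" "\<And>t x. 0 < t \<Longrightarrow> T t f x = \<Lambda> t * f x" by auto
  define \<Lambda>' where "\<Lambda>' t = (if t \<le> 0 then 0 else \<Lambda> t)" for t
  have feig: "f \<in> eigenspace \<Lambda>'"
    using f(1,3) VD(1) by (simp add: eigenspace_def \<Lambda>'_def E_def)
  then have "\<Lambda>' \<in> spectrum" using f(2) by (auto simp: spectrum_def \<Lambda>'_def)
  moreover have "0 < \<sigma> * (\<Lambda>' a * \<Lambda>' b)"
  proof -
    obtain x where x: "f x \<noteq> 0" using f(2) by auto
    have "T b f = (\<lambda>x. \<Lambda> b * f x)" using f(3)[OF ab(2)] by blast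
    then have "T a (T b f) x = \<Lambda> b * (\<Lambda> a * f x)" using f(3)[OF ab(1)] by (simp add: T_scale)
    moreover have "T a (T b f) x = (\<rho> / \<sigma>) * f x" using f(1) by (simp add: E_def)
    ultimately have "(\<Lambda> a * \<Lambda> b) * f x = (\<rho> / \<sigma>) * f x" by (simp only: mult_ac)
    then have "\<Lambda> a * \<Lambda> b = \<rho> / \<sigma>" by (rule mult_right_cancel[OF x, THEN iffD1])
    then show ?thesis using ab g(1) \<sigma> by (simp add: \<Lambda>'_def)
  qed
  ultimately show ?thesis using f feig by (auto simp: E_def)
qed


subsection \<open>Zonal functions\<close>

text \<open>On small balls around \<open>x\<close> the function \<open>f\<close> keeps the sign of \<open>f x\<close>.\<close>

lemma T_small_radius:
  assumes f: "continuous_on UNIV f" and x: "f x \<noteq> 0"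
  shows "\<exists>\<delta>>0. \<forall>t. 0 < t \<and> t < \<delta> \<longrightarrow> T t f x \<noteq> 0"
proof -
  from x have "0 < \<bar>f x\<bar> / 2" by simp
  from uniformly_continuous[OF f this] obtain \<delta> where \<delta>: "\<delta> > 0"
    "\<And>u y. d u y < \<delta> \<Longrightarrow> \<bar>f u - f y\<bar> < \<bar>f x\<bar> / 2" by blast
  have "T t f x \<noteq> 0" if t: "0 < t" "t < \<delta>" for t
  proof -
    let ?I = "\<lambda>y. indicator {y. d x y < t} y :: real"
    have bf: "bm (\<lambda>y. ?I y * f y)" by (intro bm_mult bm_ball bm_continuous f)
    have "(\<integral>y. (f x)\<^sup>2 / 2 * ?I y \<partial>\<mu>) \<le> (\<integral>y. f x * (?I y * f y) \<partial>\<mu>)"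
    proof (intro integral_mono bm_integrable bm_mult[OF bm_const] bm_ball bf)
      fix y
      show "(f x)\<^sup>2 / 2 * ?I y \<le> f x * (?I y * f y)"
      proof (cases "d x y < t")
        case True
        then have "\<bar>f x - f y\<bar> < \<bar>f x\<bar> / 2" using \<delta>(2) t by simp
        then have "f x * (f x - f y) \<le> \<bar>f x\<bar> * (\<bar>f x\<bar> / 2)"
          using mult_left_mono[of "\<bar>f x - f y\<bar>" "\<bar>f x\<bar> / 2" "\<bar>f x\<bar>"] abs_ge_self[of "f x * (f x - f y)"]
          by (simp add: abs_mult)
        then show ?thesis using True by (simp add: power2_eq_square algebra_simps)
      qed simp
    qed
    then have "(f x)\<^sup>2 / 2 * ball_volume t \<le> f x * T t f x" by (simp add: T_def measure_ball)
    moreover have "0 < (f x)\<^sup>2 / 2 * ball_volume t" using x ball_volume_pos[OF t(1)] by simp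
    ultimately show ?thesis by auto
  qed
  with \<delta>(1) show ?thesis by blast
qed

lemma spectrum_eigenfunction:
  assumes "\<Lambda> \<in> spectrum"
  obtains f x where "f \<in> eigenspace \<Lambda>" "f x \<noteq> 0"
  using assms zero_in_eigenspace[of \<Lambda>] by (fastforce simp: spectrum_def)

lemma eigenspaceD:
  "f \<in> eigenspace \<Lambda> \<Longrightarrow> continuous_on UNIV f"
  "f \<in> eigenspace \<Lambda> \<Longrightarrow> 0 < t \<Longrightarrow> T t f x = \<Lambda> t * f x"
  "f \<in> eigenspace \<Lambda> \<Longrightarrow> bm f"
  by (auto simp: eigenspace_def bm_continuous)

lemma spectrum_nonzero_near_0:
  assumes "\<Lambda> \<in> spectrum"
  shows "\<exists>\<delta>>0. \<forall>t. 0 < t \<and> t < \<delta> \<longrightarrow> \<Lambda> t \<noteq> 0"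
proof -
  obtain f x where f: "f \<in> eigenspace \<Lambda>" "f x \<noteq> 0" by (rule spectrum_eigenfunction[OF assms])
  from T_small_radius[OF eigenspaceD(1)[OF f(1)] f(2)] show ?thesis
    using eigenspaceD(2)[OF f(1)] by (metis mult_zero_left)
qed

lemma spectrum_continuous:
  assumes "\<Lambda> \<in> spectrum"
  shows "continuous_on {0<..} \<Lambda>"
proof -
  obtain f x where f: "f \<in> eigenspace \<Lambda>" "f x \<noteq> 0" by (rule spectrum_eigenfunction[OF assms])
  have "continuous_on {0<..} (\<lambda>t. T t f x / f x)"
    by (intro continuous_on_divide T_continuous_radius continuous_on_const eigenspaceD(3)[OF f(1)])
       (use f(2) in simp)
  then show ?thesis
    by (rule continuous_on_eq) (use f eigenspaceD(2)[OF f(1)] in auto)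
qed

lemma invariant_subspace_spectral: "invariant_subspace (eigenspace \<Lambda>)"
proof -
  have "eigenspace \<Lambda> = (\<Inter>t\<in>{0<..}. {f \<in> {f. continuous_on UNIV f}. \<forall>x. T t f x = \<Lambda> t * f x})"
    by (auto simp: eigenspace_def ball_conj_distrib gt_ex)
  also have "invariant_subspace \<dots>"
    by (intro invariant_subspace_Inter invariant_subspace_eigenspace invariant_subspace_all) simp
  finally show ?thesis .
qed

text \<open>The reproducing kernel of an eigenspace is invariant under isometries, since these carry
  orthonormal bases to orthonormal bases. By two-point homogeneity it is a function of the
  distance.\<close>

lemma zonal_kernel:
  assumes \<Lambda>: "\<Lambda> \<in> spectrum"
  shows "\<exists>n e z. (\<forall>i<(n::nat). e i \<in> eigenspace \<Lambda>) \<and> (\<forall>x y. (\<Sum>i<n. e i x * e i y) = z (d x y)) \<and>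
           1 \<le> z 0 * vol \<and> (\<forall>f\<in>eigenspace \<Lambda>. \<forall>x. ip f (\<lambda>y. z (d x y)) = f x)"
proof -
  let ?E = "eigenspace \<Lambda>"
  interpret E: inner_function_space ?E ip
    by (rule invariant_subspace_inner_function_space[OF invariant_subspace_spectral])
  obtain r where r: "0 < r" "\<Lambda> r \<noteq> 0"
  proof -
    obtain \<delta> where "\<delta> > 0" "\<And>t. 0 < t \<Longrightarrow> t < \<delta> \<Longrightarrow> \<Lambda> t \<noteq> 0"
      using spectrum_nonzero_near_0[OF \<Lambda>] by blast
    then show ?thesis using that[of "\<delta> / 2"] by simp
  qed
  \<comment> \<open>An eigenfunction with \<open>\<Lambda> r \<noteq> 0\<close> is a multiple of its average, and averages are bounded by
    the norm of \<open>ip\<close>.\<close>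
  define C where "C = vol / (\<Lambda> r)\<^sup>2"
  have C0: "0 \<le> C" by (simp add: C_def)
  have ev: "(f x)\<^sup>2 \<le> C * ip f f" if f: "f \<in> ?E" for f x
  proof -
    have "(\<Lambda> r * f x)\<^sup>2 \<le> vol * ip f f"
      using T_bound[OF eigenspaceD(3)[OF f], of r x] eigenspaceD(2)[OF f r(1)] by simp
    then show ?thesis using r(2) by (simp add: C_def power_mult_distrib field_simps)
  qed
  obtain e n where on: "E.orthonormal e n" and max: "\<And>e' n'. E.orthonormal e' n' \<Longrightarrow> n' \<le> n"
    using exists_basis[OF invariant_subspace_spectral C0 ev] by blast
  have eE: "\<forall>i<n. e i \<in> ?E" using on by (auto simp: E.orthonormal_def)
  define Z where "Z x y = (\<Sum>i<n. e i x * e i y)" for x y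
  have Z_eq: "Z x = (\<lambda>y. \<Sum>i<n. e i x * e i y)" for x by (simp add: Z_def fun_eq_iff)
  have ZE: "Z x \<in> ?E" for x
    unfolding Z_def by (rule E.sum_mem[OF eE])
  have repr: "ip f (\<lambda>y. \<Sum>i<n. u i x * u i y) = f x" if u: "E.orthonormal u n" and f: "f \<in> ?E" for u f x
  proof -
    have uE: "\<forall>i<n. u i \<in> ?E" using u by (auto simp: E.orthonormal_def)
    have "f x = (\<Sum>i<n. ip f (u i) * u i x)"
      by (rule E.maximal_orthonormal_expansion[OF u _ f]) (rule max)
    also have "\<dots> = (\<Sum>i<n. u i x * ip (u i) f)" by (simp add: ip_commute mult.commute)
    also have "\<dots> = ip (\<lambda>y. \<Sum>i<n. u i x * u i y) f" by (rule E.ip_sum[OF uE f, symmetric])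
    finally show ?thesis by (simp add: ip_commute)
  qed
  have Zinv: "Z (h x) (h y) = Z x y" if h: "h \<in> G" for h x y
  proof -
    define u where "u i = (\<lambda>x. e i (h x))" for i
    have "u i \<in> ?E" if "i < n" for i
    proof -
      have ei: "e i \<in> ?E" using eE that by blast
      have "continuous_on UNIV (u i)" unfolding u_def
        by (rule continuous_on_compose2[OF eigenspaceD(1)[OF ei] G_continuous[OF h]]) simp
      moreover have "T t (u i) x = \<Lambda> t * u i x" if "0 < t" for t x
        unfolding u_def T_compose[OF eigenspaceD(3)[OF ei] h] by (rule eigenspaceD(2)[OF ei that])
      ultimately show ?thesis by (simp add: eigenspace_def)
    qed
    moreover have "ip (u i) (u j) = ip (e i) (e j)" if "i < n" "j < n" for i j
      unfolding u_def using eE that eigenspaceD(3) by (intro ip_compose h) blast+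
    ultimately have u: "E.orthonormal u n" using on by (simp add: E.orthonormal_def)
    let ?Z' = "\<lambda>y. \<Sum>i<n. u i x * u i y"
    have Z'E: "?Z' \<in> ?E" using u by (intro E.sum_mem) (auto simp: E.orthonormal_def)
    have "Z x = ?Z'"
    proof -
      let ?D = "\<lambda>y. Z x y - ?Z' y"
      have DE: "?D \<in> ?E" by (rule E.diff_mem[OF ZE Z'E])
      have "ip ?D ?D = ip (Z x) ?D - ip ?Z' ?D" by (rule E.ip_diff[OF ZE Z'E DE])
      also have "ip (Z x) ?D = ?D x"
        using repr[OF on DE, of x] unfolding Z_eq[symmetric] by (rule trans[OF ip_commute])
      also have "ip ?Z' ?D = ?D x" by (rule trans[OF ip_commute repr[OF u DE]])
      finally have "ip ?D ?D = 0" by simp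
      from E.ip_definite[OF DE this] show ?thesis by (auto simp: fun_eq_iff)
    qed
    from fun_cong[OF this, of y] show ?thesis by (simp add: Z_def u_def)
  qed
  \<comment> \<open>Any pair of points at distance \<open>r\<close> gives the same value of \<open>Z\<close>.\<close>
  define z where "z r = (SOME c. \<exists>p q. d p q = r \<and> c = Z p q)" for r
  have z: "z (d x y) = Z x y" for x y
  proof -
    have "\<exists>p q. d p q = d x y \<and> z (d x y) = Z p q"
      unfolding z_def by (rule someI_ex) blast
    then obtain p q where pq: "d p q = d x y" "z (d x y) = Z p q" by blast
    obtain h where "h \<in> G" "h p = x" "h q = y" using two_point[OF pq(1)] by blast
    with Zinv[of h p q] pq(2) show ?thesis by simp
  qed
  have "1 \<le> z 0 * vol"
  proof -
    obtain f x where f: "f \<in> ?E" "f x \<noteq> 0" by (rule spectrum_eigenfunction[OF \<Lambda>])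
    have "f x = (\<Sum>i<n. ip f (e i) * e i x)"
      by (rule E.maximal_orthonormal_expansion[OF on _ f(1)]) (rule max)
    with f(2) have "n \<noteq> 0" by (intro notI) simp
    moreover have "(\<Sum>i<n. (e i x)\<^sup>2) = z 0" for x
      using z[of x x] by (simp add: Z_def power2_eq_square)
    then have "real n = (\<integral>x. z 0 \<partial>\<mu>)" using orthonormal_card[OF invariant_subspace_spectral on] by simp
    then have "real n = z 0 * vol" by (simp add: mult.commute)
    ultimately show ?thesis by simp
  qed
  moreover have "ip f (\<lambda>y. z (d x y)) = f x" if "f \<in> ?E" for f x
    unfolding z Z_def by (rule repr[OF on that])
  ultimately show ?thesis
    using eE z unfolding Z_def by (intro exI[of _ n] exI[of _ e] exI[of _ z]) auto
qed

text \<open>Along a minimizing geodesic of maximal length the zonal kernel becomes a kernel of finite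
  rank that depends on the difference of the arguments only.\<close>

lemma zonal_function:
  assumes \<Lambda>: "\<Lambda> \<in> spectrum"
  shows "\<exists>z. continuous_on {0..diam} z \<and> countable {r\<in>{0<..<diam}. z r = 0} \<and> 1 \<le> z 0 * vol \<and>
           (\<forall>x. (\<lambda>y. z (d x y)) \<in> eigenspace \<Lambda>) \<and>
           (\<forall>f\<in>eigenspace \<Lambda>. \<forall>x. ip f (\<lambda>y. z (d x y)) = f x)"
proof -
  obtain n :: nat and e z where e: "\<And>i. i < n \<Longrightarrow> e i \<in> eigenspace \<Lambda>"
    and z: "\<And>x y. (\<Sum>i<n. e i x * e i y) = z (d x y)" and z0: "1 \<le> z 0 * vol"
    and repr: "\<And>f x. f \<in> eigenspace \<Lambda> \<Longrightarrow> ip f (\<lambda>y. z (d x y)) = f x"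
    using zonal_kernel[OF \<Lambda>] by blast
  interpret E: inner_function_space "eigenspace \<Lambda>" ip
    by (rule invariant_subspace_inner_function_space[OF invariant_subspace_spectral])
  obtain p q where pq: "d p q = diam" using diam_attained by blast
  obtain \<gamma> where \<gamma>: "\<And>s t. s \<in> {0..diam} \<Longrightarrow> t \<in> {0..diam} \<Longrightarrow> d (\<gamma> s) (\<gamma> t) = \<bar>s - t\<bar>"
    using geodesic[of p q] unfolding pq by metis
  have D0: "0 \<le> diam" using pq d_nonneg[of p q] by simp
  have ec: "continuous_on {0..diam} (\<lambda>s. e i (\<gamma> s))" if i: "i < n" for i
    unfolding continuous_on_iff
  proof (intro ballI allI impI)
    fix s \<epsilon> :: real assume s: "s \<in> {0..diam}" and \<epsilon>: "0 < \<epsilon>"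
    obtain \<delta> where \<delta>: "\<delta> > 0" "\<And>x y. d x y < \<delta> \<Longrightarrow> \<bar>e i x - e i y\<bar> < \<epsilon>"
      using uniformly_continuous[OF eigenspaceD(1)[OF e[OF i]] \<epsilon>] by blast
    have "dist (e i (\<gamma> t)) (e i (\<gamma> s)) < \<epsilon>" if "t \<in> {0..diam}" "dist t s < \<delta>" for t
      using \<delta>(2)[of "\<gamma> t" "\<gamma> s"] \<gamma>[OF that(1) s] that(2) by (simp add: dist_real_def)
    with \<delta>(1) show "\<exists>\<delta>>0. \<forall>t\<in>{0..diam}. dist t s < \<delta> \<longrightarrow> dist (e i (\<gamma> t)) (e i (\<gamma> s)) < \<epsilon>" by blast
  qed
  have F: "(\<Sum>i<n. e i (\<gamma> s) * e i (\<gamma> t)) = z \<bar>s - t\<bar>" if "s \<in> {0..diam}" "t \<in> {0..diam}" for s t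
    using z[of "\<gamma> s" "\<gamma> t"] \<gamma>[OF that] by simp
  have "countable {r\<in>{0<..<diam}. z r = 0}"
    by (rule countable_zeros_finite_rank[OF ec F]) (use z0 in auto)
  moreover have "continuous_on {0..diam} z"
  proof (rule continuous_on_eq)
    show "continuous_on {0..diam} (\<lambda>t. \<Sum>i<n. e i (\<gamma> 0) * e i (\<gamma> t))"
      by (intro continuous_on_sum continuous_on_mult continuous_on_const ec) auto
    show "(\<Sum>i<n. e i (\<gamma> 0) * e i (\<gamma> t)) = z t" if "t \<in> {0..diam}" for t
      using F[OF _ that, of 0] that D0 by simp
  qed
  moreover have "(\<lambda>y. z (d x y)) \<in> eigenspace \<Lambda>" for x
    unfolding z[symmetric] using e by (intro E.sum_mem) auto
  ultimately show ?thesis using z0 repr by blast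
qed

text \<open>A point isolated from the right and the rest of the set to its right are separated by a
  rational number, and different points need different rational numbers.\<close>

lemma countable_right_isolated:
  fixes S :: "real set"
  shows "countable {t\<in>S. \<exists>e>0. S \<inter> {t<..<t + e} = {}}"
proof -
  let ?I = "{t\<in>S. \<exists>e>0. S \<inter> {t<..<t + e} = {}}"
  have "\<exists>q::rat. t < of_rat q \<and> S \<inter> {t<..<of_rat q} = {}" if "t \<in> ?I" for t
  proof -
    obtain e where e: "e > 0" "S \<inter> {t<..<t + e} = {}" using \<open>t \<in> ?I\<close> by blast
    obtain q :: rat where "t < of_rat q" "of_rat q < t + e" using of_rat_dense[of t "t + e"] e(1) by auto
    with e(2) show ?thesis by (intro exI[of _ q]) (auto simp: disjoint_iff)
  qed
  then have "\<forall>t\<in>?I. \<exists>q::rat. t < of_rat q \<and> S \<inter> {t<..<of_rat q} = {}" by blast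
  from bchoice[OF this] obtain q :: "real \<Rightarrow> rat"
    where "\<forall>t\<in>?I. t < of_rat (q t) \<and> S \<inter> {t<..<of_rat (q t)} = {}" by blast
  then have q: "\<And>t. t \<in> ?I \<Longrightarrow> t < of_rat (q t)"
    "\<And>t. t \<in> ?I \<Longrightarrow> S \<inter> {t<..<of_rat (q t)} = {}" by blast+
  have less: False if "s \<in> ?I" "t \<in> ?I" "q s = q t" "s < t" for s t
    using q(2)[OF that(1)] q(1)[OF that(2)] that by auto
  have "inj_on q ?I"
  proof (rule inj_onI)
    fix s t assume "s \<in> ?I" "t \<in> ?I" "q s = q t"
    then show "s = t" using less[of s t] less[of t s] by (cases s t rule: linorder_cases) auto
  qed
  then show ?thesis by (rule countable_image_inj_on[OF countableI_type])
qed

text \<open>Up to a nonzero factor, the derivative of the eigenvalue with respect to the volume of the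
  ball is the zonal function, so a zero of the eigenvalue that is a limit of zeros from the
  right is a zero of the zonal function.\<close>

lemma countable_eigenvalue_zeros:
  assumes \<Lambda>: "\<Lambda> \<in> spectrum"
  shows "countable {t\<in>{0<..<diam}. \<Lambda> t = 0}"
proof -
  let ?S = "{t\<in>{0<..<diam}. \<Lambda> t = 0}"
  obtain z where zc: "continuous_on {0..diam} z" and zz: "countable {r\<in>{0<..<diam}. z r = 0}"
    and zE: "\<And>x. (\<lambda>y. z (d x y)) \<in> eigenspace \<Lambda>"
    using zonal_function[OF \<Lambda>] by blast
  obtain p q where pq: "d p q = diam" using diam_attained by blast
  define f where "f = (\<lambda>y. z (d p y))"
  have fE: "f \<in> eigenspace \<Lambda>" unfolding f_def by (rule zE)
  have "z t = 0" if t: "t \<in> ?S" and acc: "\<And>e. e > 0 \<Longrightarrow> ?S \<inter> {t<..<t + e} \<noteq> {}" for t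
  proof (rule ccontr)
    assume zt: "z t \<noteq> 0"
    then have "0 < \<bar>z t\<bar> / 2" by simp
    then obtain e where e: "e > 0"
      "\<And>r. r \<in> {0..diam} \<Longrightarrow> dist r t < e \<Longrightarrow> dist (z r) (z t) < \<bar>z t\<bar> / 2"
      using zc t unfolding continuous_on_iff by (metis (no_types, lifting) mem_Collect_eq greaterThanLessThan_subseteq_atLeastAtMost_iff greaterThanLessThan_iff atLeastAtMost_iff less_imp_le)
    from acc[OF e(1)] obtain u where "u \<in> ?S \<inter> {t<..<t + e}" by blast
    then have u: "u \<in> ?S" "t < u" "u < t + e" by auto
    let ?I = "\<lambda>s y. indicator {y. d p y < s} y :: real"
    let ?A = "\<lambda>y. ?I u y - ?I t y"
    have Ts: "T s f p = 0" if "s \<in> ?S" for s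
      using eigenspaceD(2)[OF fE, of s p] that by auto
    have bA: "bm ?A" by (intro bm_diff bm_ball)
    have "(\<integral>y. ?A y * f y \<partial>\<mu>) = T u f p - T t f p"
      unfolding T_def left_diff_distrib
      by (rule Bochner_Integration.integral_diff) (intro bm_integrable bm_mult bm_ball eigenspaceD(3)[OF fE])+
    then have I0: "(\<integral>y. ?A y * f y \<partial>\<mu>) = 0" using Ts[OF t] Ts[OF u(1)] by simp
    have "(\<integral>y. (z t)\<^sup>2 / 2 * ?A y \<partial>\<mu>) \<le> (\<integral>y. z t * (?A y * f y) \<partial>\<mu>)"
    proof (intro integral_mono bm_integrable bm_mult[OF bm_const] bA bm_mult[OF bA eigenspaceD(3)[OF fE]])
      fix y
      show "(z t)\<^sup>2 / 2 * ?A y \<le> z t * (?A y * f y)"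
      proof (cases "t \<le> d p y \<and> d p y < u")
        case True
        then have "dist (z (d p y)) (z t) < \<bar>z t\<bar> / 2"
          using u by (intro e(2)) (auto simp: d_nonneg d_le_diam dist_real_def)
        then have "\<bar>z t - f y\<bar> < \<bar>z t\<bar> / 2" by (simp add: f_def dist_real_def abs_minus_commute)
        then have "z t * (z t - f y) \<le> \<bar>z t\<bar> * (\<bar>z t\<bar> / 2)"
          using mult_left_mono[of "\<bar>z t - f y\<bar>" "\<bar>z t\<bar> / 2" "\<bar>z t\<bar>"] abs_ge_self[of "z t * (z t - f y)"]
          by (simp add: abs_mult)
        then show ?thesis using True by (simp add: power2_eq_square algebra_simps)
      next
        case False
        then have "?A y = 0" using u(2) by (auto simp: indicator_def)
        then show ?thesis by simp
      qed
    qed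
    then have "(z t)\<^sup>2 / 2 * (\<integral>y. ?A y \<partial>\<mu>) \<le> z t * (\<integral>y. ?A y * f y \<partial>\<mu>)" by simp
    then have le0: "(z t)\<^sup>2 / 2 * (\<integral>y. ?A y \<partial>\<mu>) \<le> 0" by (simp add: I0)
    obtain w where w: "d p w = (t + u) / 2"
      using point_at_distance[of "(t + u) / 2" p q] pq t u by auto
    have "ball_volume ((u - t) / 2) = (\<integral>y. indicator {y. d w y < (u - t) / 2} y \<partial>\<mu>)"
      using measure_ball[of w "(u - t) / 2"] level_sets_measurable(1)[of w "(u - t) / 2"]
      by (simp del: level_sets_measurable)
    also have "\<dots> \<le> (\<integral>y. ?A y \<partial>\<mu>)"
    proof (intro integral_mono bm_integrable bm_ball bA)
      fix y
      have "t \<le> d p y \<and> d p y < u" if "d w y < (u - t) / 2"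
        using d_tri[of p w y] d_tri[of p y w] d_sym[of y w] w that by (auto simp: field_simps)
      then show "indicator {y. d w y < (u - t) / 2} y \<le> ?A y"
        using u(2) by (auto simp: indicator_def)
    qed
    finally have "0 < (\<integral>y. ?A y \<partial>\<mu>)" using ball_volume_pos[of "(u - t) / 2"] u(2) by simp
    with le0 zt show False by (simp add: mult_le_0_iff)
  qed
  then have "?S \<subseteq> {r\<in>{0<..<diam}. z r = 0} \<union> {t\<in>?S. \<exists>e>0. ?S \<inter> {t<..<t + e} = {}}" by blast
  then show ?thesis
    using zz countable_right_isolated[of ?S] by (meson countable_Un countable_subset)
qed

lemma Bessel_inequality:
  assumes "finite L" "\<And>a. a \<in> L \<Longrightarrow> bm (\<psi> a)" "\<And>a. a \<in> L \<Longrightarrow> ip (\<psi> a) (\<psi> a) = 1"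
    "\<And>a b. a \<in> L \<Longrightarrow> b \<in> L \<Longrightarrow> a \<noteq> b \<Longrightarrow> ip (\<psi> a) (\<psi> b) = 0" "bm g"
  shows "(\<Sum>a\<in>L. (ip g (\<psi> a))\<^sup>2) \<le> ip g g"
  using assms
proof (induction L arbitrary: g rule: finite_induct)
  case empty
  then show ?case using ip_ge_0[of g] by simp
next
  case (insert b L)
  define c where "c = ip g (\<psi> b)"
  define r where "r = (\<lambda>x. 1 * g x + (- c) * \<psi> b x)"
  have \<psi>: "bm (\<psi> b)" "ip (\<psi> b) (\<psi> b) = 1" using insert.prems by auto
  have r: "bm r" unfolding r_def by (rule bm_lin[OF insert.prems(4) \<psi>(1)])
  have ipr: "ip r h = ip g h - c * ip (\<psi> b) h" if "bm h" for h
    using ip_linear[OF insert.prems(4) \<psi>(1) that, of 1 "- c"] by (simp add: r_def)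
  have "(\<Sum>a\<in>L. (ip r (\<psi> a))\<^sup>2) \<le> ip r r"
    by (rule insert.IH) (use insert.prems r in auto)
  moreover have "ip r (\<psi> a) = ip g (\<psi> a)" if "a \<in> L" for a
    using ipr[of "\<psi> a"] insert.prems(1,3) insert.hyps(2) that by force
  moreover have "ip r r = ip g g - c\<^sup>2"
  proof -
    have "ip r r = ip g r - c * ip (\<psi> b) r" by (rule ipr[OF r])
    also have "ip g r = ip g g - c * c"
      using ipr[OF insert.prems(4)] by (simp add: ip_commute c_def)
    also have "ip (\<psi> b) r = c - c * 1"
      using ipr[OF \<psi>(1)] \<psi>(2) by (simp add: ip_commute[of "\<psi> b" r] c_def)
    finally show ?thesis by (simp add: power2_eq_square)
  qed
  ultimately have "(\<Sum>a\<in>L. (ip g (\<psi> a))\<^sup>2) \<le> ip g g - c\<^sup>2" by simp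
  then show ?case using insert.hyps by (simp add: c_def)
qed

text \<open>Bessel's inequality for the indicator function of a ball and the normalised zonal functions
  bounds the sum of the squares of the eigenvalues for every radius.\<close>

lemma countable_spectrum: "countable spectrum"
proof -
  fix x0 :: 'a
  have "\<exists>\<psi>. \<psi> \<in> eigenspace \<Lambda> \<and> ip \<psi> \<psi> = 1 \<and> 1 / vol \<le> (\<psi> x0)\<^sup>2" if \<Lambda>: "\<Lambda> \<in> spectrum" for \<Lambda>
  proof -
    obtain z where z0: "1 \<le> z 0 * vol" and zE: "(\<lambda>y. z (d x0 y)) \<in> eigenspace \<Lambda>"
      and repr: "ip (\<lambda>y. z (d x0 y)) (\<lambda>y. z (d x0 y)) = z (d x0 x0)"
      using zonal_function[OF \<Lambda>] by blast
    have z0': "1 / vol \<le> z 0" using z0 vol_pos by (simp add: pos_divide_le_eq)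
    then have zp: "0 < z 0" using vol_pos by (smt (verit) divide_pos_pos)
    interpret E: inner_function_space "eigenspace \<Lambda>" ip
      by (rule invariant_subspace_inner_function_space[OF invariant_subspace_spectral])
    let ?\<psi> = "\<lambda>y. (1 / sqrt (z 0)) * z (d x0 y)"
    have "?\<psi> \<in> eigenspace \<Lambda>" by (rule E.scale_mem[OF zE])
    moreover have "ip ?\<psi> ?\<psi> = 1"
      unfolding ip_scale_left ip_scale_right repr using zp by (simp add: field_simps)
    moreover have "(?\<psi> x0)\<^sup>2 = z 0" using zp by (simp add: power2_eq_square field_simps)
    ultimately show ?thesis using z0' by (intro exI[of _ ?\<psi>]) simp
  qed
  then obtain \<psi> where \<psi>E: "\<And>\<Lambda>. \<Lambda> \<in> spectrum \<Longrightarrow> \<psi> \<Lambda> \<in> eigenspace \<Lambda>"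
    and \<psi>1: "\<And>\<Lambda>. \<Lambda> \<in> spectrum \<Longrightarrow> ip (\<psi> \<Lambda>) (\<psi> \<Lambda>) = 1"
    and \<psi>x0: "\<And>\<Lambda>. \<Lambda> \<in> spectrum \<Longrightarrow> 1 / vol \<le> (\<psi> \<Lambda> x0)\<^sup>2" by metis
  have orth: "ip (\<psi> \<Lambda>) (\<psi> \<Lambda>') = 0" if "\<Lambda> \<in> spectrum" "\<Lambda>' \<in> spectrum" "\<Lambda> \<noteq> \<Lambda>'" for \<Lambda> \<Lambda>'
  proof -
    obtain t where t: "\<Lambda> t \<noteq> \<Lambda>' t" using \<open>\<Lambda> \<noteq> \<Lambda>'\<close> by blast
    then have "t > 0" using that(1,2) by (force simp: spectrum_def not_le[symmetric])
    have e: "T t (\<psi> \<Lambda>) = (\<lambda>x. \<Lambda> t * \<psi> \<Lambda> x)" "T t (\<psi> \<Lambda>') = (\<lambda>x. \<Lambda>' t * \<psi> \<Lambda>' x)"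
      using eigenspaceD(2)[OF \<psi>E[OF that(1)] \<open>t > 0\<close>] eigenspaceD(2)[OF \<psi>E[OF that(2)] \<open>t > 0\<close>] by blast+
    have "ip (T t (\<psi> \<Lambda>)) (\<psi> \<Lambda>') = ip (\<psi> \<Lambda>) (T t (\<psi> \<Lambda>'))"
      by (rule T_symmetric[OF eigenspaceD(3)[OF \<psi>E[OF that(1)]] eigenspaceD(3)[OF \<psi>E[OF that(2)]]])
    then have "\<Lambda> t * ip (\<psi> \<Lambda>) (\<psi> \<Lambda>') = \<Lambda>' t * ip (\<psi> \<Lambda>) (\<psi> \<Lambda>')"
      unfolding e ip_scale_left ip_scale_right .
    with t show ?thesis by simp
  qed
  have bessel: "(\<Sum>\<Lambda>\<in>L. (\<Lambda> t)\<^sup>2) \<le> vol * vol" if L: "finite L" "L \<subseteq> spectrum" and t: "0 < t" for L t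
  proof -
    let ?g = "indicator {y. d x0 y < t} :: 'a \<Rightarrow> real"
    define c where "c \<Lambda> = ip ?g (\<psi> \<Lambda>)" for \<Lambda>
    have c: "c \<Lambda> = \<Lambda> t * \<psi> \<Lambda> x0" if "\<Lambda> \<in> L" for \<Lambda>
      using eigenspaceD(2)[OF \<psi>E t, of \<Lambda> x0] L(2) that by (auto simp: c_def ip_def T_def)
    have "(\<Sum>\<Lambda>\<in>L. (c \<Lambda>)\<^sup>2) \<le> ip ?g ?g"
      unfolding c_def
    proof (rule Bessel_inequality[OF L(1)])
      show "bm (\<psi> \<Lambda>)" "ip (\<psi> \<Lambda>) (\<psi> \<Lambda>) = 1" if "\<Lambda> \<in> L" for \<Lambda>
        using L(2) that eigenspaceD(3)[OF \<psi>E] \<psi>1 by auto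
      show "ip (\<psi> \<Lambda>) (\<psi> \<Lambda>') = 0" if "\<Lambda> \<in> L" "\<Lambda>' \<in> L" "\<Lambda> \<noteq> \<Lambda>'" for \<Lambda> \<Lambda>'
        using L(2) that by (intro orth) auto
    qed (rule bm_ball)
    also have "ip ?g ?g \<le> 1 * vol" by (rule ip_le_sup[OF bm_ball]) (auto simp: indicator_def)
    finally have *: "(\<Sum>\<Lambda>\<in>L. (c \<Lambda>)\<^sup>2) \<le> vol" by simp
    have "(\<Lambda> t)\<^sup>2 \<le> vol * (c \<Lambda>)\<^sup>2" if "\<Lambda> \<in> L" for \<Lambda>
    proof -
      have "1 \<le> vol * (\<psi> \<Lambda> x0)\<^sup>2" using \<psi>x0[of \<Lambda>] L(2) that vol_pos by (auto simp: pos_divide_le_eq mult.commute)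
      from mult_left_mono[OF this, of "(\<Lambda> t)\<^sup>2"] show ?thesis
        unfolding c[OF that] by (simp add: power_mult_distrib mult_ac)
    qed
    then have "(\<Sum>\<Lambda>\<in>L. (\<Lambda> t)\<^sup>2) \<le> vol * (\<Sum>\<Lambda>\<in>L. (c \<Lambda>)\<^sup>2)"
      unfolding sum_distrib_left by (rule sum_mono)
    also have "\<dots> \<le> vol * vol" using * by (intro mult_left_mono) auto
    finally show ?thesis .
  qed
  have fin: "finite {\<Lambda>\<in>spectrum. \<eta> \<le> \<bar>\<Lambda> t\<bar>}" if \<eta>: "0 < \<eta>" and t: "0 < t" for \<eta> t
  proof (rule ccontr)
    assume inf: "infinite {\<Lambda>\<in>spectrum. \<eta> \<le> \<bar>\<Lambda> t\<bar>}"
    obtain N :: nat where N: "vol * vol / \<eta>\<^sup>2 < N" using reals_Archimedean2 by blast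
    obtain L where L: "finite L" "card L = N" "L \<subseteq> {\<Lambda>\<in>spectrum. \<eta> \<le> \<bar>\<Lambda> t\<bar>}"
      using infinite_arbitrarily_large[OF inf] by blast
    have "(\<Sum>\<Lambda>\<in>L. \<eta>\<^sup>2) \<le> (\<Sum>\<Lambda>\<in>L. (\<Lambda> t)\<^sup>2)"
    proof (rule sum_mono)
      fix \<Lambda> assume "\<Lambda> \<in> L"
      then have "\<eta> \<le> \<bar>\<Lambda> t\<bar>" using L(3) by blast
      from power_mono[OF this, of 2] \<eta> show "\<eta>\<^sup>2 \<le> (\<Lambda> t)\<^sup>2" by simp
    qed
    also have "\<dots> \<le> vol * vol" using L(1,3) t by (intro bessel) auto
    finally have "real N * \<eta>\<^sup>2 \<le> vol * vol" using L(2) by simp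
    then show False using N \<eta> by (simp add: pos_divide_less_eq)
  qed
  have "spectrum \<subseteq> (\<Union>j. \<Union>k. {\<Lambda>\<in>spectrum. 1 / real (Suc k) \<le> \<bar>\<Lambda> (1 / real (Suc j))\<bar>})"
  proof
    fix \<Lambda> assume \<Lambda>: "\<Lambda> \<in> spectrum"
    obtain \<delta> where \<delta>: "\<delta> > 0" "\<And>t. 0 < t \<Longrightarrow> t < \<delta> \<Longrightarrow> \<Lambda> t \<noteq> 0"
      using spectrum_nonzero_near_0[OF \<Lambda>] by blast
    from \<delta>(1) obtain j where j: "1 / real (Suc j) < \<delta>" by (rule nat_approx_posE)
    have "\<Lambda> (1 / real (Suc j)) \<noteq> 0" by (rule \<delta>(2)[OF _ j]) simp
    then have "0 < \<bar>\<Lambda> (1 / real (Suc j))\<bar>" by simp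
    then obtain k where "1 / real (Suc k) < \<bar>\<Lambda> (1 / real (Suc j))\<bar>" by (rule nat_approx_posE)
    with \<Lambda> show "\<Lambda> \<in> (\<Union>j. \<Union>k. {\<Lambda>\<in>spectrum. 1 / real (Suc k) \<le> \<bar>\<Lambda> (1 / real (Suc j))\<bar>})"
      by (intro UN_I[of j] UN_I[of k]) auto
  qed
  moreover have "countable (\<Union>j. \<Union>k. {\<Lambda>\<in>spectrum. 1 / real (Suc k) \<le> \<bar>\<Lambda> (1 / real (Suc j))\<bar>})"
    by (intro countable_UN[OF countableI_type] countable_finite fin) auto
  ultimately show ?thesis by (rule countable_subset)
qed

subsection \<open>Exceptional radii\<close>

definition exceptional_radii :: "real set" where
  "exceptional_radii = {t\<in>{0<..<diam}. \<exists>\<Lambda>\<in>spectrum. \<Lambda> t = 0}"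

lemma countable_exceptional_radii: "countable exceptional_radii"
proof -
  have "exceptional_radii = (\<Union>\<Lambda>\<in>spectrum. {t\<in>{0<..<diam}. \<Lambda> t = 0})"
    by (auto simp: exceptional_radii_def)
  then show ?thesis using countable_eigenvalue_zeros countable_spectrum by auto
qed

text \<open>The kernel of \<open>T t\<close> is an invariant subspace. If it contains \<open>f \<noteq> 0\<close>, then \<open>ip (T r (T r f)) f\<close>
  is positive for small \<open>r\<close>, so that it contains a simultaneous eigenfunction.\<close>

lemma exceptional_radii_iff:
  assumes t: "t \<in> {0<..<diam}"
  shows "t \<in> exceptional_radii \<longleftrightarrow> (\<exists>f. continuous_on UNIV f \<and> (\<exists>x. f x \<noteq> 0) \<and> (\<forall>x. T t f x = 0))"
    (is "?L \<longleftrightarrow> ?R")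
proof
  assume ?L
  then obtain \<Lambda> where \<Lambda>: "\<Lambda> \<in> spectrum" "\<Lambda> t = 0" by (auto simp: exceptional_radii_def)
  obtain f x where f: "f \<in> eigenspace \<Lambda>" "f x \<noteq> 0" by (rule spectrum_eigenfunction[OF \<Lambda>(1)])
  have "T t f x = 0" for x using eigenspaceD(2)[OF f(1), of t x] t \<Lambda>(2) by simp
  then show ?R using f eigenspaceD(1) by blast
next
  assume ?R
  then obtain f x where f: "continuous_on UNIV f" "f x \<noteq> 0" "\<And>x. T t f x = 0" by blast
  have t0: "0 < t" using t by simp
  define V where "V = {f \<in> {f. continuous_on UNIV f}. \<forall>x. T t f x = 0 * f x}"
  have V: "invariant_subspace V" unfolding V_def by (rule invariant_subspace_eigenspace[OF invariant_subspace_all])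
  have fV: "f \<in> V" using f by (simp add: V_def)
  obtain \<delta> where \<delta>: "\<delta> > 0" "\<And>t. 0 < t \<Longrightarrow> t < \<delta> \<Longrightarrow> T t f x \<noteq> 0"
    using T_small_radius[OF f(1,2)] by blast
  define r where "r = \<delta> / 2"
  have r: "0 < r" "T r f x \<noteq> 0" using \<delta>(1) \<delta>(2)[of r] by (auto simp: r_def)
  have bf: "bm f" by (rule bm_continuous[OF f(1)])
  have "ip (\<lambda>x. 1 * T r (T r f) x) f = ip (T r f) (T r f)"
    using T_symmetric[OF bm_T[OF bf r(1)] bf, of r] by simp
  moreover have "ip (T r f) (T r f) \<noteq> 0"
    using ip_eq_0[OF T_continuous[OF bf r(1)]] r(2) by auto
  ultimately have "0 < ip (\<lambda>x. 1 * T r (T r f) x) f" using ip_ge_0[of "T r f"] by linarith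
  from exists_spectrum_sign[OF V r(1) r(1) fV this]
  obtain \<Lambda> g where \<Lambda>: "\<Lambda> \<in> spectrum" and g: "g \<in> V" "g \<noteq> (\<lambda>x. 0)" "g \<in> eigenspace \<Lambda>" by blast
  obtain y where y: "g y \<noteq> 0" using g(2) by auto
  have "\<Lambda> t * g y = 0" using eigenspaceD(2)[OF g(3) t0, of y] g(1) by (simp add: V_def)
  then have "\<Lambda> t = 0" using y by simp
  then show ?L using \<Lambda> t by (auto simp: exceptional_radii_def)
qed

text \<open>Otherwise every \<open>\<Lambda>\<close> has the same sign at \<open>t1\<close> and \<open>t2\<close> by the intermediate value theorem, and
  \<open>T t1 \<circ> T t2\<close> is positive definite. But a nonzero function with integral zero and support of
  diameter less than \<open>t2 - t1\<close> is isotropic for its quadratic form.\<close>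

lemma exceptional_radius_between:
  assumes t: "0 < t1" "t1 < t2" "t2 < diam"
  shows "\<exists>t\<in>exceptional_radii. t1 \<le> t \<and> t \<le> t2"
proof (rule ccontr)
  assume no: "\<not> ?thesis"
  have t2: "0 < t2" using t by simp
  have nz: "\<Lambda> s \<noteq> 0" if "\<Lambda> \<in> spectrum" "t1 \<le> s" "s \<le> t2" for \<Lambda> s
    using no that t by (auto simp: exceptional_radii_def)
  have inj: "f = (\<lambda>x. 0)" if "continuous_on UNIV f" "\<And>x. T s f x = 0" "s \<in> {t1, t2}" for f s
  proof -
    have "s \<in> {0<..<diam}" "s \<notin> exceptional_radii" using that(3) no t by auto
    with exceptional_radii_iff[of s] that show ?thesis by auto
  qed
  have pos: "0 < \<Lambda> t1 * \<Lambda> t2" if \<Lambda>: "\<Lambda> \<in> spectrum" for \<Lambda>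
  proof (rule ccontr)
    assume "\<not> ?thesis"
    then have "\<Lambda> t1 * \<Lambda> t2 < 0" using nz[OF \<Lambda>, of t1] nz[OF \<Lambda>, of t2] t by (simp add: not_less order_less_le)
    moreover have c: "continuous_on {t1..t2} \<Lambda>"
      using t by (intro continuous_on_subset[OF spectrum_continuous[OF \<Lambda>]]) auto
    ultimately have "\<exists>s. t1 \<le> s \<and> s \<le> t2 \<and> \<Lambda> s = 0"
      using IVT'[of \<Lambda> t1 0 t2] IVT2'[of \<Lambda> t2 0 t1] t by (force simp: mult_less_0_iff)
    then show False using nz[OF \<Lambda>] by blast
  qed
  define P where "P f x = T t1 (T t2 f) x" for f x
  note all = invariant_subspaceD[OF invariant_subspace_all]
  have PSD: "0 \<le> ip (P f) f" if f: "continuous_on UNIV f" for f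
  proof (rule ccontr)
    assume "\<not> ?thesis"
    then have "0 < ip (\<lambda>x. (-1) * T t1 (T t2 f) x) f"
      unfolding ip_scale_left P_def by simp
    from exists_spectrum_sign[OF invariant_subspace_all t(1) t2 _ this] f
    obtain \<Lambda> where "\<Lambda> \<in> spectrum" "0 < (-1) * (\<Lambda> t1 * \<Lambda> t2)" by auto
    with pos show False by fastforce
  qed
  define \<delta> where "\<delta> = t2 - t1"
  have \<delta>: "0 < \<delta>" "\<delta> < diam" using t by (auto simp: \<delta>_def)
  obtain p q where pq: "d p q = diam" using diam_attained by blast
  obtain w where w: "d p w = \<delta> / 4"
    using point_at_distance[of "\<delta> / 4" p q] pq \<delta> by auto
  \<comment> \<open>Two bumps of the same shape; their difference has integral zero.\<close>
  define \<beta> where "\<beta> a y = max 0 (\<delta> / 4 - d a y)" for a y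
  have \<beta>c: "continuous_on UNIV (\<beta> a)" for a
    unfolding \<beta>_def by (intro continuous_on_max continuous_on_diff continuous_on_const continuous_d_right)
  define f where "f = (\<lambda>y. \<beta> p y - \<beta> w y)"
  have fc: "continuous_on UNIV f" unfolding f_def by (intro continuous_on_diff \<beta>c)
  have fb: "bm f" by (rule bm_continuous[OF fc])
  have f0: "f \<noteq> (\<lambda>x. 0)"
  proof
    assume "f = (\<lambda>x. 0)"
    from fun_cong[OF this, of p] show False
      using \<delta> w d_sym[of w p] by (simp add: f_def \<beta>_def)
  qed
  have supp: "d p y < \<delta> / 2" if "f y \<noteq> 0" for y
  proof -
    have "d p y < \<delta> / 4 \<or> d w y < \<delta> / 4" using that by (auto simp: f_def \<beta>_def max_def split: if_splits)
    then show ?thesis using d_tri[of p y w] w \<delta> by linarith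
  qed
  have int0: "(\<integral>y. f y \<partial>\<mu>) = 0"
  proof -
    obtain h where h: "h \<in> G" "h p = w" using transitive by blast
    have "(\<integral>y. \<beta> w y \<partial>\<mu>) = (\<integral>y. \<beta> w (h y) \<partial>\<mu>)"
      by (rule integral_compose[OF h(1) bm_measurable[OF bm_continuous[OF \<beta>c]], symmetric])
    also have "\<dots> = (\<integral>y. \<beta> p y \<partial>\<mu>)"
      using G_isometry[OF h(1), of p] h(2) by (simp add: \<beta>_def)
    finally show ?thesis
      unfolding f_def by (subst Bochner_Integration.integral_diff) (auto intro!: bm_integrable bm_continuous \<beta>c)
  qed
  have Pf0: "f x * P f x = 0" for x
  proof (cases "f x = 0")
    case False
    \<comment> \<open>The ball of radius \<open>t2\<close> around \<open>v\<close> contains the support of \<open>f\<close>.\<close>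
    have T2: "T t2 f v = 0" if v: "d x v < t1" for v
    proof -
      have "indicator {y. d v y < t2} y * f y = f y" for y
      proof (cases "f y = 0")
        case False
        have "d v y < t2"
          using d_tri[of v y x] d_tri[of x y p] d_sym[of v x] d_sym[of x p] v
            supp[OF \<open>f x \<noteq> 0\<close>] supp[OF False] by (simp add: \<delta>_def)
        then show ?thesis by simp
      qed simp
      then have "T t2 f v = (\<integral>y. f y \<partial>\<mu>)"
        unfolding T_def by (intro Bochner_Integration.integral_cong refl)
      then show ?thesis using int0 by (rule trans)
    qed
    have "indicator {y. d x y < t1} y * T t2 f y = 0" for y
      using T2[of y] by (simp add: indicator_def)
    then have "T t1 (T t2 f) x = (\<integral>y. 0 \<partial>\<mu>)"
      unfolding T_def[of t1] by (intro Bochner_Integration.integral_cong refl)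
    then have "P f x = 0" by (simp add: P_def)
    then show ?thesis by simp
  qed simp
  have "P f x * f x = 0" for x using Pf0[of x] by (simp add: mult.commute)
  then have "ip (P f) f = (\<integral>x. 0 \<partial>\<mu>)"
    unfolding ip_def by (intro Bochner_Integration.integral_cong refl)
  then have ipPf: "ip (P f) f = 0" by simp
  interpret V: inner_function_space "{f. continuous_on UNIV f}" ip
    by (rule invariant_subspace_inner_function_space[OF invariant_subspace_all])
  have Pc: "continuous_on UNIV (P g)" if "bm g" for g
    unfolding P_def by (rule T_continuous[OF bm_T[OF that t2] t(1)])
  define g where "g = P f"
  have gc: "continuous_on UNIV g" using Pc[OF fb] by (simp add: g_def)
  have "(ip (P f) g)\<^sup>2 \<le> ip (P f) f * ip (P g) g"
  proof (rule V.positive_form_Cauchy_Schwarz)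
    fix u v :: "'a \<Rightarrow> real" assume "u \<in> {f. continuous_on UNIV f}" "v \<in> {f. continuous_on UNIV f}"
    then have u: "bm u" and v: "bm v" using bm_continuous by auto
    show "P (\<lambda>x. a * u x + b * v x) = (\<lambda>x. a * P u x + b * P v x)" for a b
    proof -
      have "T t2 (\<lambda>x. a * u x + b * v x) = (\<lambda>x. a * T t2 u x + b * T t2 v x)"
        using T_linear[OF u v] by blast
      then show ?thesis
        unfolding P_def using T_linear[OF bm_T[OF u t2] bm_T[OF v t2]] by presburger
    qed
    have "ip (P u) v = ip u (T t2 (T t1 v))"
      unfolding P_def using T_symmetric[OF bm_T[OF u t2] v, of t1] T_symmetric[OF u bm_T[OF v t(1)], of t2] by simp
    also have "T t2 (T t1 v) = P v" unfolding P_def using T_commute[OF v] by blast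
    finally show "ip (P u) v = ip u (P v)" .
  qed (use PSD fc gc Pc bm_continuous in auto)
  then have "ip (P f) g = 0" using ipPf by simp
  then have "P f = (\<lambda>x. 0)" using ip_eq_0[OF Pc[OF fb]] by (simp add: g_def)
  then have "\<And>x. T t1 (T t2 f) x = 0" by (simp add: P_def fun_eq_iff)
  then have "T t2 f = (\<lambda>x. 0)" using inj[OF T_continuous[OF fb t2], of t1] by simp
  then have "f = (\<lambda>x. 0)" using inj[OF fc, of t2] by (simp add: fun_eq_iff)
  with f0 show False ..
qed

lemma exceptional_radii_dense: "{0<..<diam} \<subseteq> closure exceptional_radii"
proof
  fix t assume t: "t \<in> {0<..<diam}"
  show "t \<in> closure exceptional_radii"
    unfolding closure_approachable
  proof (intro allI impI)
    fix e :: real assume e: "e > 0"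
    define u where "u = t + min e (diam - t) / 2"
    have "0 < t" "t < u" "u < diam" "u < t + e" using t e by (auto simp: u_def min_def field_simps)
    then obtain s where "s \<in> exceptional_radii" "t \<le> s" "s \<le> u" using exceptional_radius_between by blast
    then show "\<exists>s\<in>exceptional_radii. dist s t < e"
      using \<open>u < t + e\<close> by (intro bexI[of _ s]) (auto simp: dist_real_def)
  qed
qed

end

section \<open>Curves in Riemannian manifolds\<close>

locale riemannian_manifold =
  fixes A :: "('a::{t2_space,second_countable_topology}, 'n::{finite,wellorder}) chart set"
    and g :: "('a, 'n) metric_tensor"
  assumes atlas: "smooth_atlas A"
    and metric: "riemannian_metric A g"
begin

subsection \<open>Charts and smooth maps\<close>

lemma chart:
  assumes "c \<in> A"
  shows chart_open: "open (cdom c)" and chart_image_open: "open (cmap c ` cdom c)"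
    and chart_homeomorphism: "homeomorphism (cdom c) (cmap c ` cdom c) (cmap c) (cinv c)"
  using atlas assms by (auto simp: smooth_atlas_def)

lemma exists_chart: "\<exists>c\<in>A. p \<in> cdom c"
  using atlas by (auto simp: smooth_atlas_def)

lemma cinv_cmap [simp]: "c \<in> A \<Longrightarrow> p \<in> cdom c \<Longrightarrow> cinv c (cmap c p) = p"
  and cmap_cinv [simp]: "c \<in> A \<Longrightarrow> x \<in> cmap c ` cdom c \<Longrightarrow> cmap c (cinv c x) = x"
  and cinv_mem: "c \<in> A \<Longrightarrow> x \<in> cmap c ` cdom c \<Longrightarrow> cinv c x \<in> cdom c"
  and continuous_cmap: "c \<in> A \<Longrightarrow> continuous_on (cdom c) (cmap c)"
  and continuous_cinv: "c \<in> A \<Longrightarrow> continuous_on (cmap c ` cdom c) (cinv c)"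
  using chart_homeomorphism[of c] by (auto simp: homeomorphism_def)

lemma cinv_image_open:
  assumes c: "c \<in> A" and U: "open U" "U \<subseteq> cmap c ` cdom c"
  shows "open (cinv c ` U)"
proof -
  have "cinv c ` U = cdom c \<inter> cmap c -` U"
    using c U(2) by (auto simp: cinv_mem subset_eq intro!: image_eqI[of _ _ "cmap c _"])
  then show ?thesis
    using continuous_open_preimage[OF continuous_cmap[OF c] chart_open[OF c] U(1)] by simp
qed

lemma cmap_image_eq:
  assumes c: "c \<in> A" and B: "B \<subseteq> cdom c"
  shows "cmap c ` B = cmap c ` cdom c \<inter> cinv c -` B"
proof (intro equalityI subsetI)
  fix x assume "x \<in> cmap c ` B"
  then show "x \<in> cmap c ` cdom c \<inter> cinv c -` B" using c B by (auto simp: subset_eq)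
next
  fix x assume "x \<in> cmap c ` cdom c \<inter> cinv c -` B"
  then have "x = cmap c (cinv c x)" "cinv c x \<in> B" using c by auto
  then show "x \<in> cmap c ` B" by blast
qed

lemma smooth_on_derivative:
  assumes "smooth_on F U" "x \<in> U"
  shows "(F has_derivative frechet_derivative F (at x)) (at x)"
proof -
  have "Ck_on (Suc 0) F U" using assms(1) unfolding smooth_on_def by blast
  then show ?thesis using assms(2) frechet_derivative_works by auto
qed

lemma smooth_on_continuous_derivative:
  assumes "smooth_on F U"
  shows "continuous_on U (\<lambda>x. frechet_derivative F (at x) v)"
proof -
  have "Ck_on (Suc 0) F U" using assms unfolding smooth_on_def by blast
  then show ?thesis by auto
qed

lemma smooth_on_continuous: "smooth_on F U \<Longrightarrow> continuous_on U F"
  unfolding smooth_on_def using Ck_on.simps(1) by blast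

definition coord_map :: "('a, 'n) chart \<Rightarrow> ('a, 'n) chart \<Rightarrow> ('a \<Rightarrow> 'a) \<Rightarrow> (real, 'n) vec \<Rightarrow> (real, 'n) vec" where
  "coord_map c c' h = cmap c' \<circ> h \<circ> cinv c"

definition coord_dom :: "('a, 'n) chart \<Rightarrow> ('a, 'n) chart \<Rightarrow> ('a \<Rightarrow> 'a) \<Rightarrow> ((real, 'n) vec) set" where
  "coord_dom c c' h = cmap c ` (cdom c \<inter> h -` cdom c')"

lemma smooth_mapD:
  assumes "smooth_map A h" "c \<in> A" "c' \<in> A"
  shows "smooth_on (coord_map c c' h) (coord_dom c c' h)" "continuous_on UNIV h"
  using assms by (auto simp: smooth_map_def coord_map_def coord_dom_def)

lemma coord_dom_mem: "c \<in> A \<Longrightarrow> p \<in> cdom c \<Longrightarrow> h p \<in> cdom c' \<Longrightarrow> cmap c p \<in> coord_dom c c' h"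
  by (auto simp: coord_dom_def)

lemma coord_map_derivative:
  assumes h: "smooth_map A h" and c: "c \<in> A" "c' \<in> A" and p: "p \<in> cdom c" "h p \<in> cdom c'"
  shows "(coord_map c c' h has_derivative coord_deriv c c' h p) (at (cmap c p))"
proof -
  have "cmap c p \<in> coord_dom c c' h" by (rule coord_dom_mem) fact+
  from smooth_on_derivative[OF smooth_mapD(1)[OF h c] this] show ?thesis
    by (simp add: coord_deriv_def coord_map_def)
qed

lemma smooth_map_id: "smooth_map A id"
proof -
  have "smooth_on (cmap c' \<circ> id \<circ> cinv c) (cmap c ` (cdom c \<inter> id -` cdom c'))" if "c \<in> A" "c' \<in> A" for c c'
    using atlas that unfolding smooth_atlas_def by (simp add: comp_def)
  then show ?thesis by (auto simp: smooth_map_def continuous_on_id)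
qed

lemma isometry_id: "isometry A g id"
proof -
  have "\<forall>c\<in>A. \<forall>c'\<in>A. \<forall>p\<in>cdom c \<inter> cdom c'. \<forall>u v.
      g c p u v = g c' p (coord_deriv c c' id p u) (coord_deriv c c' id p v)"
    using metric unfolding riemannian_metric_def by (elim conjE)
  note inv = bspec[OF bspec[OF bspec[OF this]], THEN spec, THEN spec]
  show ?thesis
    unfolding isometry_def inv_id
  proof (intro conjI bij_id smooth_map_id ballI allI)
    fix c c' p u v
    assume c: "c \<in> A" "c' \<in> A" and p: "p \<in> cdom c \<inter> id -` cdom c'"
    then have "p \<in> cdom c \<inter> cdom c'" by simp
    from inv[OF c this, of u v]
    show "g c p u v = g c' (id p) (coord_deriv c c' id p u) (coord_deriv c c' id p v)" by simp
  qed
qed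

lemma metricD:
  assumes "c \<in> A" "p \<in> cdom c"
  shows metric_bilinear: "bilinear (g c p)"
    and metric_pos: "u \<noteq> 0 \<Longrightarrow> 0 < g c p u u"
proof -
  have "\<forall>c\<in>A. \<forall>p\<in>cdom c. bilinear (g c p) \<and> (\<forall>u v. g c p u v = g c p v u) \<and>
        (\<forall>u. u \<noteq> 0 \<longrightarrow> g c p u u > 0)"
    using metric unfolding riemannian_metric_def by (rule conjunct1)
  note * = bspec[OF bspec[OF this assms(1)] assms(2)]
  show "bilinear (g c p)" by (rule conjunct1[OF *])
  show "0 < g c p u u" if "u \<noteq> 0" by (rule conjunct2[OF conjunct2[OF *], THEN spec, THEN mp, OF that])
qed

lemma metric_smooth: "c \<in> A \<Longrightarrow> smooth_on (\<lambda>x. g c (cinv c x) u v) (cmap c ` cdom c)"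
  using metric unfolding riemannian_metric_def by simp

lemma metric_nonneg: "c \<in> A \<Longrightarrow> p \<in> cdom c \<Longrightarrow> 0 \<le> g c p u u"
  using metric_pos[of c p u] bilinear_lzero[OF metric_bilinear[of c p], of 0] by (cases "u = 0") auto

lemma gram_expand:
  assumes "c \<in> A" "p \<in> cdom c"
  shows "g c p u v = (\<Sum>k\<in>UNIV. \<Sum>l\<in>UNIV. u $ k * v $ l * gram g c p $ k $ l)"
proof -
  note b = metric_bilinear[OF assms]
  have "g c p u v = g c p (\<Sum>k\<in>UNIV. u $ k *\<^sub>R axis k 1) (\<Sum>l\<in>UNIV. v $ l *\<^sub>R axis l 1)"
    using basis_expansion[of u] basis_expansion[of v] by (simp add: scalar_mult_eq_scaleR)
  also have "\<dots> = (\<Sum>(k, l)\<in>UNIV \<times> UNIV. g c p (u $ k *\<^sub>R axis k 1) (v $ l *\<^sub>R axis l 1))"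
    by (rule bilinear_sum[OF b])
  also have "\<dots> = (\<Sum>k\<in>UNIV. \<Sum>l\<in>UNIV. u $ k * v $ l * gram g c p $ k $ l)"
    unfolding sum.cartesian_product[symmetric]
    by (simp add: bilinear_lmul[OF b] bilinear_rmul[OF b] gram_def mult.assoc mult.left_commute)
  finally show ?thesis .
qed

lemma metric_continuous:
  assumes c: "c \<in> A" and X: "continuous_on S X" "X ` S \<subseteq> cmap c ` cdom c"
    and v: "continuous_on S u" "continuous_on S v"
  shows "continuous_on S (\<lambda>s. g c (cinv c (X s)) (u s) (v s))"
proof -
  have gr: "continuous_on S (\<lambda>s. gram g c (cinv c (X s)) $ i $ j)" for i j
    unfolding gram_def vec_lambda_beta
    by (rule continuous_on_compose2[OF smooth_on_continuous[OF metric_smooth[OF c]] X])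
  have "continuous_on S (\<lambda>s. \<Sum>i\<in>UNIV. \<Sum>j\<in>UNIV. u s $ i * v s $ j * gram g c (cinv c (X s)) $ i $ j)"
    by (intro continuous_on_sum continuous_on_mult gr continuous_on_component[OF v(1)] continuous_on_component[OF v(2)])
  then show ?thesis
    by (rule continuous_on_eq) (use X(2) in \<open>auto simp: gram_expand[OF c cinv_mem[OF c]]\<close>)
qed

subsection \<open>Regular parameters\<close>

text \<open>A curve is regular at a parameter when it is continuously differentiable around it. In
  these terms, the piecewise continuously differentiable curves are the paths with finitely many
  exceptional parameters.\<close>

definition regular :: "(real \<Rightarrow> 'a) \<Rightarrow> real \<Rightarrow> bool" where
  "regular \<gamma> t \<longleftrightarrow> (\<exists>c\<in>A. \<exists>e>0. (\<forall>s\<in>ball t e. \<gamma> s \<in> cdom c) \<and> (cmap c \<circ> \<gamma>) C1_differentiable_on ball t e)"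

lemma C1_differentiable_on_smooth_compose:
  assumes F: "smooth_on F U" and f: "f C1_differentiable_on S" "f ` S \<subseteq> U"
  shows "(F \<circ> f) C1_differentiable_on S"
proof -
  obtain D where D: "\<And>x. x \<in> S \<Longrightarrow> (f has_vector_derivative D x) (at x)" "continuous_on S D"
    using f(1) by (auto simp: C1_differentiable_on_def)
  let ?D = "\<lambda>x. frechet_derivative F (at (f x)) (D x)"
  have lin: "linear (frechet_derivative F (at (f x)))" if "x \<in> S" for x
    using smooth_on_derivative[OF F] f(2) that has_derivative_linear by blast
  have der: "((F \<circ> f) has_vector_derivative ?D x) (at x)" if x: "x \<in> S" for x
    by (rule vector_derivative_diff_chain_within[OF D(1)[OF x] has_derivative_at_withinI[OF smooth_on_derivative[OF F]]])
       (use f(2) x in auto)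
  have cont: "continuous_on S ?D"
  proof (rule continuous_on_eq)
    have fc: "continuous_on S f"
      using D(1) has_vector_derivative_continuous continuous_at_imp_continuous_on by blast
    show "continuous_on S (\<lambda>x. \<Sum>i\<in>Basis. (D x \<bullet> i) *\<^sub>R frechet_derivative F (at (f x)) i)"
      by (intro continuous_on_sum continuous_on_scaleR continuous_on_inner D(2) continuous_on_const
          continuous_on_compose2[OF smooth_on_continuous_derivative[OF F] fc f(2)])
    fix x assume x: "x \<in> S"
    have "?D x = frechet_derivative F (at (f x)) (\<Sum>i\<in>Basis. (D x \<bullet> i) *\<^sub>R i)"
      by (simp add: euclidean_representation)
    then show "(\<Sum>i\<in>Basis. (D x \<bullet> i) *\<^sub>R frechet_derivative F (at (f x)) i) = ?D x"
      by (simp only: linear_sum[OF lin[OF x]] linear_scale[OF lin[OF x]])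
  qed
  show ?thesis unfolding C1_differentiable_on_def by (intro exI[of _ ?D] conjI ballI der cont)
qed

lemma C1_differentiable_on_cong:
  assumes "open S" "\<And>x. x \<in> S \<Longrightarrow> f x = f' x" "f C1_differentiable_on S"
  shows "f' C1_differentiable_on S"
proof -
  obtain D where D: "\<And>x. x \<in> S \<Longrightarrow> (f has_vector_derivative D x) (at x)" "continuous_on S D"
    using assms(3) by (auto simp: C1_differentiable_on_def)
  have "(f' has_vector_derivative D x) (at x)" if "x \<in> S" for x
    by (rule has_vector_derivative_transform_within_open[OF D(1)[OF that] assms(1) that assms(2)])
  with D(2) show ?thesis by (auto simp: C1_differentiable_on_def)
qed

lemma regular_isCont: "regular \<gamma> t \<Longrightarrow> isCont \<gamma> t"
proof -
  assume "regular \<gamma> t"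
  then obtain c e where c: "c \<in> A" "e > 0" "\<And>s. s \<in> ball t e \<Longrightarrow> \<gamma> s \<in> cdom c"
    "(cmap c \<circ> \<gamma>) C1_differentiable_on ball t e" by (auto simp: regular_def)
  have "continuous_on (ball t e) (cmap c \<circ> \<gamma>)"
    using C1_differentiable_imp_continuous_on c(4) by blast
  then have "continuous_on (ball t e) (\<lambda>s. cinv c ((cmap c \<circ> \<gamma>) s))"
    by (rule continuous_on_compose2[OF continuous_cinv[OF c(1)]]) (use c(3) in auto)
  then have "continuous_on (ball t e) \<gamma>"
    by (rule continuous_on_eq) (use c(1,3) in auto)
  then show ?thesis using c(2) by (simp add: continuous_on_eq_continuous_at)
qed

text \<open>Charts around \<open>\<gamma> t\<close> and \<open>h (\<gamma> t)\<close> differ by a smooth map. With \<open>h = id\<close> this says that regularity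
  can be tested in any chart.\<close>

lemma regular_smooth_map:
  assumes h: "smooth_map A h" and t: "regular \<gamma> t" and c': "c' \<in> A" "h (\<gamma> t) \<in> cdom c'"
  shows "\<exists>e>0. (\<forall>s\<in>ball t e. h (\<gamma> s) \<in> cdom c') \<and> (cmap c' \<circ> (h \<circ> \<gamma>)) C1_differentiable_on ball t e"
proof -
  obtain c e where c: "c \<in> A" "e > 0" "\<And>s. s \<in> ball t e \<Longrightarrow> \<gamma> s \<in> cdom c"
    "(cmap c \<circ> \<gamma>) C1_differentiable_on ball t e" using t by (auto simp: regular_def)
  have "isCont (h \<circ> \<gamma>) t"
    using regular_isCont[OF t] smooth_mapD(2)[OF h c(1) c'(1)]
    unfolding comp_def by (auto simp: continuous_on_eq_continuous_at intro: isCont_o2)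
  then have "eventually (\<lambda>s. h (\<gamma> s) \<in> cdom c') (nhds t)"
    using chart_open[OF c'(1)] c'(2) by (auto simp: continuous_at_open eventually_nhds)
  then obtain e' where e': "e' > 0" "\<And>s. s \<in> ball t e' \<Longrightarrow> h (\<gamma> s) \<in> cdom c'"
    by (auto simp: eventually_nhds_metric dist_commute)
  define \<epsilon> where "\<epsilon> = min e e'"
  have \<epsilon>: "\<epsilon> > 0" "ball t \<epsilon> \<subseteq> ball t e" "ball t \<epsilon> \<subseteq> ball t e'" using c e' by (auto simp: \<epsilon>_def)
  have "(coord_map c c' h \<circ> (cmap c \<circ> \<gamma>)) C1_differentiable_on ball t \<epsilon>"
    by (rule C1_differentiable_on_smooth_compose[OF smooth_mapD(1)[OF h c(1) c'(1)]
          C1_differentiable_on_subset[OF c(4) \<epsilon>(2)]])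
       (use c(1,3) e'(2) \<epsilon>(2,3) in \<open>auto intro!: coord_dom_mem\<close>)
  then have "(cmap c' \<circ> (h \<circ> \<gamma>)) C1_differentiable_on ball t \<epsilon>"
    by (rule C1_differentiable_on_cong[OF open_ball, rotated])
       (use c(1,3) \<epsilon>(2) in \<open>auto simp: coord_map_def\<close>)
  with \<epsilon> e'(2) show ?thesis by (intro exI[of _ \<epsilon>]) auto
qed

lemma regular_compose:
  assumes "smooth_map A h" "regular \<gamma> t"
  shows "regular (h \<circ> \<gamma>) t"
proof -
  obtain c where c: "c \<in> A" "h (\<gamma> t) \<in> cdom c" using exists_chart by blast
  obtain e where "e > 0" "\<forall>s\<in>ball t e. h (\<gamma> s) \<in> cdom c"
    "(cmap c \<circ> (h \<circ> \<gamma>)) C1_differentiable_on ball t e"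
    using regular_smooth_map[OF assms c] by blast
  then show ?thesis unfolding regular_def by (intro bexI[OF _ c(1)] exI[of _ e]) simp
qed

lemma regular_in_chart:
  assumes "regular \<gamma> t" "c \<in> A" "\<gamma> t \<in> cdom c"
  shows "\<exists>e>0. (\<forall>s\<in>ball t e. \<gamma> s \<in> cdom c) \<and> (cmap c \<circ> \<gamma>) C1_differentiable_on ball t e"
  using regular_smooth_map[OF smooth_map_id assms(1,2)] assms(3) by simp

lemma open_regular: "open {t. regular \<gamma> t}"
  unfolding open_contains_ball
proof (rule ballI)
  fix t assume "t \<in> {t. regular \<gamma> t}"
  then obtain c e where c: "c \<in> A" "e > 0" "\<And>s. s \<in> ball t e \<Longrightarrow> \<gamma> s \<in> cdom c"
    "(cmap c \<circ> \<gamma>) C1_differentiable_on ball t e" by (auto simp: regular_def)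
  have "regular \<gamma> s" if s: "s \<in> ball t e" for s
  proof -
    obtain e' where e': "e' > 0" "ball s e' \<subseteq> ball t e" using s open_contains_ball_eq[OF open_ball] by metis
    with c(3) C1_differentiable_on_subset[OF c(4) e'(2)] show ?thesis
      unfolding regular_def by (intro bexI[OF _ c(1)] exI[of _ e']) auto
  qed
  with c(2) show "\<exists>e>0. ball t e \<subseteq> {t. regular \<gamma> t}" by (intro exI[of _ e]) auto
qed

lemma finite_if_locally_finite:
  fixes N :: "real set"
  assumes "\<And>t. t \<in> {a..b} \<Longrightarrow> \<exists>e>0. finite (N \<inter> ball t e)"
  shows "finite (N \<inter> {a..b})"
proof -
  obtain e where e: "\<And>t. t \<in> {a..b} \<Longrightarrow> e t > 0" "\<And>t. t \<in> {a..b} \<Longrightarrow> finite (N \<inter> ball t (e t))"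
    using assms by metis
  obtain T where T: "T \<subseteq> {a..b}" "finite T" "{a..b} \<subseteq> (\<Union>t\<in>T. ball t (e t))"
    by (rule compactE_image[OF compact_Icc, of "{a..b}" "\<lambda>t. ball t (e t)" a b])
       (use e(1) in auto)
  have "N \<inter> {a..b} \<subseteq> (\<Union>t\<in>T. N \<inter> ball t (e t))" using T(3) by blast
  moreover have "finite (\<Union>t\<in>T. N \<inter> ball t (e t))" using T e(2) by blast
  ultimately show ?thesis by (rule finite_subset)
qed

lemma piecewise_C1_curve_iff:
  "piecewise_C1_curve A \<gamma> \<longleftrightarrow> path \<gamma> \<and> finite ({t. \<not> regular \<gamma> t} \<inter> {0..1})"
proof (intro iffI conjI)
  assume \<gamma>: "piecewise_C1_curve A \<gamma>"
  then show p: "path \<gamma>" by (simp add: piecewise_C1_curve_def)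
  show "finite ({t. \<not> regular \<gamma> t} \<inter> {0..1})"
  proof -
    have "finite ({t\<in>{0..1}. \<not> regular \<gamma> t} \<inter> {0..1})"
    proof (rule finite_if_locally_finite)
      fix t0 :: real assume t0: "t0 \<in> {0..1}"
      obtain c where c: "c \<in> A" "\<gamma> t0 \<in> cdom c" using exists_chart by blast
      have "continuous_on {0..1} \<gamma>" using p by (simp add: path_def)
      then have "\<forall>\<^sub>F t in at t0 within {0..1}. \<gamma> t \<in> cdom c"
        using t0 c(2) chart_open[OF c(1)] unfolding continuous_on_def by (blast dest: topological_tendstoD)
      then obtain e where e: "e > 0" "\<And>t. t \<in> {0..1} \<Longrightarrow> t \<noteq> t0 \<Longrightarrow> dist t t0 < e \<Longrightarrow> \<gamma> t \<in> cdom c"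
        unfolding eventually_at by blast
      define a where "a = max 0 (t0 - e / 2)" define b where "b = min 1 (t0 + e / 2)"
      have ab: "{a..b} \<subseteq> {0..1}" by (auto simp: a_def b_def)
      have img: "\<gamma> ` {a..b} \<subseteq> cdom c"
      proof safe
        fix t assume t: "t \<in> {a..b}"
        show "\<gamma> t \<in> cdom c"
        proof (cases "t = t0")
          case False
          then show ?thesis using t e(1) by (intro e(2)) (auto simp: a_def b_def dist_real_def)
        qed (use c in simp)
      qed
      have "(cmap c \<circ> \<gamma>) piecewise_C1_differentiable_on {a..b}"
        using \<gamma> c(1) ab img unfolding piecewise_C1_curve_def by blast
      then obtain S where S: "finite S" "(cmap c \<circ> \<gamma>) C1_differentiable_on ({a..b} - S)"
        by (auto simp: piecewise_C1_differentiable_on_def)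
      have reg: "regular \<gamma> t" if t: "t \<in> {a<..<b} - S" for t
      proof -
        have "open ({a<..<b} - S)" using S(1) by (intro open_Diff finite_imp_closed) auto
        then obtain e' where e': "e' > 0" "ball t e' \<subseteq> {a<..<b} - S" using t open_contains_ball by blast
        have "\<forall>s\<in>ball t e'. \<gamma> s \<in> cdom c"
        proof
          fix s assume "s \<in> ball t e'"
          then have "s \<in> {a..b}" using e'(2) by auto
          then show "\<gamma> s \<in> cdom c" using img by blast
        qed
        moreover have "(cmap c \<circ> \<gamma>) C1_differentiable_on ball t e'"
          by (rule C1_differentiable_on_subset[OF S(2)]) (use e'(2) in auto)
        ultimately show ?thesis unfolding regular_def using c(1) e'(1) by blast
      qed
      \<comment> \<open>At the ends \<open>0\<close> and \<open>1\<close> a curve need not be regular, as its values outside \<open>{0..1}\<close> are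
        arbitrary.\<close>
      have "{t\<in>{0..1}. \<not> regular \<gamma> t} \<inter> ball t0 (e / 2) \<subseteq> S \<union> {0, 1}"
      proof
        fix t assume t: "t \<in> {t\<in>{0..1}. \<not> regular \<gamma> t} \<inter> ball t0 (e / 2)"
        then have "t \<notin> {a<..<b} - S" using reg by auto
        moreover have "0 \<le> t" "t \<le> 1" "t0 - e / 2 < t" "t < t0 + e / 2"
        proof -
          have "\<bar>t0 - t\<bar> < e / 2" using t by (simp add: dist_real_def)
          then show "t0 - e / 2 < t" "t < t0 + e / 2" by linarith+
        qed (use t in auto)
        ultimately show "t \<in> S \<union> {0, 1}" by (auto simp: a_def b_def)
      qed
      moreover have "finite (S \<union> {0, 1})" using S(1) by simp
      ultimately show "\<exists>e>0. finite ({t\<in>{0..1}. \<not> regular \<gamma> t} \<inter> ball t0 e)"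
        using e(1) finite_subset by (intro exI[of _ "e / 2"]) auto
    qed
    then show ?thesis by (rule rev_finite_subset) auto
  qed
next
  assume \<gamma>: "path \<gamma> \<and> finite ({t. \<not> regular \<gamma> t} \<inter> {0..1})"
  show "piecewise_C1_curve A \<gamma>"
    unfolding piecewise_C1_curve_def
  proof (intro conjI ballI allI impI)
    show "path \<gamma>" using \<gamma> by simp
    fix c a b assume c: "c \<in> A" and ab: "{a..b} \<subseteq> {0..1} \<and> \<gamma> ` {a..b} \<subseteq> cdom c"
    have "continuous_on {0..1} \<gamma>" using \<gamma> by (simp add: path_def)
    then have \<gamma>c: "continuous_on {a..b} \<gamma>" using ab continuous_on_subset by blast
    define S where "S = {t. \<not> regular \<gamma> t} \<inter> {0..1}"
    have loc: "\<exists>e>0. (cmap c \<circ> \<gamma>) C1_differentiable_on ball t e" if "t \<in> {a..b} - S" for t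
      using regular_in_chart[of \<gamma> t c] that ab c by (auto simp: S_def subset_eq)
    have "(cmap c \<circ> \<gamma>) C1_differentiable_on ({a..b} - S)"
      unfolding C1_differentiable_on_eq
    proof (intro conjI ballI)
      fix t assume t: "t \<in> {a..b} - S"
      show "(cmap c \<circ> \<gamma>) differentiable at t"
        using loc[OF t] by (auto simp: C1_differentiable_on_eq)
    next
      show "continuous_on ({a..b} - S) (\<lambda>x. vector_derivative (cmap c \<circ> \<gamma>) (at x))"
      proof (rule continuous_at_imp_continuous_on, rule ballI)
        fix t assume t: "t \<in> {a..b} - S"
        obtain e where e: "e > 0" "continuous_on (ball t e) (\<lambda>x. vector_derivative (cmap c \<circ> \<gamma>) (at x))"
          using loc[OF t] by (auto simp: C1_differentiable_on_eq)
        then show "isCont (\<lambda>x. vector_derivative (cmap c \<circ> \<gamma>) (at x)) t"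
          by (simp add: continuous_on_eq_continuous_at)
      qed
    qed
    moreover have "continuous_on {a..b} (cmap c \<circ> \<gamma>)"
      using continuous_on_compose2[OF continuous_cmap[OF c] \<gamma>c] ab by (simp add: comp_def)
    moreover have "finite S" using \<gamma> by (simp add: S_def)
    ultimately show "(cmap c \<circ> \<gamma>) piecewise_C1_differentiable_on {a..b}"
      unfolding piecewise_C1_differentiable_on_def by blast
  qed
qed

subsection \<open>Speed\<close>

lemma regular_has_vector_derivative:
  assumes "regular \<gamma> t" "c \<in> A" "\<gamma> t \<in> cdom c"
  shows "((cmap c \<circ> \<gamma>) has_vector_derivative vector_derivative (cmap c \<circ> \<gamma>) (at t)) (at t)"
proof -
  obtain e where "e > 0" "(cmap c \<circ> \<gamma>) C1_differentiable_on ball t e"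
    using regular_in_chart[OF assms] by blast
  then have "(cmap c \<circ> \<gamma>) differentiable at t" by (auto simp: C1_differentiable_on_eq)
  then show ?thesis by (simp add: vector_derivative_works)
qed

lemma velocity_compose:
  assumes h: "smooth_map A h" and t: "regular \<gamma> t" and c: "c \<in> A" "\<gamma> t \<in> cdom c"
    and c': "c' \<in> A" "h (\<gamma> t) \<in> cdom c'"
  shows "vector_derivative (cmap c' \<circ> (h \<circ> \<gamma>)) (at t) =
         coord_deriv c c' h (\<gamma> t) (vector_derivative (cmap c \<circ> \<gamma>) (at t))"
proof -
  let ?v = "vector_derivative (cmap c \<circ> \<gamma>) (at t)"
  have der: "((coord_map c c' h \<circ> (cmap c \<circ> \<gamma>)) has_vector_derivative coord_deriv c c' h (\<gamma> t) ?v) (at t)"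
    by (rule vector_derivative_diff_chain_within[OF regular_has_vector_derivative[OF t c]
          has_derivative_at_withinI])
       (use coord_map_derivative[OF h c(1) c'(1) c(2) c'(2)] in simp)
  obtain e where e: "e > 0" "\<And>s. s \<in> ball t e \<Longrightarrow> \<gamma> s \<in> cdom c"
    using regular_in_chart[OF t c] by blast
  have mem: "t \<in> ball t e" using e(1) by simp
  have eq: "(coord_map c c' h \<circ> (cmap c \<circ> \<gamma>)) s = (cmap c' \<circ> (h \<circ> \<gamma>)) s" if "s \<in> ball t e" for s
    using e(2)[OF that] c(1) by (simp add: coord_map_def)
  have "((cmap c' \<circ> (h \<circ> \<gamma>)) has_vector_derivative coord_deriv c c' h (\<gamma> t) ?v) (at t)"
    by (rule has_vector_derivative_transform_within_open[OF der open_ball mem eq])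
  then show ?thesis by (rule vector_derivative_at)
qed

lemma isometryD:
  assumes "isometry A g h"
  shows "bij h" "smooth_map A h" "smooth_map A (inv h)"
    "c \<in> A \<Longrightarrow> c' \<in> A \<Longrightarrow> p \<in> cdom c \<Longrightarrow> h p \<in> cdom c' \<Longrightarrow>
       g c' (h p) (coord_deriv c c' h p u) (coord_deriv c c' h p v) = g c p u v"
  using assms by (auto simp: isometry_def)

text \<open>The chart in the definition of the speed is arbitrary; the transformation law, in the form
  of an isometry, removes the choice.\<close>

lemma speed_compose_in_chart:
  assumes h: "isometry A g h" and t: "regular \<gamma> t" and c: "c \<in> A" "\<gamma> t \<in> cdom c"
  shows "speed A g (h \<circ> \<gamma>) t =
         sqrt (g c (\<gamma> t) (vector_derivative (cmap c \<circ> \<gamma>) (at t)) (vector_derivative (cmap c \<circ> \<gamma>) (at t)))"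
proof -
  define c' where "c' = (SOME c. c \<in> A \<and> (h \<circ> \<gamma>) t \<in> cdom c)"
  have c': "c' \<in> A \<and> (h \<circ> \<gamma>) t \<in> cdom c'"
    unfolding c'_def by (rule someI_ex) (use exists_chart in blast)
  then show ?thesis
    unfolding speed_def Let_def c'_def[symmetric]
    using velocity_compose[OF isometryD(2)[OF h] t c] isometryD(4)[OF h c(1) _ c(2)] by simp
qed

lemma speed_in_chart:
  assumes "regular \<gamma> t" "c \<in> A" "\<gamma> t \<in> cdom c"
  shows "speed A g \<gamma> t =
         sqrt (g c (\<gamma> t) (vector_derivative (cmap c \<circ> \<gamma>) (at t)) (vector_derivative (cmap c \<circ> \<gamma>) (at t)))"
  using speed_compose_in_chart[OF isometry_id assms] by simp

lemma speed_isometry: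
  assumes "isometry A g h" "regular \<gamma> t"
  shows "speed A g (h \<circ> \<gamma>) t = speed A g \<gamma> t"
  using exists_chart[of "\<gamma> t"] speed_compose_in_chart[OF assms] speed_in_chart[OF assms(2)] by auto

lemma speed_nonneg: "0 \<le> speed A g \<gamma> t"
proof -
  define c where "c = (SOME c. c \<in> A \<and> \<gamma> t \<in> cdom c)"
  have "c \<in> A \<and> \<gamma> t \<in> cdom c"
    unfolding c_def by (rule someI_ex) (use exists_chart in blast)
  then show ?thesis unfolding speed_def Let_def c_def[symmetric] by (simp add: metric_nonneg)
qed

lemma speed_continuous: "continuous_on {t. regular \<gamma> t} (speed A g \<gamma>)"
proof (rule continuous_at_imp_continuous_on, rule ballI)
  fix t assume "t \<in> {t. regular \<gamma> t}"
  then have t: "regular \<gamma> t" by simp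
  obtain c where c: "c \<in> A" "\<gamma> t \<in> cdom c" using exists_chart by blast
  obtain e where e: "e > 0" "\<And>s. s \<in> ball t e \<Longrightarrow> \<gamma> s \<in> cdom c"
    "(cmap c \<circ> \<gamma>) C1_differentiable_on ball t e" using regular_in_chart[OF t c] by blast
  let ?v = "\<lambda>s. vector_derivative (cmap c \<circ> \<gamma>) (at s)"
  have v: "continuous_on (ball t e) ?v" using e(3) by (simp add: C1_differentiable_on_eq)
  have "(cmap c \<circ> \<gamma>) ` ball t e \<subseteq> cmap c ` cdom c" using e(2) by auto
  from continuous_on_real_sqrt[OF metric_continuous[OF c(1)
        C1_differentiable_imp_continuous_on[OF e(3)] this v v]]
  have "continuous_on (ball t e) (\<lambda>s. sqrt (g c (cinv c ((cmap c \<circ> \<gamma>) s)) (?v s) (?v s)))" .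
  then have "continuous_on (ball t e) (speed A g \<gamma>)"
  proof (rule continuous_on_eq)
    fix s assume s: "s \<in> ball t e"
    obtain e' where e': "e' > 0" "ball s e' \<subseteq> ball t e" using s open_contains_ball_eq[OF open_ball] by metis
    have "regular \<gamma> s"
      unfolding regular_def using e(2) e' C1_differentiable_on_subset[OF e(3) e'(2)] c(1) by blast
    from speed_in_chart[OF this c(1) e(2)[OF s]]
    show "sqrt (g c (cinv c ((cmap c \<circ> \<gamma>) s)) (?v s) (?v s)) = speed A g \<gamma> s"
      using e(2)[OF s] c(1) by simp
  qed
  then show "isCont (speed A g \<gamma>) t" using e(1) by (simp add: continuous_on_eq_continuous_at)
qed

lemma regular_speed_cong:
  assumes "open S" "t \<in> S" "\<And>s. s \<in> S \<Longrightarrow> \<gamma> s = \<gamma>' s"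
  shows "regular \<gamma> t \<longleftrightarrow> regular \<gamma>' t" "regular \<gamma> t \<Longrightarrow> speed A g \<gamma> t = speed A g \<gamma>' t"
proof -
  have imp: "regular \<gamma>' t" if reg: "regular \<gamma> t" and eq: "\<And>s. s \<in> S \<Longrightarrow> \<gamma> s = \<gamma>' s" for \<gamma> \<gamma>'
  proof -
    obtain c e where c: "c \<in> A" "e > 0" "\<And>s. s \<in> ball t e \<Longrightarrow> \<gamma> s \<in> cdom c"
      "(cmap c \<circ> \<gamma>) C1_differentiable_on ball t e" using reg by (auto simp: regular_def)
    obtain e' where e': "e' > 0" "ball t e' \<subseteq> S" using assms(1,2) open_contains_ball by blast
    define \<epsilon> where "\<epsilon> = min e e'"
    have \<epsilon>: "\<epsilon> > 0" "ball t \<epsilon> \<subseteq> ball t e" "ball t \<epsilon> \<subseteq> S" using c e' by (auto simp: \<epsilon>_def)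
    have "(cmap c \<circ> \<gamma>') C1_differentiable_on ball t \<epsilon>"
      by (rule C1_differentiable_on_cong[OF open_ball _ C1_differentiable_on_subset[OF c(4) \<epsilon>(2)]])
         (use eq \<epsilon>(3) in \<open>auto simp: subset_eq\<close>)
    moreover have "\<forall>s\<in>ball t \<epsilon>. \<gamma>' s \<in> cdom c"
    proof
      fix s assume s: "s \<in> ball t \<epsilon>"
      then have "\<gamma> s \<in> cdom c" "\<gamma> s = \<gamma>' s" using \<epsilon> c(3) eq by auto
      then show "\<gamma>' s \<in> cdom c" by simp
    qed
    ultimately show ?thesis unfolding regular_def using c(1) \<epsilon>(1) by blast
  qed
  show "regular \<gamma> t \<longleftrightarrow> regular \<gamma>' t"
    using imp[of \<gamma> \<gamma>'] imp[of \<gamma>' \<gamma>] assms(3) by metis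
  assume reg: "regular \<gamma> t"
  obtain c where c: "c \<in> A" "\<gamma> t \<in> cdom c" using exists_chart by blast
  have "((cmap c \<circ> \<gamma>') has_vector_derivative vector_derivative (cmap c \<circ> \<gamma>) (at t)) (at t)"
    by (rule has_vector_derivative_transform_within_open
          [OF regular_has_vector_derivative[OF reg c] assms(1,2)]) (simp add: assms(3))
  from vector_derivative_at[OF this] show "speed A g \<gamma> t = speed A g \<gamma>' t"
    using speed_in_chart[OF reg c] speed_in_chart[OF imp[OF reg assms(3)] c(1)] assms(2,3) c(2) by simp
qed

lemma regular_speed_affine:
  assumes m: "m \<noteq> 0" and t: "regular \<gamma> (k + m * t)"
  shows "regular (\<lambda>s. \<gamma> (k + m * s)) t" "speed A g (\<lambda>s. \<gamma> (k + m * s)) t = \<bar>m\<bar> * speed A g \<gamma> (k + m * t)"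
proof -
  let ?a = "\<lambda>s. k + m * s"
  obtain c where c: "c \<in> A" "\<gamma> (?a t) \<in> cdom c" using exists_chart by blast
  obtain e where e: "e > 0" "\<And>s. s \<in> ball (?a t) e \<Longrightarrow> \<gamma> s \<in> cdom c"
    "(cmap c \<circ> \<gamma>) C1_differentiable_on ball (?a t) e" using regular_in_chart[OF t c] by blast
  obtain D where D: "\<And>x. x \<in> ball (?a t) e \<Longrightarrow> ((cmap c \<circ> \<gamma>) has_vector_derivative D x) (at x)"
    "continuous_on (ball (?a t) e) D" using e(3) unfolding C1_differentiable_on_def by blast
  define \<epsilon> where "\<epsilon> = e / \<bar>m\<bar>"
  have \<epsilon>: "\<epsilon> > 0" using e(1) m by (simp add: \<epsilon>_def)
  have ball: "?a s \<in> ball (?a t) e" if "s \<in> ball t \<epsilon>" for s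
  proof -
    have "dist (?a t) (?a s) = \<bar>m\<bar> * dist t s"
      by (simp add: dist_real_def abs_mult[symmetric] algebra_simps)
    also have "\<dots> < \<bar>m\<bar> * \<epsilon>" using that m by (intro mult_strict_left_mono) auto
    finally show ?thesis using m by (simp add: \<epsilon>_def)
  qed
  have aff: "(?a has_vector_derivative m) (at s)" for s
    by (auto intro!: derivative_eq_intros simp: has_real_derivative_iff_has_vector_derivative[symmetric])
  have der: "((cmap c \<circ> (\<lambda>s. \<gamma> (?a s))) has_vector_derivative m *\<^sub>R D (?a s)) (at s)" if "s \<in> ball t \<epsilon>" for s
    using vector_diff_chain_at[OF aff D(1)[OF ball[OF that]]] by (simp add: comp_def)
  have "continuous_on (ball t \<epsilon>) (\<lambda>s. m *\<^sub>R D (?a s))"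
    by (intro continuous_on_scaleR continuous_on_const continuous_on_compose2[OF D(2)] continuous_on_add
        continuous_on_mult continuous_on_id) (use ball in auto)
  with der have "(cmap c \<circ> (\<lambda>s. \<gamma> (?a s))) C1_differentiable_on ball t \<epsilon>"
    unfolding C1_differentiable_on_def by (intro exI[of _ "\<lambda>s. m *\<^sub>R D (?a s)"]) auto
  then show reg: "regular (\<lambda>s. \<gamma> (k + m * s)) t"
    unfolding regular_def using c(1) \<epsilon> e(2) ball by blast
  have v: "vector_derivative (cmap c \<circ> \<gamma>) (at (?a t)) = D (?a t)"
    using D(1) e(1) by (intro vector_derivative_at) simp
  have w: "vector_derivative (cmap c \<circ> (\<lambda>s. \<gamma> (?a s))) (at t) = m *\<^sub>R D (?a t)"
    using der \<epsilon> by (intro vector_derivative_at) simp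
  note b = metric_bilinear[OF c]
  have "speed A g (\<lambda>s. \<gamma> (?a s)) t = sqrt (g c (\<gamma> (?a t)) (m *\<^sub>R D (?a t)) (m *\<^sub>R D (?a t)))"
    using speed_in_chart[OF reg c] w by simp
  also have "\<dots> = sqrt (m\<^sup>2 * g c (\<gamma> (?a t)) (D (?a t)) (D (?a t)))"
    by (simp add: bilinear_lmul[OF b] bilinear_rmul[OF b] power2_eq_square mult.assoc)
  also have "\<dots> = \<bar>m\<bar> * speed A g \<gamma> (?a t)"
    using speed_in_chart[OF t c] v by (simp add: real_sqrt_mult)
  finally show "speed A g (\<lambda>s. \<gamma> (k + m * s)) t = \<bar>m\<bar> * speed A g \<gamma> (k + m * t)" .
qed


section \<open>The Riemannian distance\<close>

subsection \<open>Length\<close>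

text \<open>The length of the part of a curve between two parameters. Only regular parameters in the
  open interval count, so that the values of the curve outside it do not matter.\<close>

definition len :: "(real \<Rightarrow> 'a) \<Rightarrow> real \<Rightarrow> real \<Rightarrow> ennreal" where
  "len \<gamma> a b = (\<integral>\<^sup>+t. ennreal (speed A g \<gamma> t) * indicator ({a<..<b} \<inter> {t. regular \<gamma> t}) t \<partial>lborel)"

lemma speed_measurable:
  assumes "S \<in> sets borel"
  shows "(\<lambda>t. ennreal (speed A g \<gamma> t) * indicator (S \<inter> {t. regular \<gamma> t}) t) \<in> borel_measurable borel"
proof -
  have "(\<lambda>t. indicator {t. regular \<gamma> t} t *\<^sub>R speed A g \<gamma> t) \<in> borel_measurable borel"
    using open_regular by (intro borel_measurable_continuous_on_indicator speed_continuous) auto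
  then have "(\<lambda>t. ennreal (indicator {t. regular \<gamma> t} t *\<^sub>R speed A g \<gamma> t) * indicator S t) \<in> borel_measurable borel"
    using assms by measurable
  also have "(\<lambda>t. ennreal (indicator {t. regular \<gamma> t} t *\<^sub>R speed A g \<gamma> t) * indicator S t)
      = (\<lambda>t. ennreal (speed A g \<gamma> t) * indicator (S \<inter> {t. regular \<gamma> t}) t)"
    by (auto simp: indicator_def fun_eq_iff)
  finally show ?thesis .
qed

lemma curve_length_eq_len:
  assumes "piecewise_C1_curve A \<gamma>"
  shows "curve_length A g \<gamma> = len \<gamma> 0 1"
proof -
  let ?N = "({t. \<not> regular \<gamma> t} \<inter> {0..1}) \<union> {0, 1}"
  have "finite ?N" using assms by (simp add: piecewise_C1_curve_iff)
  then have N: "?N \<in> null_sets lborel" by (rule finite_imp_null_set_lborel)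
  show ?thesis
    unfolding curve_length_def len_def
  proof (rule nn_integral_cong_AE, rule AE_mp[OF AE_not_in[OF N]], rule AE_I2, rule impI)
    fix t assume "t \<notin> ?N"
    then show "ennreal (speed A g \<gamma> t) * indicator {0..1} t
        = ennreal (speed A g \<gamma> t) * indicator ({0<..<1} \<inter> {t. regular \<gamma> t}) t"
      by (auto simp: indicator_def)
  qed
qed

lemma len_self [simp]: "len \<gamma> a a = 0"
  by (simp add: len_def)

lemma len_add:
  assumes "a \<le> b" "b \<le> c"
  shows "len \<gamma> a c = len \<gamma> a b + len \<gamma> b c"
proof -
  let ?I = "\<lambda>a b. {a<..<b} \<inter> {t. regular \<gamma> t}"
  have "len \<gamma> a c = (\<integral>\<^sup>+t. ennreal (speed A g \<gamma> t) * indicator (?I a b) t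
      + ennreal (speed A g \<gamma> t) * indicator (?I b c) t \<partial>lborel)"
    unfolding len_def
  proof (rule nn_integral_cong_AE, rule AE_mp[OF AE_lborel_singleton[of b]], rule AE_I2, rule impI)
    fix t assume "t \<noteq> b"
    then show "ennreal (speed A g \<gamma> t) * indicator (?I a c) t
        = ennreal (speed A g \<gamma> t) * indicator (?I a b) t + ennreal (speed A g \<gamma> t) * indicator (?I b c) t"
      using assms by (auto simp: indicator_def)
  qed
  also have "\<dots> = len \<gamma> a b + len \<gamma> b c"
    unfolding len_def using speed_measurable by (intro nn_integral_add) auto
  finally show ?thesis .
qed

lemma len_cong:
  assumes "\<And>t. t \<in> {a<..<b} \<Longrightarrow> \<gamma> t = \<gamma>' t"
  shows "len \<gamma> a b = len \<gamma>' a b"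
  unfolding len_def
proof (rule nn_integral_cong)
  fix t
  show "ennreal (speed A g \<gamma> t) * indicator ({a<..<b} \<inter> {t. regular \<gamma> t}) t
      = ennreal (speed A g \<gamma>' t) * indicator ({a<..<b} \<inter> {t. regular \<gamma>' t}) t"
    using regular_speed_cong[OF open_greaterThanLessThan[of a b], of t \<gamma> \<gamma>'] assms
    by (auto simp: indicator_def)
qed

lemma regular_affine_iff:
  assumes "m \<noteq> 0"
  shows "regular (\<lambda>s. \<gamma> (k + m * s)) t \<longleftrightarrow> regular \<gamma> (k + m * t)"
proof
  assume r: "regular (\<lambda>s. \<gamma> (k + m * s)) t"
  have "- k / m + 1 / m * (k + m * t) = t" using assms by (simp add: field_simps)
  with r have "regular (\<lambda>u. \<gamma> (k + m * (- k / m + 1 / m * u))) (k + m * t)"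
    using assms regular_speed_affine(1)[of "1 / m" "\<lambda>s. \<gamma> (k + m * s)" "- k / m" "k + m * t"] by simp
  moreover have "k + m * (- k / m + 1 / m * u) = u" for u using assms by (simp add: field_simps)
  ultimately show "regular \<gamma> (k + m * t)" by simp
qed (rule regular_speed_affine(1)[OF assms])

lemma len_affine:
  assumes m: "m \<noteq> 0" and S: "\<And>s. a < s \<and> s < b \<longleftrightarrow> a' < k + m * s \<and> k + m * s < b'"
  shows "len (\<lambda>s. \<gamma> (k + m * s)) a b = len \<gamma> a' b'"
proof -
  let ?f = "\<lambda>u. ennreal (speed A g \<gamma> u) * indicator ({a'<..<b'} \<inter> {t. regular \<gamma> t}) u"
  have "len \<gamma> a' b' = ennreal \<bar>m\<bar> * (\<integral>\<^sup>+s. ?f (k + m * s) \<partial>lborel)"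
    unfolding len_def by (rule nn_integral_real_affine[OF speed_measurable m]) simp
  also have "\<dots> = (\<integral>\<^sup>+s. ennreal \<bar>m\<bar> * ?f (k + m * s) \<partial>lborel)"
  proof (rule nn_integral_cmult[symmetric])
    have "(\<lambda>s. k + m * s) \<in> borel_measurable borel" by measurable
    from measurable_compose[OF this speed_measurable[of "{a'<..<b'}" \<gamma>]]
    show "(\<lambda>s. ?f (k + m * s)) \<in> borel_measurable lborel" by simp
  qed
  also have "\<dots> = len (\<lambda>s. \<gamma> (k + m * s)) a b"
    unfolding len_def
  proof (rule nn_integral_cong)
    fix s
    show "ennreal \<bar>m\<bar> * ?f (k + m * s) = ennreal (speed A g (\<lambda>s. \<gamma> (k + m * s)) s)
        * indicator ({a<..<b} \<inter> {t. regular (\<lambda>s. \<gamma> (k + m * s)) t}) s"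
      using S[of s] regular_affine_iff[OF m, of \<gamma> k s] regular_speed_affine(2)[OF m, of \<gamma> k s]
      by (auto simp: indicator_def ennreal_mult speed_nonneg)
  qed
  finally show ?thesis ..
qed

subsection \<open>Curves between two points\<close>

definition curves :: "'a \<Rightarrow> 'a \<Rightarrow> (real \<Rightarrow> 'a) set" where
  "curves p q = {\<gamma>. piecewise_C1_curve A \<gamma> \<and> pathstart \<gamma> = p \<and> pathfinish \<gamma> = q}"

lemma curves_iff:
  "\<gamma> \<in> curves p q \<longleftrightarrow> continuous_on {0..1} \<gamma> \<and> finite ({t. \<not> regular \<gamma> t} \<inter> {0..1}) \<and> \<gamma> 0 = p \<and> \<gamma> 1 = q"
  by (auto simp: curves_def piecewise_C1_curve_iff path_def pathstart_def pathfinish_def)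

text \<open>The infimum in the definition of the distance before it is made a real number.\<close>

definition ext_dist :: "'a \<Rightarrow> 'a \<Rightarrow> ennreal" where
  "ext_dist p q = (INF \<gamma>\<in>curves p q. len \<gamma> 0 1)"

lemma riem_dist_eq: "riem_dist A g p q = enn2real (ext_dist p q)"
proof -
  have "(INF \<gamma>\<in>curves p q. curve_length A g \<gamma>) = ext_dist p q"
    unfolding ext_dist_def by (intro INF_cong refl curve_length_eq_len) (simp add: curves_def)
  then show ?thesis by (simp add: riem_dist_def curves_def)
qed

lemma curve_affine:
  assumes \<gamma>: "\<gamma> \<in> curves p q" and m: "m \<noteq> 0" and S: "\<And>s. s \<in> {0..1} \<Longrightarrow> k + m * s \<in> {0..1}"
  shows "(\<lambda>s. \<gamma> (k + m * s)) \<in> curves (\<gamma> k) (\<gamma> (k + m))"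
proof -
  have "continuous_on {0..1} (\<lambda>s. \<gamma> (k + m * s))"
  proof (rule continuous_on_compose2[where f = "\<lambda>s. k + m * s"])
    show "continuous_on {0..1} \<gamma>" using \<gamma> by (simp add: curves_iff)
    show "continuous_on {0..1} (\<lambda>s. k + m * s)"
      by (intro continuous_on_add continuous_on_mult continuous_on_const continuous_on_id)
  qed (use S in auto)
  moreover have "finite ({t. \<not> regular (\<lambda>s. \<gamma> (k + m * s)) t} \<inter> {0..1})"
  proof (rule finite_subset)
    show "{t. \<not> regular (\<lambda>s. \<gamma> (k + m * s)) t} \<inter> {0..1}
        \<subseteq> (\<lambda>u. (u - k) / m) ` ({t. \<not> regular \<gamma> t} \<inter> {0..1})"
    proof
      fix t assume "t \<in> {t. \<not> regular (\<lambda>s. \<gamma> (k + m * s)) t} \<inter> {0..1}"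
      then show "t \<in> (\<lambda>u. (u - k) / m) ` ({t. \<not> regular \<gamma> t} \<inter> {0..1})"
        using S[of t] m by (intro image_eqI[of _ _ "k + m * t"]) (auto simp: regular_affine_iff[OF m])
    qed
    show "finite ((\<lambda>u. (u - k) / m) ` ({t. \<not> regular \<gamma> t} \<inter> {0..1}))"
      using \<gamma> by (simp add: curves_iff)
  qed
  ultimately show ?thesis by (simp add: curves_iff)
qed

lemma constant_curve: "(\<lambda>_. p) \<in> curves p p" "len (\<lambda>_. p) a b = 0"
proof -
  obtain c where c: "c \<in> A" "p \<in> cdom c" using exists_chart by blast
  have C1: "(cmap c \<circ> (\<lambda>_. p)) C1_differentiable_on ball t 1" for t :: real
    unfolding C1_differentiable_on_def
    by (intro exI[of _ "\<lambda>_. 0"]) (auto simp: comp_def intro: has_vector_derivative_const)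
  then have reg: "regular (\<lambda>_. p) t" for t
    unfolding regular_def using c zero_less_one by blast
  then show "(\<lambda>_. p) \<in> curves p p" by (simp add: curves_iff)
  have "vector_derivative (cmap c \<circ> (\<lambda>_. p)) (at t) = 0" for t :: real
    by (rule vector_derivative_at) (simp add: comp_def)
  then have "speed A g (\<lambda>_. p) t = 0" for t
    using speed_in_chart[OF reg c] bilinear_lzero[OF metric_bilinear[OF c]] by simp
  then show "len (\<lambda>_. p) a b = 0" by (simp add: len_def)
qed

lemma ext_dist_le_len: "\<gamma> \<in> curves p q \<Longrightarrow> ext_dist p q \<le> len \<gamma> 0 1"
  unfolding ext_dist_def by (rule INF_lower)

lemma ext_dist_self [simp]: "ext_dist p p = 0"
  using ext_dist_le_len[OF constant_curve(1)] constant_curve(2) by simp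

lemma exists_curve_less: "ext_dist p q < L \<Longrightarrow> \<exists>\<gamma>\<in>curves p q. len \<gamma> 0 1 < L"
  unfolding ext_dist_def by (simp add: INF_less_iff)

lemma ext_dist_le_part:
  assumes \<gamma>: "\<gamma> \<in> curves p q" and ab: "0 \<le> a" "a \<le> b" "b \<le> 1"
  shows "ext_dist (\<gamma> a) (\<gamma> b) \<le> len \<gamma> a b"
proof (cases "a = b")
  case False
  then have m: "b - a \<noteq> 0" "0 < b - a" using ab by auto
  have S: "a + (b - a) * s \<in> {0..1}" if "s \<in> {0..1}" for s
  proof -
    have "(b - a) * s \<le> (b - a) * 1" "0 \<le> (b - a) * s" using m that by (auto intro: mult_left_mono)
    then show ?thesis using ab by auto
  qed
  have "(\<lambda>s. \<gamma> (a + (b - a) * s)) \<in> curves (\<gamma> a) (\<gamma> (a + (b - a)))"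
    by (rule curve_affine[OF \<gamma> m(1) S])
  from ext_dist_le_len[OF this] have "ext_dist (\<gamma> a) (\<gamma> b) \<le> len (\<lambda>s. \<gamma> (a + (b - a) * s)) 0 1" by simp
  also have "\<dots> = len \<gamma> a b"
  proof (rule len_affine[OF m(1)])
    fix s
    have "a + (b - a) * s < b \<longleftrightarrow> (b - a) * s < (b - a) * 1" by auto
    then show "0 < s \<and> s < 1 \<longleftrightarrow> a < a + (b - a) * s \<and> a + (b - a) * s < b"
      using m(2) mult_less_cancel_left_pos[OF m(2)] by (simp add: zero_less_mult_iff)
  qed
  finally show ?thesis .
qed simp

lemma ext_dist_commute_le: "ext_dist p q \<le> ext_dist q p"
  unfolding ext_dist_def[of q p]
proof (rule INF_greatest)
  fix \<gamma> assume \<gamma>: "\<gamma> \<in> curves q p"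
  have "(\<lambda>s. \<gamma> (1 + (-1) * s)) \<in> curves (\<gamma> 1) (\<gamma> (1 + (-1)))"
    by (rule curve_affine[OF \<gamma>]) auto
  then have "(\<lambda>s. \<gamma> (1 + (-1) * s)) \<in> curves p q" using \<gamma> by (simp add: curves_iff)
  from ext_dist_le_len[OF this] have "ext_dist p q \<le> len (\<lambda>s. \<gamma> (1 + (-1) * s)) 0 1" .
  also have "\<dots> = len \<gamma> 0 1" by (rule len_affine) auto
  finally show "ext_dist p q \<le> len \<gamma> 0 1" .
qed

lemma ext_dist_commute: "ext_dist p q = ext_dist q p"
  by (intro antisym ext_dist_commute_le)

lemma join_curve:
  assumes \<gamma>1: "\<gamma>1 \<in> curves p q" and \<gamma>2: "\<gamma>2 \<in> curves q r"
  shows "\<gamma>1 +++ \<gamma>2 \<in> curves p r" "len (\<gamma>1 +++ \<gamma>2) 0 1 = len \<gamma>1 0 1 + len \<gamma>2 0 1"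
proof -
  let ?\<gamma> = "\<gamma>1 +++ \<gamma>2"
  have left: "?\<gamma> s = \<gamma>1 (0 + 2 * s)" if "s \<in> {..<1/2}" for s using that by (simp add: joinpaths_def)
  have right: "?\<gamma> s = \<gamma>2 (-1 + 2 * s)" if "s \<in> {1/2<..}" for s using that by (simp add: joinpaths_def)
  have regl: "regular ?\<gamma> t \<longleftrightarrow> regular \<gamma>1 (0 + 2 * t)" if "t < 1/2" for t
    using regular_speed_cong(1)[OF open_lessThan[of "1/2"], of t ?\<gamma> "\<lambda>s. \<gamma>1 (0 + 2 * s)"] left that
      regular_affine_iff[of 2 \<gamma>1 0 t] by simp
  have regr: "regular ?\<gamma> t \<longleftrightarrow> regular \<gamma>2 (-1 + 2 * t)" if "t > 1/2" for t
    using regular_speed_cong(1)[OF open_greaterThan[of "1/2"], of t ?\<gamma> "\<lambda>s. \<gamma>2 (-1 + 2 * s)"] right that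
      regular_affine_iff[of 2 \<gamma>2 "-1" t] by simp
  have "path ?\<gamma>"
    using \<gamma>1 \<gamma>2 by (intro path_join_imp) (auto simp: curves_iff path_def pathstart_def pathfinish_def)
  moreover have "finite ({t. \<not> regular ?\<gamma> t} \<inter> {0..1})"
  proof (rule finite_subset)
    let ?N = "\<lambda>\<gamma>. {t. \<not> regular \<gamma> t} \<inter> {0..1}"
    show "?N ?\<gamma> \<subseteq> {1/2} \<union> (\<lambda>u. u / 2) ` ?N \<gamma>1 \<union> (\<lambda>u. (u + 1) / 2) ` ?N \<gamma>2"
    proof
      fix t assume t: "t \<in> ?N ?\<gamma>"
      show "t \<in> {1/2} \<union> (\<lambda>u. u / 2) ` ?N \<gamma>1 \<union> (\<lambda>u. (u + 1) / 2) ` ?N \<gamma>2"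
      proof (cases t "1/2 :: real" rule: linorder_cases)
        case less
        then have "t \<in> (\<lambda>u. u / 2) ` ?N \<gamma>1" using t regl by (intro image_eqI[of _ _ "2 * t"]) auto
        then show ?thesis by blast
      next
        case greater
        then have "t \<in> (\<lambda>u. (u + 1) / 2) ` ?N \<gamma>2" using t regr by (intro image_eqI[of _ _ "-1 + 2 * t"]) auto
        then show ?thesis by blast
      qed simp
    qed
    show "finite ({1/2} \<union> (\<lambda>u. u / 2) ` ?N \<gamma>1 \<union> (\<lambda>u. (u + 1) / 2) ` ?N \<gamma>2)"
      using \<gamma>1 \<gamma>2 by (simp add: curves_iff)
  qed
  moreover have "?\<gamma> 0 = p" "?\<gamma> 1 = r" using \<gamma>1 \<gamma>2 by (auto simp: curves_iff joinpaths_def)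
  ultimately show "?\<gamma> \<in> curves p r" by (simp add: curves_iff path_def)
  have "len ?\<gamma> 0 1 = len ?\<gamma> 0 (1/2) + len ?\<gamma> (1/2) 1" by (rule len_add) auto
  also have "len ?\<gamma> 0 (1/2) = len (\<lambda>s. \<gamma>1 (0 + 2 * s)) 0 (1/2)" by (rule len_cong) (use left in auto)
  also have "\<dots> = len \<gamma>1 0 1" by (rule len_affine) auto
  also have "len ?\<gamma> (1/2) 1 = len (\<lambda>s. \<gamma>2 (-1 + 2 * s)) (1/2) 1" by (rule len_cong) (use right in auto)
  also have "\<dots> = len \<gamma>2 0 1" by (rule len_affine) auto
  finally show "len ?\<gamma> 0 1 = len \<gamma>1 0 1 + len \<gamma>2 0 1" .
qed

lemma ext_dist_triangle: "ext_dist p r \<le> ext_dist p q + ext_dist q r"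
proof (cases "ext_dist p q + ext_dist q r = \<infinity>")
  case False
  then have fin: "ext_dist p q < \<infinity>" "ext_dist q r < \<infinity>" by (auto simp: less_top)
  show ?thesis
  proof (rule ennreal_le_epsilon)
    fix e :: real assume e: "0 < e"
    have "ext_dist p q < ext_dist p q + ennreal (e / 2)" "ext_dist q r < ext_dist q r + ennreal (e / 2)"
      using fin e by (auto simp: ennreal_add_left_cancel_less[where b = 0, simplified])
    then obtain \<gamma>1 \<gamma>2 where \<gamma>: "\<gamma>1 \<in> curves p q" "len \<gamma>1 0 1 < ext_dist p q + ennreal (e / 2)"
      "\<gamma>2 \<in> curves q r" "len \<gamma>2 0 1 < ext_dist q r + ennreal (e / 2)"
      using exists_curve_less by meson
    have "ext_dist p r \<le> len \<gamma>1 0 1 + len \<gamma>2 0 1"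
      using ext_dist_le_len[OF join_curve(1)[OF \<gamma>(1,3)]] join_curve(2)[OF \<gamma>(1,3)] by simp
    also have "\<dots> \<le> (ext_dist p q + ennreal (e / 2)) + (ext_dist q r + ennreal (e / 2))"
      using \<gamma>(2,4) by (intro add_mono) auto
    also have "\<dots> = ext_dist p q + ext_dist q r + (ennreal (e / 2) + ennreal (e / 2))"
      by (simp add: ac_simps)
    also have "ennreal (e / 2) + ennreal (e / 2) = ennreal e"
      using e by (simp flip: ennreal_plus)
    finally show "ext_dist p r \<le> ext_dist p q + ext_dist q r + ennreal e" .
  qed
next
  case True
  show ?thesis unfolding True by simp
qed

subsection \<open>Isometries preserve the distance\<close>

lemma smooth_map_curve:
  assumes h: "smooth_map A h" and \<gamma>: "\<gamma> \<in> curves p q"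
  shows "h \<circ> \<gamma> \<in> curves (h p) (h q)"
proof -
  obtain c where c: "c \<in> A" using exists_chart by blast
  have "continuous_on {0..1} (h \<circ> \<gamma>)"
    using \<gamma> continuous_on_subset[OF smooth_mapD(2)[OF h c c]]
    by (intro continuous_on_compose) (auto simp: curves_iff)
  moreover have "finite ({t. \<not> regular (h \<circ> \<gamma>) t} \<inter> {0..1})"
    by (rule finite_subset[of _ "{t. \<not> regular \<gamma> t} \<inter> {0..1}"])
       (use \<gamma> regular_compose[OF h] in \<open>auto simp: curves_iff\<close>)
  ultimately show ?thesis using \<gamma> by (simp add: curves_iff)
qed

lemma len_isometry:
  assumes h: "isometry A g h"
  shows "len (h \<circ> \<gamma>) a b = len \<gamma> a b"
  unfolding len_def
proof (rule nn_integral_cong)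
  fix t
  have "(inv h \<circ> (h \<circ> \<gamma>)) = \<gamma>"
    using bij_is_inj[OF isometryD(1)[OF h]] by (auto simp: fun_eq_iff)
  then have "regular (h \<circ> \<gamma>) t \<longleftrightarrow> regular \<gamma> t"
    using regular_compose[OF isometryD(2)[OF h]] regular_compose[OF isometryD(3)[OF h]] by metis
  then show "ennreal (speed A g (h \<circ> \<gamma>) t) * indicator ({a<..<b} \<inter> {t. regular (h \<circ> \<gamma>) t}) t
      = ennreal (speed A g \<gamma> t) * indicator ({a<..<b} \<inter> {t. regular \<gamma> t}) t"
    using speed_isometry[OF h, of \<gamma> t] by (auto simp: indicator_def)
qed

lemma ext_dist_isometry:
  assumes h: "isometry A g h"
  shows "ext_dist (h p) (h q) = ext_dist p q"
proof (rule antisym)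
  show "ext_dist (h p) (h q) \<le> ext_dist p q"
    unfolding ext_dist_def[of p q]
  proof (rule INF_greatest)
    fix \<gamma> assume "\<gamma> \<in> curves p q"
    from ext_dist_le_len[OF smooth_map_curve[OF isometryD(2)[OF h] this]]
    show "ext_dist (h p) (h q) \<le> len \<gamma> 0 1" by (simp add: len_isometry[OF h])
  qed
  have inv: "inv h (h x) = x" "h (inv h x) = x" for x
    using isometryD(1)[OF h] by (auto simp: bij_is_inj bij_is_surj surj_f_inv_f)
  show "ext_dist p q \<le> ext_dist (h p) (h q)"
    unfolding ext_dist_def[of "h p" "h q"]
  proof (rule INF_greatest)
    fix \<gamma> assume "\<gamma> \<in> curves (h p) (h q)"
    from ext_dist_le_len[OF smooth_map_curve[OF isometryD(3)[OF h] this]]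
    have "ext_dist p q \<le> len (inv h \<circ> \<gamma>) 0 1" by (simp add: inv)
    also have "\<dots> = len (h \<circ> (inv h \<circ> \<gamma>)) 0 1" by (rule len_isometry[OF h, symmetric])
    also have "h \<circ> (inv h \<circ> \<gamma>) = \<gamma>" by (simp add: fun_eq_iff inv)
    finally show "ext_dist p q \<le> len \<gamma> 0 1" .
  qed
qed

subsection \<open>Comparison with the Euclidean distance in a chart\<close>

text \<open>By compactness of the product of a coordinate ball and the unit sphere, the norms given by the metric
  are uniformly equivalent to the Euclidean norm.\<close>

lemma metric_bounds:
  assumes c: "c \<in> A" and x0: "x0 \<in> cmap c ` cdom c"
  shows "\<exists>r>0. \<exists>k>0. \<exists>K>0. cball x0 r \<subseteq> cmap c ` cdom c \<and>
           (\<forall>x\<in>cball x0 r. \<forall>v. k * norm v \<le> sqrt (g c (cinv c x) v v) \<and> sqrt (g c (cinv c x) v v) \<le> K * norm v)"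
proof -
  obtain r where r: "r > 0" "cball x0 r \<subseteq> cmap c ` cdom c"
    using chart_image_open[OF c] x0 open_contains_cball_eq by metis
  let ?X = "cball x0 r \<times> sphere (0 :: (real, 'n) vec) 1"
  let ?f = "\<lambda>p. sqrt (g c (cinv c (fst p)) (snd p) (snd p))"
  have X: "compact ?X" by (intro compact_Times compact_cball compact_sphere)
  obtain b :: "(real, 'n) vec" where "b \<in> Basis" using nonempty_Basis by blast
  then have ne: "?X \<noteq> {}" using r(1) by (auto intro!: exI[of _ x0] exI[of _ b])
  have f: "continuous_on ?X ?f"
  proof (rule continuous_on_real_sqrt, rule metric_continuous[OF c])
    show "continuous_on ?X (\<lambda>p. fst p)" "continuous_on ?X (\<lambda>p. snd p)" "continuous_on ?X (\<lambda>p. snd p)"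
      by (intro continuous_on_fst continuous_on_snd continuous_on_id)+
    show "(\<lambda>p. fst p) ` ?X \<subseteq> cmap c ` cdom c" using r(2) by auto
  qed
  obtain p where p: "p \<in> ?X" "\<And>q. q \<in> ?X \<Longrightarrow> ?f p \<le> ?f q"
    using continuous_attains_inf[OF X ne f] by blast
  obtain q where q: "q \<in> ?X" "\<And>p. p \<in> ?X \<Longrightarrow> ?f p \<le> ?f q"
    using continuous_attains_sup[OF X ne f] by blast
  have pos: "0 < ?f p"
  proof -
    have "fst p \<in> cmap c ` cdom c" "snd p \<noteq> 0" using p(1) r(2) by auto
    then show ?thesis using metric_pos[OF c cinv_mem[OF c]] by simp
  qed
  have "?f p * norm v \<le> sqrt (g c (cinv c x) v v) \<and> sqrt (g c (cinv c x) v v) \<le> ?f q * norm v"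
    if x: "x \<in> cball x0 r" for x v
  proof (cases "v = 0")
    case True
    then show ?thesis using bilinear_lzero[OF metric_bilinear[OF c cinv_mem[OF c]]] x r(2) by auto
  next
    case False
    define w where "w = (1 / norm v) *\<^sub>R v"
    have w: "(x, w) \<in> ?X" using x False by (simp add: w_def)
    have v: "v = norm v *\<^sub>R w" using False by (simp add: w_def)
    have b: "bilinear (g c (cinv c x))" using x r(2) by (intro metric_bilinear[OF c cinv_mem[OF c]]) auto
    have "g c (cinv c x) v v = (norm v)\<^sup>2 * g c (cinv c x) w w"
      by (subst v, subst (2) v) (simp only: bilinear_lmul[OF b] bilinear_rmul[OF b] real_scaleR_def power2_eq_square mult.assoc)
    then have eq: "sqrt (g c (cinv c x) v v) = ?f (x, w) * norm v" by (simp add: real_sqrt_mult)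
    show ?thesis
      unfolding eq using mult_right_mono[OF p(2)[OF w] norm_ge_zero[of v]]
        mult_right_mono[OF q(2)[OF w] norm_ge_zero[of v]] by (intro conjI)
  qed
  moreover have "0 < ?f q" using pos q(2)[OF p(1)] by simp
  ultimately show ?thesis using r pos by blast
qed

text \<open>The coordinate segment from \<open>x\<close> to \<open>y\<close> is a curve of at most this length.\<close>

lemma ext_dist_upper:
  assumes c: "c \<in> A" and r: "ball x0 r \<subseteq> cmap c ` cdom c" and K: "0 < K"
    and bd: "\<And>x v. x \<in> ball x0 r \<Longrightarrow> sqrt (g c (cinv c x) v v) \<le> K * norm v"
    and x: "x \<in> ball x0 r" and y: "y \<in> ball x0 r"
  shows "ext_dist (cinv c x) (cinv c y) \<le> ennreal (K * dist x y)"
proof -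
  define l where "l s = x + s *\<^sub>R (y - x)" for s
  define \<gamma> where "\<gamma> s = cinv c (l s)" for s
  have lball: "l s \<in> ball x0 r" if "s \<in> {0..1}" for s
  proof -
    have "l s = (1 - s) *\<^sub>R x + s *\<^sub>R y" by (simp add: l_def algebra_simps)
    then show ?thesis using convexD[OF convex_ball x y, of "1 - s" s] that by simp
  qed
  have limg: "l s \<in> cmap c ` cdom c" if "s \<in> {0..1}" for s using lball[OF that] r by blast
  have lder: "(l has_vector_derivative (y - x)) (at s)" for s
    unfolding l_def by (auto intro!: derivative_eq_intros)
  have lcont: "continuous_on S l" for S
    unfolding l_def by (intro continuous_on_add continuous_on_scaleR continuous_on_const continuous_on_id)
  have der: "((cmap c \<circ> \<gamma>) has_vector_derivative (y - x)) (at s)" if "s \<in> {0<..<1}" for s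
    by (rule has_vector_derivative_transform_within_open[OF lder open_greaterThanLessThan that])
       (use limg c in \<open>simp add: \<gamma>_def\<close>)
  have reg: "regular \<gamma> t" if t: "t \<in> {0<..<1}" for t
  proof -
    obtain e where e: "e > 0" "ball t e \<subseteq> {0<..<1}"
      using t open_contains_ball_eq[OF open_greaterThanLessThan] by blast
    have "(cmap c \<circ> \<gamma>) C1_differentiable_on ball t e"
      unfolding C1_differentiable_on_def using der e(2)
      by (intro exI[of _ "\<lambda>_. y - x"]) (auto intro: continuous_on_const)
    moreover have "\<forall>s\<in>ball t e. \<gamma> s \<in> cdom c"
    proof
      fix s assume "s \<in> ball t e"
      then have "s \<in> {0<..<1}" using e(2) by blast
      then show "\<gamma> s \<in> cdom c" unfolding \<gamma>_def by (intro cinv_mem[OF c limg]) auto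
    qed
    ultimately show ?thesis unfolding regular_def using c e(1) by blast
  qed
  have "\<gamma> \<in> curves (cinv c x) (cinv c y)"
  proof -
    have "continuous_on {0..1} \<gamma>"
      unfolding \<gamma>_def by (rule continuous_on_compose2[OF continuous_cinv[OF c] lcont]) (use limg in auto)
    moreover have "{t. \<not> regular \<gamma> t} \<inter> {0..1} \<subseteq> {0, 1}"
    proof
      fix t assume "t \<in> {t. \<not> regular \<gamma> t} \<inter> {0..1}"
      then have "0 \<le> t" "t \<le> 1" "\<not> (0 < t \<and> t < 1)" using reg[of t] by auto
      then show "t \<in> {0, 1}" by auto
    qed
    then have "finite ({t. \<not> regular \<gamma> t} \<inter> {0..1})" by (rule finite_subset) simp
    ultimately show ?thesis by (simp add: curves_iff \<gamma>_def l_def)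
  qed
  from ext_dist_le_len[OF this] have "ext_dist (cinv c x) (cinv c y) \<le> len \<gamma> 0 1" .
  also have "\<dots> \<le> (\<integral>\<^sup>+t. ennreal (K * dist x y) * indicator {0..1::real} t \<partial>lborel)"
    unfolding len_def
  proof (rule nn_integral_mono)
    fix t :: real
    show "ennreal (speed A g \<gamma> t) * indicator ({0<..<1} \<inter> {t. regular \<gamma> t}) t
        \<le> ennreal (K * dist x y) * indicator {0..1} t"
    proof (cases "t \<in> {0<..<1}")
      case True
      have "\<gamma> t \<in> cdom c" unfolding \<gamma>_def using True by (intro cinv_mem[OF c limg]) auto
      note sp = speed_in_chart[OF reg[OF True] c this]
      have \<gamma>t: "\<gamma> t = cinv c (l t)" by (simp add: \<gamma>_def)
      have "speed A g \<gamma> t = sqrt (g c (cinv c (l t)) (y - x) (y - x))"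
        using sp unfolding vector_derivative_at[OF der[OF True]] \<gamma>t .
      also have "\<dots> \<le> K * norm (y - x)" using True by (intro bd lball) auto
      finally show ?thesis using True by (auto simp: indicator_def dist_norm norm_minus_commute intro: ennreal_leI)
    qed (auto simp: indicator_def)
  qed
  also have "\<dots> = ennreal (K * dist x y)" by (simp add: nn_integral_cmult_indicator)
  finally show ?thesis .
qed


text \<open>Up to the first exit from the coordinate ball of radius \<open>\<rho>\<close> the coordinates of the curve
  move by \<open>\<rho>\<close>. Integrate the derivative in the direction of the exit point.\<close>

lemma ext_dist_lower:
  assumes c: "c \<in> A" and r: "cball x0 r \<subseteq> cmap c ` cdom c" and k: "0 < k"
    and bd: "\<And>x v. x \<in> cball x0 r \<Longrightarrow> k * norm v \<le> sqrt (g c (cinv c x) v v)"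
    and \<rho>: "0 < \<rho>" "\<rho> \<le> r" and q: "q \<notin> cinv c ` ball x0 \<rho>"
  shows "ennreal (k * \<rho>) \<le> ext_dist (cinv c x0) q"
  unfolding ext_dist_def
proof (rule INF_greatest)
  fix \<gamma> assume \<gamma>: "\<gamma> \<in> curves (cinv c x0) q"
  have \<gamma>c: "continuous_on {0..1} \<gamma>" and \<gamma>0: "\<gamma> 0 = cinv c x0" and \<gamma>1: "\<gamma> 1 = q"
    and fin: "finite ({t. \<not> regular \<gamma> t} \<inter> {0..1})" using \<gamma> by (auto simp: curves_iff)
  have cb: "cball x0 \<rho> \<subseteq> cmap c ` cdom c" using r \<rho> by (meson order_trans subset_cball)
  have bb: "ball x0 \<rho> \<subseteq> cmap c ` cdom c" using cb ball_subset_cball by blast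
  define V where "V = cinv c ` ball x0 \<rho>"
  have V: "open V" unfolding V_def by (rule cinv_image_open[OF c open_ball bb])
  define S where "S = {0..1} \<inter> \<gamma> -` (- V)"
  have "closed S" unfolding S_def by (rule continuous_closed_preimage[OF \<gamma>c]) (use V in auto)
  then have Sc: "compact S" unfolding S_def by (metis Int_absorb1 Int_lower1 compact_Icc compact_Int_closed)
  have "1 \<in> S" using q \<gamma>1 by (simp add: S_def V_def)
  then obtain u where u: "u \<in> S" "\<And>t. t \<in> S \<Longrightarrow> u \<le> t"
    using compact_attains_inf[OF Sc] by blast
  have \<gamma>0V: "\<gamma> 0 \<in> V" using \<gamma>0 \<rho> by (simp add: V_def)
  then have u01: "0 < u" "u \<le> 1"
    using u(1) by (auto simp: S_def less_le)
  have inV: "\<gamma> t \<in> V" if "0 \<le> t" "t < u" for t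
    using u(2)[of t] that u01 by (auto simp: S_def)
  have inK: "\<gamma> ` {0..u} \<subseteq> cinv c ` cball x0 \<rho>"
  proof -
    have "compact (cinv c ` cball x0 \<rho>)"
      by (rule compact_continuous_image[OF continuous_on_subset[OF continuous_cinv[OF c] cb] compact_cball])
    then have K: "closed (cinv c ` cball x0 \<rho>)" by (rule compact_imp_closed)
    have cl: "closure {0..<u} = {0..u}" using u01 by simp
    have "\<gamma> ` closure {0..<u} \<subseteq> cinv c ` cball x0 \<rho>"
    proof (rule image_closure_subset[OF _ K])
      show "continuous_on (closure {0..<u}) \<gamma>"
        unfolding cl by (rule continuous_on_subset[OF \<gamma>c]) (use u01 in auto)
      show "\<gamma> ` {0..<u} \<subseteq> cinv c ` cball x0 \<rho>"
      proof (rule image_subsetI)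
        fix t assume "t \<in> {0..<u}"
        then have "\<gamma> t \<in> V" by (intro inV) auto
        moreover have "V \<subseteq> cinv c ` cball x0 \<rho>"
          unfolding V_def by (rule image_mono[OF ball_subset_cball])
        ultimately show "\<gamma> t \<in> cinv c ` cball x0 \<rho>" by (rule rev_subsetD)
      qed
    qed
    then show ?thesis by (simp only: cl)
  qed
  have dom: "\<gamma> t \<in> cdom c" if "t \<in> {0..u}" for t
  proof -
    have "\<gamma> t \<in> cinv c ` cball x0 \<rho>" using inK that by (rule subsetD[OF _ imageI])
    then obtain y where "y \<in> cball x0 \<rho>" "\<gamma> t = cinv c y" by (rule imageE)
    then show ?thesis using cinv_mem[OF c subsetD[OF cb]] by simp
  qed
  define f where "f = cmap c \<circ> \<gamma>"
  have fc: "continuous_on {0..u} f"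
    unfolding f_def comp_def
    by (rule continuous_on_compose2[OF continuous_cmap[OF c] continuous_on_subset[OF \<gamma>c]])
       (use u01 dom in auto)
  have x0: "x0 \<in> cmap c ` cdom c" using cb \<rho> by auto
  have f0: "f 0 = x0" using x0 c by (simp add: f_def \<gamma>0)
  have fball: "f t \<in> ball x0 \<rho>" if t: "0 \<le> t" "t < u" for t
  proof -
    obtain y where y: "y \<in> ball x0 \<rho>" "\<gamma> t = cinv c y" using inV[OF t] unfolding V_def by blast
    then have "f t = y" using bb c by (auto simp: f_def)
    with y(1) show ?thesis by simp
  qed
  have fu: "norm (f u - x0) = \<rho>"
  proof -
    have "u \<in> {0..u}" using u01 by simp
    then obtain y where y: "y \<in> cball x0 \<rho>" "\<gamma> u = cinv c y" using inK by blast
    have "\<gamma> u \<notin> V" using u(1) by (simp add: S_def)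
    then have "y \<notin> ball x0 \<rho>" using y(2) by (auto simp: V_def)
    then have "dist x0 y = \<rho>" using y(1) by simp
    moreover have "f u = y" using y cb c by (auto simp: f_def)
    ultimately show ?thesis by (simp add: dist_norm norm_minus_commute)
  qed
  define w where "w = (1 / \<rho>) *\<^sub>R (f u - x0)"
  have w1: "norm w = 1" using fu \<rho> by (simp add: w_def)
  let ?v = "\<lambda>t. vector_derivative f (at t)"
  define X where "X = {0<..<u} \<inter> {t. regular \<gamma> t}"
  have Xo: "open X" unfolding X_def using open_regular by (intro open_Int) auto
  define H where "H t = indicator X t *\<^sub>R (w \<bullet> ?v t)" for t
  have vder: "(f has_vector_derivative ?v t) (at t)" if "t \<in> X" for t
    unfolding f_def by (rule regular_has_vector_derivative[OF _ c]) (use that dom in \<open>auto simp: X_def\<close>)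
  have "continuous_on X (\<lambda>t. w \<bullet> ?v t)"
  proof (intro continuous_on_inner continuous_on_const continuous_at_imp_continuous_on ballI)
    fix t assume t: "t \<in> X"
    then have "regular \<gamma> t" "\<gamma> t \<in> cdom c" using dom by (auto simp: X_def)
    then obtain e where e: "e > 0" "f C1_differentiable_on ball t e"
      using regular_in_chart[OF _ c] unfolding f_def by blast
    then show "isCont ?v t" by (simp add: C1_differentiable_on_eq continuous_on_eq_continuous_at)
  qed
  then have Hm: "H \<in> borel_measurable borel"
    unfolding H_def using Xo by (intro borel_measurable_continuous_on_indicator) auto
  have "((\<lambda>t. w \<bullet> f t) has_vector_derivative H t) (at t)" if t: "t \<in> {0<..<u} - ({t. \<not> regular \<gamma> t} \<inter> {0..1})" for t
  proof -
    have X: "t \<in> X" using t u01 by (auto simp: X_def)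
    from bounded_linear.has_vector_derivative[OF bounded_linear_inner_right vder[OF X]]
    show ?thesis using X by (simp add: H_def)
  qed
  then have "(H has_integral (w \<bullet> f u - w \<bullet> f 0)) {0..u}"
    using u01 fin
    by (intro fundamental_theorem_of_calculus_interior_strong[of "{t. \<not> regular \<gamma> t} \<inter> {0..1}"]
        continuous_on_inner continuous_on_const fc) auto
  moreover have "w \<bullet> f u - w \<bullet> f 0 = \<rho>"
  proof -
    have "w \<bullet> f u - w \<bullet> f 0 = w \<bullet> (f u - x0)" by (simp only: f0 inner_diff_right)
    also have "\<dots> = (1 / \<rho>) * ((f u - x0) \<bullet> (f u - x0))" unfolding w_def by (rule inner_scaleR_left)
    also have "\<dots> = (1 / \<rho>) * \<rho>\<^sup>2" by (simp only: dot_square_norm fu)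
    also have "\<dots> = \<rho>" using \<rho> by (simp add: power2_eq_square)
    finally show ?thesis .
  qed
  ultimately have "(H has_integral \<rho>) {0..u}" by simp
  then have HI: "(H has_integral \<rho>) UNIV"
    by (rule has_integral_on_superset) (auto simp: H_def X_def)
  have "ennreal \<rho> \<le> (\<integral>\<^sup>+t. ennreal (norm (H t)) \<partial>lborel)"
  proof (cases "(\<integral>\<^sup>+t. ennreal (norm (H t)) \<partial>lborel) < \<infinity>")
    case True
    then have I: "integrable lborel H" using Hm by (intro integrableI_bounded) auto
    from has_integral_unique[OF HI has_integral_integral_lborel[OF I]]
    have "\<rho> = integral\<^sup>L lborel H" .
    with integral_norm_bound_ennreal[OF I] \<rho> show ?thesis by simp
  next
    case False
    then have "(\<integral>\<^sup>+t. ennreal (norm (H t)) \<partial>lborel) = top"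
      using top.not_eq_extremum by (metis infinity_ennreal_def)
    then show ?thesis by (simp only: top_greatest)
  qed
  also have "\<dots> \<le> (\<integral>\<^sup>+t. ennreal (1 / k) * (ennreal (speed A g \<gamma> t) * indicator ({0<..<u} \<inter> {t. regular \<gamma> t}) t) \<partial>lborel)"
  proof (rule nn_integral_mono)
    fix t
    show "ennreal (norm (H t)) \<le> ennreal (1 / k) * (ennreal (speed A g \<gamma> t) * indicator ({0<..<u} \<inter> {t. regular \<gamma> t}) t)"
    proof (cases "t \<in> X")
      case True
      then have tu: "0 \<le> t" "t < u" "regular \<gamma> t" by (auto simp: X_def)
      have t: "regular \<gamma> t" "\<gamma> t \<in> cdom c" "f t \<in> ball x0 \<rho>"
        using tu dom[of t] fball[OF tu(1,2)] by simp_all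
      have "norm (H t) \<le> norm (?v t)"
        using Cauchy_Schwarz_ineq2[of w "?v t"] w1 True by (simp add: H_def)
      moreover have "k * norm (?v t) \<le> sqrt (g c (cinv c (f t)) (?v t) (?v t))"
        by (rule bd) (use t(3) \<rho> in auto)
      then have "norm (?v t) \<le> 1 / k * speed A g \<gamma> t"
        using speed_in_chart[OF t(1) c t(2)] k c t(2) by (simp add: f_def field_simps)
      ultimately have "ennreal (norm (H t)) \<le> ennreal (1 / k * speed A g \<gamma> t)"
        by (intro ennreal_leI) linarith
      also have "ennreal (1 / k * speed A g \<gamma> t) = ennreal (1 / k) * ennreal (speed A g \<gamma> t)"
        by (rule ennreal_mult) (use k speed_nonneg in simp_all)
      finally show ?thesis using True by (simp add: X_def)
    qed (simp add: H_def)
  qed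
  also have "\<dots> = ennreal (1 / k) * len \<gamma> 0 u"
    unfolding len_def
    by (rule nn_integral_cmult, unfold measurable_lborel2, rule speed_measurable) simp
  finally have "ennreal k * ennreal \<rho> \<le> ennreal k * (ennreal (1 / k) * len \<gamma> 0 u)"
    by (rule mult_left_mono) simp
  also have "\<dots> = len \<gamma> 0 u"
    using k by (simp add: mult.assoc[symmetric] ennreal_mult[symmetric])
  also have "\<dots> \<le> len \<gamma> 0 1" using len_add[of 0 u 1 \<gamma>] u01 by simp
  finally show "ennreal (k * \<rho>) \<le> len \<gamma> 0 1" using k \<rho> by (simp add: ennreal_mult)
qed

lemma ext_dist_pos:
  assumes "p \<noteq> q"
  shows "0 < ext_dist p q"
proof -
  obtain c where c: "c \<in> A" "p \<in> cdom c" using exists_chart by blast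
  define x0 where "x0 = cmap c p"
  have x0: "x0 \<in> cmap c ` cdom c" "cinv c x0 = p" using c by (auto simp: x0_def)
  obtain r k where r: "r > 0" "k > 0" "cball x0 r \<subseteq> cmap c ` cdom c"
    and bd: "\<And>x v. x \<in> cball x0 r \<Longrightarrow> k * norm v \<le> sqrt (g c (cinv c x) v v)"
    using metric_bounds[OF c(1) x0(1)] by blast
  have "\<exists>\<rho>>0. \<rho> \<le> r \<and> q \<notin> cinv c ` ball x0 \<rho>"
  proof (cases "q \<in> cinv c ` ball x0 r")
    case True
    then obtain y where y: "y \<in> ball x0 r" "q = cinv c y" by blast
    have yi: "y \<in> cmap c ` cdom c" using y(1) r(3) by auto
    have "y \<noteq> x0" using assms y(2) x0(2) by auto
    moreover have "q \<notin> cinv c ` ball x0 (dist x0 y)"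
    proof
      assume "q \<in> cinv c ` ball x0 (dist x0 y)"
      then obtain y' where y': "y' \<in> ball x0 (dist x0 y)" "cinv c y = cinv c y'" using y(2) by auto
      have "y' \<in> cmap c ` cdom c" using y' y(1) r(3) by (auto simp: subset_eq)
      then have "y = y'" using y'(2) yi cmap_cinv[OF c(1)] by metis
      then show False using y'(1) by simp
    qed
    ultimately show ?thesis using y(1) by (intro exI[of _ "dist x0 y"]) auto
  qed (use r in auto)
  then obtain \<rho> where \<rho>: "\<rho> > 0" "\<rho> \<le> r" "q \<notin> cinv c ` ball x0 \<rho>" by blast
  have "0 < ennreal (k * \<rho>)" using r \<rho> by simp
  also have "\<dots> \<le> ext_dist p q" using ext_dist_lower[OF c(1) r(3,2) bd \<rho>] x0(2) by simp
  finally show ?thesis .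
qed

lemma ext_dist_locally_small:
  assumes e: "e > 0"
  shows "\<exists>U. open U \<and> p \<in> U \<and> (\<forall>q\<in>U. ext_dist p q < ennreal e)"
proof -
  obtain c where c: "c \<in> A" "p \<in> cdom c" using exists_chart by blast
  define x0 where "x0 = cmap c p"
  have x0: "x0 \<in> cmap c ` cdom c" "cinv c x0 = p" using c by (auto simp: x0_def)
  obtain r K where r: "r > 0" "K > 0" "cball x0 r \<subseteq> cmap c ` cdom c"
    and bd: "\<And>x v. x \<in> cball x0 r \<Longrightarrow> sqrt (g c (cinv c x) v v) \<le> K * norm v"
    using metric_bounds[OF c(1) x0(1)] by blast
  define s where "s = min r (e / K)"
  have s: "s > 0" "s \<le> r" "s \<le> e / K" using r e by (auto simp: s_def)
  have sub: "ball x0 s \<subseteq> cmap c ` cdom c" using r(3) s(2) by (auto simp: subset_eq)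
  have "ext_dist p q < ennreal e" if q: "q \<in> cinv c ` ball x0 s" for q
  proof -
    obtain y where y: "y \<in> ball x0 s" "q = cinv c y" using q by blast
    have "ext_dist (cinv c x0) (cinv c y) \<le> ennreal (K * dist x0 y)"
      by (rule ext_dist_upper[OF c(1) sub r(2)]) (use bd s y in auto)
    also have "K * dist x0 y < e"
    proof -
      have "dist x0 y < e / K" using y(1) s(3) by simp
      then show ?thesis using r(2) by (simp add: field_simps)
    qed
    then have "ennreal (K * dist x0 y) < ennreal e" using e r(2) by (intro ennreal_lessI) auto
    finally show ?thesis using y x0 by simp
  qed
  moreover have "open (cinv c ` ball x0 s)" by (rule cinv_image_open[OF c(1) open_ball sub])
  moreover have "p \<in> cinv c ` ball x0 s" using s(1) x0(2) by (intro image_eqI[of _ _ x0]) auto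
  ultimately show ?thesis by blast
qed

text \<open>Points at finite distance from \<open>p\<close> form a set that is open and closed.\<close>

lemma ext_dist_finite:
  assumes "connected (UNIV :: 'a set)"
  shows "ext_dist p q < \<infinity>"
proof -
  let ?C = "{q. ext_dist p q < \<infinity>}"
  have nb: "\<exists>U. open U \<and> x \<in> U \<and> (\<forall>y\<in>U. ext_dist x y < \<infinity>)" for x
  proof -
    obtain U where U: "open U" "x \<in> U" "\<forall>y\<in>U. ext_dist x y < ennreal 1"
      using ext_dist_locally_small[OF zero_less_one, of x] by blast
    have "\<forall>y\<in>U. ext_dist x y < \<infinity>"
    proof
      fix y assume "y \<in> U"
      with U(3) have "ext_dist x y < ennreal 1" by (rule bspec)
      also have "\<dots> < \<infinity>" by simp
      finally show "ext_dist x y < \<infinity>" .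
    qed
    with U(1,2) show ?thesis by (intro exI conjI)
  qed
  have "open ?C"
  proof (rule open_subopen[THEN iffD2], rule ballI)
    fix x assume x: "x \<in> ?C"
    from nb[of x] obtain U where "open U \<and> x \<in> U \<and> (\<forall>y\<in>U. ext_dist x y < \<infinity>)" by (rule exE)
    then have U: "open U" "x \<in> U" "\<And>y. y \<in> U \<Longrightarrow> ext_dist x y < \<infinity>" by simp_all
    have "U \<subseteq> ?C"
    proof
      fix y assume "y \<in> U"
      have "ext_dist p y \<le> ext_dist p x + ext_dist x y" by (rule ext_dist_triangle)
      also have "\<dots> < \<infinity>" using x U(3)[OF \<open>y \<in> U\<close>] by simp
      finally show "y \<in> ?C" by simp
    qed
    with U show "\<exists>T. open T \<and> x \<in> T \<and> T \<subseteq> ?C" by blast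
  qed
  moreover have "open (- ?C)"
  proof (rule open_subopen[THEN iffD2], rule ballI)
    fix x assume x: "x \<in> - ?C"
    from nb[of x] obtain U where "open U \<and> x \<in> U \<and> (\<forall>y\<in>U. ext_dist x y < \<infinity>)" by (rule exE)
    then have U: "open U" "x \<in> U" "\<And>y. y \<in> U \<Longrightarrow> ext_dist x y < \<infinity>" by simp_all
    have "U \<subseteq> - ?C"
    proof
      fix y assume "y \<in> U"
      have "ext_dist p x \<le> ext_dist p y + ext_dist y x" by (rule ext_dist_triangle)
      moreover have "ext_dist y x < \<infinity>" using U(3)[OF \<open>y \<in> U\<close>] by (simp add: ext_dist_commute)
      ultimately show "y \<in> - ?C" using x by (auto simp: less_top[symmetric] top_unique)
    qed
    with U show "\<exists>T. open T \<and> x \<in> T \<and> T \<subseteq> - ?C" by blast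
  qed
  moreover have "\<forall>T :: 'a set. open T \<and> open (- T) \<longrightarrow> T = {} \<or> T = UNIV"
    using assms connected_clopen[of "UNIV :: 'a set"] by (simp add: closed_def)
  ultimately have "?C = {} \<or> ?C = UNIV" by blast
  moreover have "p \<in> ?C" by simp
  ultimately have "q \<in> ?C" by blast
  then show ?thesis by simp
qed

end

locale compact_riemannian_manifold = riemannian_manifold A g
  for A :: "('a::{t2_space,second_countable_topology}, 'n::{finite,wellorder}) chart set"
    and g :: "('a, 'n) metric_tensor" +
  assumes connected_UNIV: "connected (UNIV :: 'a set)" and compact_UNIV: "compact (UNIV :: 'a set)"
begin

abbreviation d :: "'a \<Rightarrow> 'a \<Rightarrow> real" where
  "d \<equiv> riem_dist A g"

lemma ennreal_d: "ennreal (d p q) = ext_dist p q"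
  using ext_dist_finite[OF connected_UNIV, of p q] by (simp add: riem_dist_eq less_top)

lemma d_nonneg: "0 \<le> d p q"
  by (simp add: riem_dist_eq)

lemma d_commute: "d p q = d q p"
  by (simp add: riem_dist_eq ext_dist_commute)

lemma d_le_iff: "0 \<le> L \<Longrightarrow> d p q \<le> L \<longleftrightarrow> ext_dist p q \<le> ennreal L"
  by (simp add: ennreal_d[symmetric] ennreal_le_iff)

lemma d_triangle: "d p r \<le> d p q + d q r"
proof -
  have "ennreal (d p r) \<le> ennreal (d p q + d q r)"
    unfolding ennreal_plus[OF d_nonneg d_nonneg] ennreal_d by (rule ext_dist_triangle)
  then show ?thesis by (rule ennreal_le_iff[THEN iffD1, rotated]) (simp add: d_nonneg)
qed

lemma d_eq_0: "d p q = 0 \<longleftrightarrow> p = q"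
proof
  assume "d p q = 0"
  then have "ext_dist p q = 0" using ennreal_d[of p q] by simp
  then show "p = q" using ext_dist_pos[of p q] by auto
qed (simp add: riem_dist_eq)

lemma d_isometry: "isometry A g h \<Longrightarrow> d (h p) (h q) = d p q"
  by (simp add: riem_dist_eq ext_dist_isometry)

lemma d_locally_small:
  assumes "e > 0"
  shows "\<exists>U. open U \<and> p \<in> U \<and> (\<forall>q\<in>U. d p q < e)"
proof -
  obtain U where U: "open U" "p \<in> U" "\<And>q. q \<in> U \<Longrightarrow> ext_dist p q < ennreal e"
    using ext_dist_locally_small[OF assms, of p] by blast
  have "d p q < e" if "q \<in> U" for q
    using U(3)[OF that] by (simp add: ennreal_d[symmetric] ennreal_less_iff d_nonneg)
  with U show ?thesis by blast
qed

lemma d_continuous: "continuous_on UNIV (\<lambda>p. d (fst p) (snd p))"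
  unfolding continuous_on_eq_continuous_at[OF open_UNIV]
proof (rule ballI, unfold isCont_def tendsto_iff, intro allI impI)
  fix p :: "'a \<times> 'a" and e :: real assume e: "e > 0"
  then have e2: "e / 2 > 0" by simp
  from d_locally_small[OF e2, of "fst p"]
  obtain U where "open U \<and> fst p \<in> U \<and> (\<forall>q\<in>U. d (fst p) q < e / 2)" by (rule exE)
  then have U: "open U" "fst p \<in> U" "\<And>q. q \<in> U \<Longrightarrow> d (fst p) q < e / 2" by simp_all
  from d_locally_small[OF e2, of "snd p"]
  obtain V where "open V \<and> snd p \<in> V \<and> (\<forall>q\<in>V. d (snd p) q < e / 2)" by (rule exE)
  then have V: "open V" "snd p \<in> V" "\<And>q. q \<in> V \<Longrightarrow> d (snd p) q < e / 2" by simp_all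
  have "dist (d (fst q) (snd q)) (d (fst p) (snd p)) < e" if "q \<in> U \<times> V" for q
  proof -
    have "d (fst p) (fst q) < e / 2" "d (snd p) (snd q) < e / 2" using U(3) V(3) that by auto
    moreover have "d (fst q) (snd q) \<le> d (fst q) (fst p) + (d (fst p) (snd p) + d (snd p) (snd q))"
      using d_triangle[of "fst q" "snd q" "fst p"] d_triangle[of "fst p" "snd q" "snd p"] by linarith
    moreover have "d (fst p) (snd p) \<le> d (fst p) (fst q) + (d (fst q) (snd q) + d (snd q) (snd p))"
      using d_triangle[of "fst p" "snd p" "fst q"] d_triangle[of "fst q" "snd p" "snd q"] by linarith
    ultimately show ?thesis
      using d_commute[of "fst p" "fst q"] d_commute[of "snd p" "snd q"] unfolding dist_real_def by linarith
  qed
  moreover have "open (U \<times> V)" "p \<in> U \<times> V" using U V by (auto simp: open_Times mem_Times_iff)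
  ultimately show "\<forall>\<^sub>F q in at p. dist (d (fst q) (snd q)) (d (fst p) (snd p)) < e"
    unfolding eventually_at_topological by blast
qed

lemma continuous_d_left: "continuous_on S (\<lambda>x. d p x)" and continuous_d_right: "continuous_on S (\<lambda>x. d x q)"
proof -
  have "continuous_on S (\<lambda>x. (p, x))" "continuous_on S (\<lambda>x. (x, q))"
    by (intro continuous_on_Pair continuous_on_const continuous_on_id)+
  from this[THEN continuous_on_compose2[OF d_continuous]]
  show "continuous_on S (\<lambda>x. d p x)" "continuous_on S (\<lambda>x. d x q)" by simp_all
qed

subsection \<open>Minimizing geodesics\<close>

lemma d_le_len: "\<gamma> \<in> curves p q \<Longrightarrow> 0 \<le> a \<Longrightarrow> a \<le> b \<Longrightarrow> b \<le> 1 \<Longrightarrow> ennreal (d (\<gamma> a) (\<gamma> b)) \<le> len \<gamma> a b"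
  unfolding ennreal_d by (rule ext_dist_le_part)

text \<open>A point of the sphere of radius \<open>s\<close> around \<open>p\<close> that is closest to \<open>q\<close> lies between \<open>p\<close> and
  \<open>q\<close>, since nearly shortest curves pass through this sphere.\<close>

lemma exists_between:
  assumes s: "0 \<le> s" "s \<le> d p q"
  shows "\<exists>x. d p x = s \<and> d x q = d p q - s"
proof -
  have meet: "\<exists>t\<in>{0..1}. d p (\<gamma> t) = s" if "\<gamma> \<in> curves p q" for \<gamma>
  proof -
    have \<gamma>: "continuous_on {0..1} \<gamma>" "\<gamma> 0 = p" "\<gamma> 1 = q" using that by (auto simp: curves_iff)
    have "continuous_on {0..1} (\<lambda>t. d p (\<gamma> t))"
      by (rule continuous_on_compose2[OF continuous_d_left[of UNIV] \<gamma>(1)]) simp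
    moreover have "d p (\<gamma> 0) \<le> s" "s \<le> d p (\<gamma> 1)" using s \<gamma> d_eq_0[of p p] by auto
    ultimately show ?thesis using IVT'[of "\<lambda>t. d p (\<gamma> t)" 0 s 1] by auto
  qed
  have curve: "\<exists>\<gamma>\<in>curves p q. len \<gamma> 0 1 < ennreal (d p q + e)" if "e > 0" for e
    using that exists_curve_less[of p q "ennreal (d p q + e)"]
    by (simp add: ennreal_d[symmetric] ennreal_less_iff d_nonneg)
  have near: "\<exists>x. d p x = s \<and> d x q < d p q - s + e" if e: "e > 0" for e
  proof -
    obtain \<gamma> where \<gamma>: "\<gamma> \<in> curves p q" "len \<gamma> 0 1 < ennreal (d p q + e)" using curve[OF e] by blast
    obtain t where t: "t \<in> {0..1}" "d p (\<gamma> t) = s" using meet[OF \<gamma>(1)] by blast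
    have ends: "\<gamma> 0 = p" "\<gamma> 1 = q" using \<gamma>(1) by (auto simp: curves_iff)
    have "ennreal (s + d (\<gamma> t) q) = ennreal (d (\<gamma> 0) (\<gamma> t)) + ennreal (d (\<gamma> t) (\<gamma> 1))"
      using t(2) ends s(1) by (simp add: d_nonneg ennreal_plus)
    also have "\<dots> \<le> len \<gamma> 0 t + len \<gamma> t 1"
      using t(1) by (intro add_mono d_le_len[OF \<gamma>(1)]) auto
    also have "\<dots> = len \<gamma> 0 1" using t(1) by (intro len_add[symmetric]) auto
    also note \<gamma>(2)
    finally have "s + d (\<gamma> t) q < d p q + e"
      using s(1) by (subst (asm) ennreal_less_iff) (auto simp: d_nonneg)
    with t(2) show ?thesis by (intro exI[of _ "\<gamma> t"]) auto
  qed
  have closed: "closed {x. d p x = s}"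
    using closed_Collect_eq[OF continuous_d_left[of UNIV p] continuous_on_const, of s] by simp
  have L: "compact {x. d p x = s}" using compact_Int_closed[OF compact_UNIV closed] by simp
  have "{x. d p x = s} \<noteq> {}" using near[of 1] by auto
  then obtain x where x: "d p x = s" "\<And>y. d p y = s \<Longrightarrow> d x q \<le> d y q"
    using continuous_attains_inf[OF L _ continuous_d_right[of _ q]] by blast
  have "d x q \<le> d p q - s"
  proof (rule ccontr)
    assume "\<not> ?thesis"
    then have "0 < d x q - (d p q - s)" by simp
    from near[OF this] x(2) show False by fastforce
  qed
  moreover have "d p q - s \<le> d x q" using d_triangle[of p q x] x(1) by simp
  ultimately show ?thesis using x(1) by (intro exI[of _ x]) auto
qed

text \<open>Add the parameters in increasing order, each time with a point between the last point and
  \<open>q\<close>.\<close>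

lemma finite_geodesic:
  assumes "finite S" "S \<subseteq> {0..d p q}"
  shows "\<exists>P. (\<forall>s\<in>S. d p (P s) = s \<and> d (P s) q = d p q - s) \<and> (\<forall>s\<in>S. \<forall>t\<in>S. d (P s) (P t) = \<bar>s - t\<bar>)"
  using assms
proof (induction S rule: finite_linorder_max_induct)
  case empty
  then show ?case by simp
next
  case (insert b S)
  have "S \<subseteq> {0..d p q}" using insert.prems by simp
  from insert.IH[OF this] obtain P where P': "(\<forall>s\<in>S. d p (P s) = s \<and> d (P s) q = d p q - s) \<and>
      (\<forall>s\<in>S. \<forall>t\<in>S. d (P s) (P t) = \<bar>s - t\<bar>)" by (rule exE)
  then have P: "\<And>s. s \<in> S \<Longrightarrow> d p (P s) = s \<and> d (P s) q = d p q - s"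
    "\<And>s t. s \<in> S \<Longrightarrow> t \<in> S \<Longrightarrow> d (P s) (P t) = \<bar>s - t\<bar>" by simp_all
  have b: "0 \<le> b" "b \<le> d p q" using insert.prems by auto
  define a where "a = (if S = {} then 0 else Max S)"
  define y where "y = (if S = {} then p else P a)"
  have aS: "S \<noteq> {} \<Longrightarrow> a \<in> S" using insert.hyps(1) by (simp add: a_def)
  have sa: "s \<le> a" if "s \<in> S" for s using that insert.hyps(1) by (auto simp: a_def)
  have ab: "a \<le> b" using insert.hyps(2) aS b(1) by (cases "S = {}") (auto simp: a_def less_imp_le)
  have y: "d p y = a" "d y q = d p q - a"
    using P(1) aS d_eq_0[of p p] by (auto simp: y_def a_def)
  obtain x where x: "d y x = b - a" "d x q = d y q - (b - a)"
    using exists_between[of "b - a" y q] ab y b by auto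
  have xq: "d x q = d p q - b" using x(2) y(2) by simp
  have px: "d p x = b" using d_triangle[of p x y] d_triangle[of p q x] x(1) y(1) xq by linarith
  have sx: "d (P s) x = b - s" if s: "s \<in> S" for s
  proof -
    have "d (P s) y = a - s"
      using P(2)[OF s aS] s sa[OF s] by (auto simp: y_def)
    then show ?thesis
      using d_triangle[of "P s" x y] d_triangle[of "P s" q x] x(1) xq P(1)[OF s] by linarith
  qed
  let ?P = "P(b := x)"
  have bS: "b \<notin> S" using insert.hyps(2) by auto
  have "\<forall>s\<in>insert b S. d p (?P s) = s \<and> d (?P s) q = d p q - s"
    using P(1) px xq bS by auto
  moreover have "\<forall>s\<in>insert b S. \<forall>t\<in>insert b S. d (?P s) (?P t) = \<bar>s - t\<bar>"
  proof (intro ballI)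
    fix s t assume st: "s \<in> insert b S" "t \<in> insert b S"
    have lb: "s < b" if "s \<in> S" for s using insert.hyps(2) that by blast
    consider "s \<in> S" "t \<in> S" | "s \<in> S" "t = b" | "s = b" "t \<in> S" | "s = b" "t = b" using st by blast
    then show "d (?P s) (?P t) = \<bar>s - t\<bar>"
    proof cases
      case 1 then show ?thesis using P(2) bS by auto
    next
      case 2 then show ?thesis using sx[of s] lb[of s] bS by auto
    next
      case 3 then show ?thesis using sx[of t] lb[of t] bS d_commute[of x "P t"] by auto
    next
      case 4 then show ?thesis using d_eq_0[of x x] by simp
    qed
  qed
  ultimately show ?case by (intro exI[of _ ?P] conjI)
qed

text \<open>The finite partial geodesics form a net in the space of all maps from the reals into the
  manifold, which is compact by Tychonoff's theorem. A cluster point of the net satisfies all the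
  conditions, as they are closed and each holds eventually along the net.\<close>

lemma exists_geodesic:
  "\<exists>\<gamma>. \<gamma> 0 = p \<and> \<gamma> (d p q) = q \<and> (\<forall>s\<in>{0..d p q}. \<forall>t\<in>{0..d p q}. d (\<gamma> s) (\<gamma> t) = \<bar>s - t\<bar>)"
proof -
  let ?I = "{0..d p q}"
  define good where "good S P \<longleftrightarrow> (\<forall>s\<in>S. d p (P s) = s \<and> d (P s) q = d p q - s) \<and>
      (\<forall>s\<in>S. \<forall>t\<in>S. d (P s) (P t) = \<bar>s - t\<bar>)" for S :: "real set" and P
  define P where "P S = (SOME P. good S P)" for S
  have good: "good S (P S)" if "finite S" "S \<subseteq> ?I" for S
  proof -
    have "\<exists>P. good S P" unfolding good_def by (rule finite_geodesic[OF that])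
    then show ?thesis unfolding P_def by (rule someI_ex)
  qed
  have P: "s \<in> S \<Longrightarrow> d p (P S s) = s \<and> d (P S s) q = d p q - s"
    "s \<in> S \<Longrightarrow> t \<in> S \<Longrightarrow> d (P S s) (P S t) = \<bar>s - t\<bar>" if "finite S" "S \<subseteq> ?I" for S s t
    using good[OF that] by (simp_all add: good_def)
  have comp: "compact (UNIV :: (real \<Rightarrow> 'a) set)"
  proof -
    have "compact_space (product_topology (\<lambda>i::real. euclidean :: 'a topology) UNIV)"
      unfolding compact_space_product_topology using compact_UNIV
      by (simp add: compact_space_def)
    then show ?thesis by (simp add: euclidean_product_topology compact_space_def)
  qed
  let ?F = "filtermap P (finite_subsets_at_top ?I)"
  have "?F \<noteq> bot" by (simp add: filtermap_bot_iff)
  from comp[unfolded compact_filter, rule_format, OF this]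
  have "\<exists>\<gamma>\<in>UNIV. inf (nhds \<gamma>) ?F \<noteq> bot" by simp
  then obtain \<gamma> where \<gamma>: "inf (nhds \<gamma>) ?F \<noteq> bot" by (rule bexE)
  have closed: "\<gamma> \<in> C" if C: "closed C" and ev: "eventually (\<lambda>S. P S \<in> C) (finite_subsets_at_top ?I)" for C
  proof (rule ccontr)
    assume "\<gamma> \<notin> C"
    then have 1: "eventually (\<lambda>f. f \<in> - C) (nhds \<gamma>)" using C by (intro eventually_nhds_in_open) auto
    have 2: "eventually (\<lambda>f. f \<in> C) ?F" using ev by (simp add: eventually_filtermap)
    have "eventually (\<lambda>f. False) (inf (nhds \<gamma>) ?F)"
      unfolding eventually_inf
      by (intro exI[of _ "\<lambda>f. f \<in> - C"] exI[of _ "\<lambda>f. f \<in> C"] conjI 1 2) simp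
    with \<gamma> show False by (simp add: trivial_limit_def)
  qed
  have cont: "continuous_on UNIV (\<lambda>f :: real \<Rightarrow> 'a. f s)" for s
    by (rule continuous_on_product_coordinates)
  have ev: "eventually (\<lambda>S. finite S \<and> S \<subseteq> ?I \<and> T \<subseteq> S) (finite_subsets_at_top ?I)" if "finite T" "T \<subseteq> ?I" for T
    using that by (auto simp: eventually_finite_subsets_at_top)
  have st: "d (\<gamma> s) (\<gamma> t) = \<bar>s - t\<bar>" if "s \<in> ?I" "t \<in> ?I" for s t
  proof -
    have "continuous_on UNIV (\<lambda>f. d (f s) (f t))"
      using continuous_on_compose2[OF d_continuous continuous_on_Pair[OF cont[of s] cont[of t]]] by simp
    then have "closed {f. d (f s) (f t) = \<bar>s - t\<bar>}" by (rule closed_Collect_eq) (rule continuous_on_const)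
    moreover have "eventually (\<lambda>S. P S \<in> {f. d (f s) (f t) = \<bar>s - t\<bar>}) (finite_subsets_at_top ?I)"
      by (rule eventually_mono[OF ev[of "{s, t}"]]) (use that P(2) in auto)
    ultimately show ?thesis using closed by blast
  qed
  have ps: "d p (\<gamma> 0) = 0"
  proof -
    have "continuous_on UNIV (\<lambda>f :: real \<Rightarrow> 'a. d p (f 0))"
      by (rule continuous_on_compose2[OF continuous_d_left[of UNIV] cont]) simp
    from closed_Collect_eq[OF this continuous_on_const]
    have "closed {f :: real \<Rightarrow> 'a. d p (f 0) = 0}" .
    moreover have "eventually (\<lambda>S. P S \<in> {f. d p (f 0) = 0}) (finite_subsets_at_top ?I)"
      by (rule eventually_mono[OF ev[of "{0}"]]) (use P(1) d_nonneg in auto)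
    ultimately show ?thesis using closed by blast
  qed
  have qs: "d (\<gamma> (d p q)) q = 0"
  proof -
    have "continuous_on UNIV (\<lambda>f :: real \<Rightarrow> 'a. d (f (d p q)) q)"
      by (rule continuous_on_compose2[OF continuous_d_right[of UNIV] cont]) simp
    from closed_Collect_eq[OF this continuous_on_const]
    have "closed {f :: real \<Rightarrow> 'a. d (f (d p q)) q = 0}" .
    moreover have "eventually (\<lambda>S. P S \<in> {f. d (f (d p q)) q = 0}) (finite_subsets_at_top ?I)"
      by (rule eventually_mono[OF ev[of "{d p q}"]]) (use P(1)[of _ "d p q"] d_nonneg in auto)
    ultimately show ?thesis using closed by blast
  qed
  show ?thesis using ps qs st by (intro exI[of _ \<gamma>]) (auto simp: d_eq_0)
qed

end

section \<open>The Riemannian measure\<close>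

lemma continuous_on_det:
  fixes M :: "'b::topological_space \<Rightarrow> real ^ 'n ^ 'n"
  assumes "\<And>i j. continuous_on S (\<lambda>x. M x $ i $ j)"
  shows "continuous_on S (\<lambda>x. det (M x))"
  unfolding det_def
  by (intro continuous_on_sum continuous_on_mult continuous_on_const continuous_on_prod assms)

text \<open>On the segment from the identity to a positive definite matrix the determinant has no zero.\<close>

lemma det_pos_if_positive_definite:
  fixes M :: "real ^ 'n ^ 'n"
  assumes pd: "\<And>v. v \<noteq> 0 \<Longrightarrow> 0 < v \<bullet> (M *v v)"
  shows "0 < det M"
proof (rule ccontr)
  assume neg: "\<not> 0 < det M"
  define P where "P t = (1 - t) *\<^sub>R mat 1 + t *\<^sub>R M" for t :: real
  have Pv: "P t *v v = (1 - t) *\<^sub>R v + t *\<^sub>R (M *v v)" for t v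
    unfolding P_def matrix_vector_mult_add_rdistrib scaleR_matrix_vector_assoc[symmetric] by simp
  have nz: "det (P t) \<noteq> 0" if t: "0 \<le> t" "t \<le> 1" for t
  proof -
    have "v = 0" if "P t *v v = 0" for v
    proof (rule ccontr)
      assume v: "v \<noteq> 0"
      have "0 < v \<bullet> v" "0 < v \<bullet> (M *v v)" using v pd by auto
      then have "0 < (1 - t) * (v \<bullet> v) + t * (v \<bullet> (M *v v))"
        using t by (cases "t = 0") (auto intro: add_nonneg_pos)
      also have "\<dots> = v \<bullet> (P t *v v)" by (simp add: Pv inner_add_right)
      finally show False using that by simp
    qed
    then have "\<exists>B. B ** P t = mat 1" unfolding matrix_left_invertible_ker by blast
    then show ?thesis by (simp add: invertible_det_nz[symmetric] invertible_left_inverse)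
  qed
  have "continuous_on {0..1} (\<lambda>t. det (P t))"
    unfolding P_def by (intro continuous_on_det) (simp, intro continuous_intros)
  moreover have "det (P 0) = 1" by (simp add: P_def)
  moreover have "det (P 1) \<le> 0" using neg by (simp add: P_def)
  ultimately obtain t where "0 \<le> t" "t \<le> 1" "det (P t) = 0"
    using IVT2'[of "\<lambda>t. det (P t)" 1 0 0] by auto
  with nz show False by blast
qed

text \<open>The bridge between absolute integrability, in which the change of variables formula is
  stated, and the integral of nonnegative functions.\<close>

lemma set_integrable_nonneg_iff:
  fixes f :: "'b::euclidean_space \<Rightarrow> real"
  assumes m: "(\<lambda>x. indicator S x * f x) \<in> borel_measurable borel" and f: "\<And>x. x \<in> S \<Longrightarrow> 0 \<le> f x"
  shows "f absolutely_integrable_on S \<longleftrightarrow> (\<integral>\<^sup>+x\<in>S. ennreal (f x) \<partial>lborel) < \<infinity>"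
    and "f absolutely_integrable_on S \<Longrightarrow> ennreal (integral S f) = (\<integral>\<^sup>+x\<in>S. ennreal (f x) \<partial>lborel)"
proof -
  let ?F = "\<lambda>x. indicator S x *\<^sub>R f x"
  have mL: "?F \<in> borel_measurable lebesgue" using m by (auto intro: measurable_completion)
  have F0: "0 \<le> ?F x" for x using f by (auto simp: indicator_def)
  have eq: "(\<integral>\<^sup>+x. ennreal (?F x) \<partial>lebesgue) = (\<integral>\<^sup>+x\<in>S. ennreal (f x) \<partial>lborel)"
    unfolding nn_integral_completion by (rule nn_integral_cong) (auto simp: indicator_def)
  show "f absolutely_integrable_on S \<longleftrightarrow> (\<integral>\<^sup>+x\<in>S. ennreal (f x) \<partial>lborel) < \<infinity>"
    unfolding set_integrable_def integrable_iff_bounded eq[symmetric] using mL F0 by simp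
  assume ai: "f absolutely_integrable_on S"
  have "integral S f = (LINT x:S|lebesgue. f x)"
    using set_lebesgue_integral_eq_integral(2)[OF ai] by simp
  then show "ennreal (integral S f) = (\<integral>\<^sup>+x\<in>S. ennreal (f x) \<partial>lborel)"
    unfolding eq[symmetric] set_lebesgue_integral_def
    using nn_integral_eq_integral[of lebesgue ?F] ai F0 by (simp add: set_integrable_def)
qed

lemma nn_integral_change_of_variables:
  fixes F :: "(real, 'n::{finite,wellorder}) vec \<Rightarrow> (real, 'n) vec" and f :: "(real, 'n) vec \<Rightarrow> real"
  assumes S: "S \<in> sets borel" and der: "\<And>x. x \<in> S \<Longrightarrow> (F has_derivative F' x) (at x within S)"
    and inj: "inj_on F S"
    and f0: "\<And>y. y \<in> F ` S \<Longrightarrow> 0 \<le> f y"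
    and mf: "(\<lambda>y. indicator (F ` S) y * f y) \<in> borel_measurable borel"
    and mg: "(\<lambda>x. indicator S x * (\<bar>det (matrix (F' x))\<bar> * f (F x))) \<in> borel_measurable borel"
  shows "(\<integral>\<^sup>+y\<in>F ` S. ennreal (f y) \<partial>lborel) = (\<integral>\<^sup>+x\<in>S. ennreal (\<bar>det (matrix (F' x))\<bar> * f (F x)) \<partial>lborel)"
proof -
  let ?g = "\<lambda>x. \<bar>det (matrix (F' x))\<bar> * f (F x)"
  have S': "S \<in> sets lebesgue" using S by simp
  have cov: "?g absolutely_integrable_on S \<and> integral S ?g = b \<longleftrightarrow>
      f absolutely_integrable_on (F ` S) \<and> integral (F ` S) f = b" for b
    using has_absolute_integral_change_of_variables[OF S' der inj, of "\<lambda>y. vec (f y) :: real ^ 1" "vec b"]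
    by (simp add: absolutely_integrable_on_1_iff integral_on_1_eq)
  have g0: "0 \<le> ?g x" if "x \<in> S" for x using f0[of "F x"] that by simp
  have fi: "f absolutely_integrable_on F ` S \<longleftrightarrow> (\<integral>\<^sup>+y\<in>F ` S. ennreal (f y) \<partial>lborel) < \<infinity>"
      "f absolutely_integrable_on F ` S \<Longrightarrow> ennreal (integral (F ` S) f) = (\<integral>\<^sup>+y\<in>F ` S. ennreal (f y) \<partial>lborel)"
    by (rule set_integrable_nonneg_iff[OF mf]; use f0 in simp)+
  have gi: "?g absolutely_integrable_on S \<longleftrightarrow> (\<integral>\<^sup>+x\<in>S. ennreal (?g x) \<partial>lborel) < \<infinity>"
      "?g absolutely_integrable_on S \<Longrightarrow> ennreal (integral S ?g) = (\<integral>\<^sup>+x\<in>S. ennreal (?g x) \<partial>lborel)"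
    by (rule set_integrable_nonneg_iff[OF mg]; use g0 in simp)+
  show ?thesis
  proof (cases "f absolutely_integrable_on (F ` S)")
    case True
    then have "?g absolutely_integrable_on S" "integral S ?g = integral (F ` S) f" using cov by auto
    with True fi(2) gi(2) show ?thesis by simp
  next
    case False
    then have "\<not> ?g absolutely_integrable_on S" using cov by blast
    with False fi(1) gi(1) show ?thesis by (simp add: less_top[symmetric])
  qed
qed

context riemannian_manifold
begin

subsection \<open>The volume density\<close>

lemma det_gram_pos:
  assumes "c \<in> A" "p \<in> cdom c"
  shows "0 < det (gram g c p)"
proof (rule det_pos_if_positive_definite)
  fix v :: "(real, 'n) vec" assume "v \<noteq> 0"
  have "v \<bullet> (gram g c p *v v) = g c p v v"
    unfolding gram_expand[OF assms, of v v] inner_vec_def matrix_vector_mult_def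
    by (simp add: sum_distrib_left mult.assoc mult.commute mult.left_commute)
  then show "0 < v \<bullet> (gram g c p *v v)" using metric_pos[OF assms \<open>v \<noteq> 0\<close>] by simp
qed

definition density :: "('a, 'n) chart \<Rightarrow> (real, 'n) vec \<Rightarrow> real" where
  "density c x = sqrt (det (gram g c (cinv c x)))"

lemma density_pos: "c \<in> A \<Longrightarrow> x \<in> cmap c ` cdom c \<Longrightarrow> 0 < density c x"
  using det_gram_pos[OF _ cinv_mem] by (simp add: density_def)

lemma density_continuous:
  assumes c: "c \<in> A"
  shows "continuous_on (cmap c ` cdom c) (density c)"
  unfolding density_def
proof (intro continuous_on_real_sqrt continuous_on_det)
  fix i j
  show "continuous_on (cmap c ` cdom c) (\<lambda>x. gram g c (cinv c x) $ i $ j)"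
    unfolding gram_def using smooth_on_continuous[OF metric_smooth[OF c]] by simp
qed

lemma borel_vimage_Int:
  fixes f :: "'x::topological_space \<Rightarrow> 'y::topological_space"
  assumes "continuous_on S f" "S \<in> sets borel" "B \<in> sets borel"
  shows "S \<inter> f -` B \<in> sets borel"
  using measurable_sets[OF borel_measurable_continuous_on_restrict[OF assms(1)] assms(3)] assms(2)
  by (simp add: sets_restrict_space_iff space_restrict_space Int_commute)

lemma cmap_image_borel:
  assumes c: "c \<in> A" and B: "B \<in> sets borel" "B \<subseteq> cdom c"
  shows "cmap c ` B \<in> sets borel"
  unfolding cmap_image_eq[OF c B(2)]
  using borel_vimage_Int[OF continuous_cinv[OF c] _ B(1)] chart_image_open[OF c] by simp

lemma density_measurable:
  assumes c: "c \<in> A" and S: "S \<in> sets borel" "S \<subseteq> cmap c ` cdom c"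
  shows "(\<lambda>x. indicator S x * density c x) \<in> borel_measurable borel"
  using borel_measurable_continuous_on_indicator[OF S(1) continuous_on_subset[OF density_continuous[OF c] S(2)]]
  by simp

text \<open>The right hand side of the condition that defines the Riemannian measure.\<close>

definition chart_volume :: "('a, 'n) chart \<Rightarrow> 'a set \<Rightarrow> ennreal" where
  "chart_volume c B = (\<integral>\<^sup>+x\<in>cmap c ` B. ennreal (density c x) \<partial>lborel)"

lemma gram_transform:
  assumes h: "isometry A g h" and c: "c \<in> A" "c' \<in> A" and p: "p \<in> cdom c" "h p \<in> cdom c'"
  defines "M \<equiv> matrix (coord_deriv c c' h p)"
  shows "gram g c p = transpose M ** gram g c' (h p) ** M"
proof -
  let ?L = "coord_deriv c c' h p"
  have "gram g c p $ i $ j = (transpose M ** gram g c' (h p) ** M) $ i $ j" for i j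
  proof -
    have "gram g c p $ i $ j = g c' (h p) (?L (axis i 1)) (?L (axis j 1))"
      using isometryD(4)[OF h c p] by (simp add: gram_def)
    also have "\<dots> = (\<Sum>k\<in>UNIV. \<Sum>l\<in>UNIV. M $ k $ i * M $ l $ j * gram g c' (h p) $ k $ l)"
      unfolding gram_expand[OF c(2) p(2)] by (simp add: M_def matrix_def)
    also have "\<dots> = (\<Sum>l\<in>UNIV. \<Sum>k\<in>UNIV. M $ k $ i * M $ l $ j * gram g c' (h p) $ k $ l)"
      by (rule sum.swap)
    also have "\<dots> = (transpose M ** gram g c' (h p) ** M) $ i $ j"
      by (simp add: matrix_matrix_mult_def transpose_def sum_distrib_right sum_distrib_left mult_ac)
    finally show ?thesis .
  qed
  then show ?thesis by (simp add: vec_eq_iff)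
qed

text \<open>The determinants of the Gram matrices at \<open>p\<close> and \<open>h p\<close> differ by the square of the Jacobian
  of \<open>h\<close>, as the change of variables formula requires. The case of the identity says that the volume
  does not depend on the chart.\<close>

lemma chart_volume_isometry:
  assumes h: "isometry A g h" and c: "c \<in> A" "c' \<in> A"
    and B: "B \<in> sets borel" "B \<subseteq> cdom c" "h ` B \<subseteq> cdom c'" and hB: "h ` B \<in> sets borel"
  shows "chart_volume c' (h ` B) = chart_volume c B"
proof -
  define S where "S = cmap c ` B"
  let ?F = "coord_map c c' h"
  let ?F' = "\<lambda>x. coord_deriv c c' h (cinv c x)"
  have S: "S \<in> sets borel" unfolding S_def by (rule cmap_image_borel[OF c(1) B(1,2)])
  have pt: "cinv c x \<in> B" "cmap c (cinv c x) = x" if "x \<in> S" for x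
    using that c(1) B(2) by (auto simp: S_def)
  have dom: "cinv c x \<in> cdom c" "h (cinv c x) \<in> cdom c'" if "x \<in> S" for x
    using pt[OF that] B by auto
  have FS: "?F ` S = cmap c' ` h ` B"
    unfolding S_def image_image using c(1) B(2) by (intro image_cong) (auto simp: coord_map_def)
  have der: "(?F has_derivative ?F' x) (at x within S)" if x: "x \<in> S" for x
    using coord_map_derivative[OF isometryD(2)[OF h] c dom[OF x]] pt(2)[OF x]
    by (simp add: has_derivative_at_withinI)
  have inj: "inj_on ?F S"
  proof (rule inj_onI)
    fix x y assume xy: "x \<in> S" "y \<in> S" "?F x = ?F y"
    then have "cmap c' (h (cinv c x)) = cmap c' (h (cinv c y))" by (simp add: coord_map_def)
    then have "h (cinv c x) = h (cinv c y)"
      using cinv_cmap[OF c(2) dom(2)[OF xy(1)]] cinv_cmap[OF c(2) dom(2)[OF xy(2)]] by metis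
    then have "cinv c x = cinv c y" using isometryD(1)[OF h] by (simp add: bij_is_inj inj_eq)
    then show "x = y" using pt(2) xy by metis
  qed
  have jac: "\<bar>det (matrix (?F' x))\<bar> * density c' (?F x) = density c x" if x: "x \<in> S" for x
  proof -
    let ?p = "cinv c x"
    have "density c x = sqrt ((det (matrix (?F' x)))\<^sup>2 * det (gram g c' (h ?p)))"
      unfolding density_def gram_transform[OF h c dom[OF x]] det_mul det_transpose
      by (simp add: power2_eq_square mult_ac)
    also have "\<dots> = \<bar>det (matrix (?F' x))\<bar> * sqrt (det (gram g c' (h ?p)))"
      by (simp add: real_sqrt_mult)
    also have "sqrt (det (gram g c' (h ?p))) = density c' (?F x)"
      using cinv_cmap[OF c(2) dom(2)[OF x]] by (simp add: density_def coord_map_def)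
    finally show ?thesis ..
  qed
  have FSb: "?F ` S \<in> sets borel" "?F ` S \<subseteq> cmap c' ` cdom c'"
    unfolding FS using cmap_image_borel[OF c(2) hB B(3)] B(3) by auto
  have "chart_volume c' (h ` B) = (\<integral>\<^sup>+y\<in>?F ` S. ennreal (density c' y) \<partial>lborel)"
    by (simp add: chart_volume_def FS)
  also have "\<dots> = (\<integral>\<^sup>+x\<in>S. ennreal (\<bar>det (matrix (?F' x))\<bar> * density c' (?F x)) \<partial>lborel)"
  proof (rule nn_integral_change_of_variables[OF S der inj])
    show "0 \<le> density c' y" if "y \<in> ?F ` S" for y
      using density_pos[OF c(2)] FSb(2) that by (meson less_imp_le subsetD)
    show "(\<lambda>y. indicator (?F ` S) y * density c' y) \<in> borel_measurable borel"
      by (rule density_measurable[OF c(2) FSb])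
    have "(\<lambda>x. indicator S x * density c x) \<in> borel_measurable borel"
      by (rule density_measurable[OF c(1) S]) (use B(2) in \<open>auto simp: S_def\<close>)
    also have "(\<lambda>x. indicator S x * density c x)
        = (\<lambda>x. indicator S x * (\<bar>det (matrix (?F' x))\<bar> * density c' (?F x)))"
      using jac by (auto simp: fun_eq_iff indicator_def)
    finally show "(\<lambda>x. indicator S x * (\<bar>det (matrix (?F' x))\<bar> * density c' (?F x))) \<in> borel_measurable borel" .
  qed
  also have "\<dots> = chart_volume c B"
    unfolding chart_volume_def S_def[symmetric]
    by (rule nn_integral_cong) (use jac in \<open>auto simp: indicator_def\<close>)
  finally show ?thesis .
qed

text \<open>The building block of the Riemannian measure: the volume in one chart, restricted to a piece of
  the chart and considered as a measure on the manifold.\<close>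

lemma exists_chart_measure:
  assumes c: "c \<in> A" and P: "P \<in> sets borel" "P \<subseteq> cdom c"
  shows "\<exists>N. sets N = sets borel \<and> (\<forall>B\<in>sets borel. emeasure N B = chart_volume c (B \<inter> P))"
proof -
  let ?I = "cmap c ` cdom c"
  define \<psi> where "\<psi> x = (if x \<in> ?I then cinv c x else undefined)" for x
  define w where "w x = ennreal (indicator (cmap c ` P) x * density c x)" for x
  have P': "cmap c ` P \<in> sets borel" "cmap c ` P \<subseteq> ?I"
    using cmap_image_borel[OF c P] P(2) by auto
  have wm: "w \<in> borel_measurable borel"
    unfolding w_def using density_measurable[OF c P'] by measurable
  have \<psi>m: "\<psi> \<in> borel_measurable borel"
  proof (rule measurableI)
    fix B :: "'a set" assume B: "B \<in> sets borel"
    have I: "?I \<in> sets borel" using chart_image_open[OF c] by simp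
    have "\<psi> -` B = (?I \<inter> cinv c -` B) \<union> (- ?I \<inter> (if undefined \<in> B then UNIV else {}))"
      by (auto simp: \<psi>_def split: if_splits)
    moreover have "?I \<inter> cinv c -` B \<in> sets borel" by (rule borel_vimage_Int[OF continuous_cinv[OF c] I B])
    moreover have "- ?I \<inter> (if undefined \<in> B then UNIV else {}) \<in> sets borel" using I by auto
    ultimately show "\<psi> -` B \<inter> space borel \<in> sets borel" by auto
  qed simp
  define N where "N = distr (Nonnegative_Lebesgue_Integration.density lborel w) borel \<psi>"
  have "emeasure N B = chart_volume c (B \<inter> P)" if B: "B \<in> sets borel" for B
  proof -
    have pre: "\<psi> -` B \<in> sets borel" using measurable_sets[OF \<psi>m B] by simp
    have "emeasure N B = emeasure (Nonnegative_Lebesgue_Integration.density lborel w) (\<psi> -` B)"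
      unfolding N_def using \<psi>m B by (subst emeasure_distr) auto
    also have "\<dots> = (\<integral>\<^sup>+x. w x * indicator (\<psi> -` B) x \<partial>lborel)"
      using wm pre by (intro emeasure_density) auto
    also have "\<dots> = chart_volume c (B \<inter> P)"
      unfolding chart_volume_def
    proof (rule nn_integral_cong)
      fix x
      have "x \<in> cmap c ` (B \<inter> P) \<longleftrightarrow> x \<in> cmap c ` P \<and> \<psi> x \<in> B"
        using P(2) c by (auto simp: \<psi>_def subset_eq)
      then show "w x * indicator (\<psi> -` B) x = ennreal (density c x) * indicator (cmap c ` (B \<inter> P)) x"
        by (auto simp: w_def indicator_def)
    qed
    finally show ?thesis .
  qed
  moreover have "sets N = sets borel" by (simp add: N_def)
  ultimately show ?thesis by blast
qed

end

lemma emeasure_finite_partition: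
  assumes M: "sets M = sets borel" and I: "finite I" and Q: "\<And>i. i \<in> I \<Longrightarrow> Q i \<in> sets borel"
    and disj: "disjoint_family_on Q I" and cover: "(\<Union>i\<in>I. Q i) = UNIV" and B: "B \<in> sets borel"
  shows "emeasure M B = (\<Sum>i\<in>I. emeasure M (B \<inter> Q i))"
proof -
  have "(\<Sum>i\<in>I. emeasure M (B \<inter> Q i)) = emeasure M (\<Union>i\<in>I. B \<inter> Q i)"
  proof (rule sum_emeasure)
    show "(\<lambda>i. B \<inter> Q i) ` I \<subseteq> sets M" unfolding M using Q B by auto
    show "disjoint_family_on (\<lambda>i. B \<inter> Q i) I" using disj by (auto simp: disjoint_family_on_def)
  qed (rule I)
  also have "(\<Union>i\<in>I. B \<inter> Q i) = B" using cover by blast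
  finally show ?thesis by simp
qed

context compact_riemannian_manifold
begin

text \<open>Remove from each chart domain of a finite cover the earlier ones.\<close>

lemma finite_borel_partition:
  "\<exists>I P. finite I \<and> I \<subseteq> A \<and> (\<forall>c\<in>I. P c \<in> sets borel \<and> P c \<subseteq> cdom c) \<and>
     disjoint_family_on P I \<and> (\<Union>c\<in>I. P c) = UNIV"
proof -
  have step: "\<exists>P. (\<forall>c\<in>I. P c \<in> sets borel \<and> P c \<subseteq> cdom c) \<and> disjoint_family_on P I \<and> (\<Union>c\<in>I. P c) = (\<Union>c\<in>I. cdom c)"
    if "finite I" "I \<subseteq> A" for I
    using that
  proof (induction rule: finite_induct)
    case empty
    show ?case by (simp add: disjoint_family_on_def)
  next
    case (insert c I)
    then obtain P where P: "\<forall>c\<in>I. P c \<in> sets borel \<and> P c \<subseteq> cdom c" "disjoint_family_on P I"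
        "(\<Union>c\<in>I. P c) = (\<Union>c\<in>I. cdom c)" by auto
    define P' where "P' = P(c := cdom c - (\<Union>c\<in>I. cdom c))"
    have old: "P' e = P e" if "e \<in> I" for e using that insert(2) by (auto simp: P'_def)
    have new: "P' c = cdom c - (\<Union>c\<in>I. cdom c)" by (simp add: P'_def)
    have opn: "open (cdom e)" if "e \<in> insert c I" for e using that insert chart_open by blast
    have "open (\<Union>c\<in>I. cdom c)" using opn by (intro open_UN) auto
    then have Pc: "P' c \<in> sets borel" unfolding new using opn[of c] by (intro sets.Diff) auto
    have "\<forall>e\<in>insert c I. P' e \<in> sets borel \<and> P' e \<subseteq> cdom e"
      using P(1) old Pc new by auto
    moreover have "disjoint_family_on P' (insert c I)"
    proof -
      have "P' e \<inter> P' c = {}" if "e \<in> I" for e using old[OF that] P(1) that new by blast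
      moreover have "disjoint_family_on P' I" using P(2) old by (simp add: disjoint_family_on_def)
      ultimately show ?thesis
        using insert(2) by (subst disjoint_family_on_insert) (blast, simp add: Int_commute, blast)
    qed
    moreover have "(\<Union>e\<in>insert c I. P' e) = (\<Union>e\<in>insert c I. cdom e)"
    proof -
      have "(\<Union>e\<in>insert c I. P' e) = P' c \<union> (\<Union>e\<in>I. P e)" using old by auto
      then show ?thesis unfolding P(3) new by auto
    qed
    ultimately show ?case by blast
  qed
  have "UNIV \<subseteq> (\<Union>c\<in>A. cdom c)" using exists_chart by blast
  then obtain I where I: "I \<subseteq> A" "finite I" "UNIV \<subseteq> (\<Union>c\<in>I. cdom c)"
    using compactE_image[OF compact_UNIV, of A cdom] chart_open by metis
  have "(\<Union>c\<in>I. cdom c) = UNIV" using I(3) by blast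
  with step[OF I(2,1)] I(1,2) show ?thesis by (intro exI[of _ I]) simp
qed

text \<open>The condition that defines the Riemannian measure.\<close>

definition has_volume_density :: "'a measure \<Rightarrow> bool" where
  "has_volume_density \<mu> \<longleftrightarrow> sets \<mu> = sets borel \<and>
     (\<forall>c\<in>A. \<forall>B\<in>sets borel. B \<subseteq> cdom c \<longrightarrow> emeasure \<mu> B = chart_volume c B)"

lemma chart_volume_finite_partition:
  assumes c: "c \<in> A" and B: "B \<in> sets borel" "B \<subseteq> cdom c" and I: "finite I"
    and Q: "\<And>i. i \<in> I \<Longrightarrow> Q i \<in> sets borel" "disjoint_family_on Q I" "(\<Union>i\<in>I. Q i) = UNIV"
  shows "chart_volume c B = (\<Sum>i\<in>I. chart_volume c (B \<inter> Q i))"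
proof -
  have "cdom c \<in> sets borel" using chart_open[OF c] by simp
  from exists_chart_measure[OF c this order_refl] obtain N
    where N: "sets N = sets borel" "\<And>B. B \<in> sets borel \<Longrightarrow> emeasure N B = chart_volume c (B \<inter> cdom c)"
    by blast
  have eq: "emeasure N (B \<inter> X) = chart_volume c (B \<inter> X)" if "X \<in> sets borel" for X
  proof -
    have "B \<inter> X \<inter> cdom c = B \<inter> X" using B(2) by blast
    then show ?thesis using N(2)[of "B \<inter> X"] B(1) that by simp
  qed
  show ?thesis
    using emeasure_finite_partition[OF N(1) I Q B(1)] eq[of UNIV] eq Q(1) by simp
qed

text \<open>Cut the manifold into finitely many Borel pieces inside charts and add up the volumes of the
  pieces.\<close>

lemma has_volume_density_exists: "\<exists>\<mu>. has_volume_density \<mu>"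
proof -
  obtain I P where I: "finite I" "I \<subseteq> A" and P: "\<And>c. c \<in> I \<Longrightarrow> P c \<in> sets borel" "\<And>c. c \<in> I \<Longrightarrow> P c \<subseteq> cdom c"
    and part: "disjoint_family_on P I" "(\<Union>c\<in>I. P c) = UNIV"
    using finite_borel_partition by blast
  have "\<forall>c\<in>I. \<exists>N. sets N = sets borel \<and> (\<forall>B\<in>sets borel. emeasure N B = chart_volume c (B \<inter> P c))"
    using exists_chart_measure P I(2) by blast
  then obtain N where N: "\<And>c. c \<in> I \<Longrightarrow> sets (N c) = sets borel"
      "\<And>c B. c \<in> I \<Longrightarrow> B \<in> sets borel \<Longrightarrow> emeasure (N c) B = chart_volume c (B \<inter> P c)"
    using bchoice[of I "\<lambda>c N. sets N = sets borel \<and> (\<forall>B\<in>sets borel. emeasure N B = chart_volume c (B \<inter> P c))"]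
    by blast
  define m where "m B = (\<Sum>c\<in>I. emeasure (N c) B)" for B
  define \<mu> where "\<mu> = measure_of UNIV (sets borel) m"
  have sets: "sets \<mu> = sets borel"
    unfolding \<mu>_def using sets.sigma_sets_eq[of "borel :: 'a measure"] by simp
  have em: "emeasure \<mu> B = m B" if B: "B \<in> sets borel" for B
  proof (rule emeasure_measure_of[OF \<mu>_def])
    show "positive (sets \<mu>) m" by (simp add: positive_def m_def)
    show "countably_additive (sets \<mu>) m"
    proof (rule countably_additiveI)
      fix X :: "nat \<Rightarrow> 'a set" assume X: "range X \<subseteq> sets \<mu>" "disjoint_family X"
      have "(\<Sum>n. m (X n)) = (\<Sum>c\<in>I. \<Sum>n. emeasure (N c) (X n))"
        unfolding m_def by (rule suminf_sum) simp
      also have "\<dots> = m (\<Union>n. X n)"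
        unfolding m_def using X N(1) sets by (intro sum.cong refl suminf_emeasure) auto
      finally show "(\<Sum>n. m (X n)) = m (\<Union>n. X n)" .
    qed
  qed (use B sets in auto)
  have "emeasure \<mu> B = chart_volume c B" if c: "c \<in> A" and B: "B \<in> sets borel" "B \<subseteq> cdom c" for c B
  proof -
    have "emeasure \<mu> B = (\<Sum>i\<in>I. chart_volume i (B \<inter> P i))"
      unfolding em[OF B(1)] m_def by (rule sum.cong) (simp_all add: N(2) B(1))
    also have "\<dots> = (\<Sum>i\<in>I. chart_volume c (B \<inter> P i))"
    proof (rule sum.cong[OF refl])
      fix i assume i: "i \<in> I"
      have "i \<in> A" "B \<inter> P i \<in> sets borel" "B \<inter> P i \<subseteq> cdom c" "B \<inter> P i \<subseteq> cdom i"
        using i I(2) P[OF i] B by auto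
      then have "chart_volume i (id ` (B \<inter> P i)) = chart_volume c (B \<inter> P i)"
        by (intro chart_volume_isometry[OF isometry_id c]) simp_all
      then show "chart_volume i (B \<inter> P i) = chart_volume c (B \<inter> P i)" by simp
    qed
    also have "\<dots> = chart_volume c B"
      by (rule chart_volume_finite_partition[OF c B I(1) P(1) part, symmetric])
    finally show ?thesis .
  qed
  with sets show ?thesis unfolding has_volume_density_def by blast
qed

lemma has_volume_density_unique:
  assumes \<mu>: "has_volume_density \<mu>" and \<nu>: "has_volume_density \<nu>"
  shows "\<mu> = \<nu>"
proof (rule measure_eqI)
  obtain I P where I: "finite I" "I \<subseteq> A" and P: "\<And>c. c \<in> I \<Longrightarrow> P c \<in> sets borel" "\<And>c. c \<in> I \<Longrightarrow> P c \<subseteq> cdom c"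
    and part: "disjoint_family_on P I" "(\<Union>c\<in>I. P c) = UNIV"
    using finite_borel_partition by blast
  have s: "sets \<mu> = sets borel" "sets \<nu> = sets borel" using \<mu> \<nu> by (auto simp: has_volume_density_def)
  show "sets \<mu> = sets \<nu>" using s by simp
  fix B assume "B \<in> sets \<mu>"
  then have B: "B \<in> sets borel" using s by simp
  have "emeasure \<mu> (B \<inter> P i) = emeasure \<nu> (B \<inter> P i)" if i: "i \<in> I" for i
  proof -
    have "B \<inter> P i \<in> sets borel" "B \<inter> P i \<subseteq> cdom i" "i \<in> A" using P[OF i] i I(2) B by auto
    then show ?thesis using \<mu> \<nu> by (simp add: has_volume_density_def)
  qed
  then show "emeasure \<mu> B = emeasure \<nu> B"
    using emeasure_finite_partition[OF s(1) I(1) P(1) part B] emeasure_finite_partition[OF s(2) I(1) P(1) part B]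
    by simp
qed

abbreviation vol :: "'a measure" where
  "vol \<equiv> riem_measure A g"

lemma vol_has_volume_density: "has_volume_density vol"
proof -
  have eq: "vol = (THE \<mu>. has_volume_density \<mu>)"
    unfolding riem_measure_def has_volume_density_def chart_volume_def density_def ..
  show ?thesis
    unfolding eq by (rule theI'[OF ex_ex1I[OF has_volume_density_exists has_volume_density_unique]])
qed

lemma sets_vol: "sets vol = sets borel"
  using vol_has_volume_density by (simp add: has_volume_density_def)

lemma emeasure_vol: "c \<in> A \<Longrightarrow> B \<in> sets borel \<Longrightarrow> B \<subseteq> cdom c \<Longrightarrow> emeasure vol B = chart_volume c B"
  using vol_has_volume_density by (simp add: has_volume_density_def)

lemma isometry_continuous: "isometry A g h \<Longrightarrow> continuous_on UNIV h"
  using isometryD(2) by (auto simp: smooth_map_def)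

lemma isometry_inv_continuous: "isometry A g h \<Longrightarrow> continuous_on UNIV (inv h)"
  using isometryD(3) by (auto simp: smooth_map_def)

lemma isometry_vimage:
  assumes "isometry A g h" shows "inv h -` B = h ` B"
  using isometryD(1)[OF assms] by (metis bij_vimage_eq_inv_image bij_imp_bij_inv inv_inv_eq)

lemma isometry_borel:
  assumes h: "isometry A g h" and B: "B \<in> sets borel"
  shows "h -` B \<in> sets borel" "h ` B \<in> sets borel"
  using borel_vimage_Int[OF isometry_continuous[OF h] _ B] borel_vimage_Int[OF isometry_inv_continuous[OF h] _ B]
    isometry_vimage[OF h, of B] by simp_all

text \<open>The image of the measure under the inverse isometry has the same density in all charts, since
  isometries preserve chart volumes. Uniqueness identifies it with the measure.\<close>

lemma vol_distr_isometry:
  assumes h: "isometry A g h"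
  shows "distr vol borel h = vol"
proof -
  obtain I P where I: "finite I" "I \<subseteq> A" and P: "\<And>c. c \<in> I \<Longrightarrow> P c \<in> sets borel" "\<And>c. c \<in> I \<Longrightarrow> P c \<subseteq> cdom c"
    and part: "disjoint_family_on P I" "(\<Union>c\<in>I. P c) = UNIV"
    using finite_borel_partition by blast
  have hm: "h \<in> measurable borel borel" "inv h \<in> measurable borel borel"
    using isometry_continuous[OF h] isometry_inv_continuous[OF h] by (auto intro: borel_measurable_continuous_onI)
  have hmv: "inv h \<in> measurable vol borel"
    using hm(2) sets_vol by (simp cong: measurable_cong_sets)
  have inj: "inj h" and surj: "surj h" using isometryD(1)[OF h] by (auto simp: bij_def)
  have part': "disjoint_family_on (\<lambda>i. h -` P i) I" "(\<Union>i\<in>I. h -` P i) = UNIV"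
  proof -
    show "disjoint_family_on (\<lambda>i. h -` P i) I"
      using part(1) by (simp add: disjoint_family_on_def vimage_Int[symmetric])
    show "(\<Union>i\<in>I. h -` P i) = UNIV" using part(2) by (simp add: vimage_UN[symmetric])
  qed
  have "has_volume_density (distr vol borel (inv h))"
    unfolding has_volume_density_def
  proof (intro conjI ballI impI)
    fix c B assume c: "c \<in> A" and B: "B \<in> sets borel" "B \<subseteq> cdom c"
    have "emeasure (distr vol borel (inv h)) B = emeasure vol (h ` B)"
      using emeasure_distr[OF hmv B(1)] isometry_vimage[OF h] sets_eq_imp_space_eq[OF sets_vol] by simp
    also have "\<dots> = (\<Sum>i\<in>I. emeasure vol (h ` B \<inter> P i))"
      by (rule emeasure_finite_partition[OF sets_vol I(1) P(1) part isometry_borel(2)[OF h B(1)]])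
    also have "\<dots> = (\<Sum>i\<in>I. chart_volume c (B \<inter> h -` P i))"
    proof (rule sum.cong[OF refl])
      fix i assume i: "i \<in> I"
      have eq: "h ` B \<inter> P i = h ` (B \<inter> h -` P i)" by blast
      have Bi: "B \<inter> h -` P i \<in> sets borel" using B(1) isometry_borel(1)[OF h P(1)[OF i]] by simp
      have hBi: "h ` (B \<inter> h -` P i) \<in> sets borel" "h ` (B \<inter> h -` P i) \<subseteq> cdom i"
        using isometry_borel(2)[OF h Bi] P(2)[OF i] by auto
      have "emeasure vol (h ` B \<inter> P i) = chart_volume i (h ` (B \<inter> h -` P i))"
        unfolding eq by (rule emeasure_vol[OF _ hBi]) (use i I(2) in blast)
      also have "\<dots> = chart_volume c (B \<inter> h -` P i)"
        by (rule chart_volume_isometry[OF h c _ Bi _ hBi(2,1)]) (use i I(2) B(2) in auto)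
      finally show "emeasure vol (h ` B \<inter> P i) = chart_volume c (B \<inter> h -` P i)" .
    qed
    also have "\<dots> = chart_volume c B"
      by (rule chart_volume_finite_partition[OF c B I(1) _ part', symmetric]) (use P(1) isometry_borel(1)[OF h] in blast)
    finally show "emeasure (distr vol borel (inv h)) B = chart_volume c B" .
  qed simp
  then have inv: "distr vol borel (inv h) = vol"
    by (rule has_volume_density_unique[OF _ vol_has_volume_density])
  have "distr vol borel h = distr (distr vol borel (inv h)) borel h" by (simp add: inv)
  also have "\<dots> = distr vol borel (h \<circ> inv h)" by (rule distr_distr[OF hm(1) hmv])
  also have "h \<circ> inv h = (\<lambda>x. x)" using surj_f_inv_f[OF surj] by (simp add: fun_eq_iff)
  also have "distr vol borel (\<lambda>x. x) = vol" by (rule distr_id2[OF sets_vol[symmetric]])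
  finally show ?thesis .
qed

lemma chart_ball_borel:
  assumes "c \<in> A" "ball x r \<subseteq> cmap c ` cdom c"
  shows "cinv c ` ball x r \<in> sets borel" "cinv c ` ball x r \<subseteq> cdom c" "cmap c ` cinv c ` ball x r = ball x r"
proof -
  show "cinv c ` ball x r \<in> sets borel" using cinv_image_open[OF assms(1) open_ball assms(2)] by simp
  show "cinv c ` ball x r \<subseteq> cdom c" using cinv_mem[OF assms(1)] assms(2) by blast
  have "cmap c ` cinv c ` ball x r = (\<lambda>y. y) ` ball x r"
    unfolding image_image by (rule image_cong[OF refl]) (use assms in auto)
  then show "cmap c ` cinv c ` ball x r = ball x r" by simp
qed

lemma emeasure_chart_ball:
  assumes "c \<in> A" "ball x r \<subseteq> cmap c ` cdom c"
  shows "emeasure vol (cinv c ` ball x r) = (\<integral>\<^sup>+y\<in>ball x r. ennreal (density c y) \<partial>lborel)"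
  using emeasure_vol[OF assms(1) chart_ball_borel(1,2)[OF assms]] chart_ball_borel(3)[OF assms]
  by (simp add: chart_volume_def)

text \<open>A coordinate ball with compact closure in the chart has finite volume, and finitely many such
  balls cover the manifold.\<close>

lemma vol_finite: "emeasure vol UNIV < \<infinity>"
proof -
  have "\<exists>U. open U \<and> p \<in> U \<and> emeasure vol U < \<infinity>" for p
  proof -
    obtain c where c: "c \<in> A" "p \<in> cdom c" using exists_chart by blast
    obtain r where r: "r > 0" "cball (cmap c p) r \<subseteq> cmap c ` cdom c"
      using chart_image_open[OF c(1)] c(2) open_contains_cball_eq by (metis image_eqI)
    let ?B = "ball (cmap c p) r"
    have B: "?B \<subseteq> cmap c ` cdom c" using r(2) ball_subset_cball by blast
    have "compact (density c ` cball (cmap c p) r)"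
      by (intro compact_continuous_image continuous_on_subset[OF density_continuous[OF c(1)] r(2)] compact_cball)
    then obtain C where C: "\<And>y. y \<in> cball (cmap c p) r \<Longrightarrow> norm (density c y) \<le> C"
      using compact_imp_bounded bounded_iff by (metis image_eqI)
    have "emeasure vol (cinv c ` ?B) = (\<integral>\<^sup>+y\<in>?B. ennreal (density c y) \<partial>lborel)"
      by (rule emeasure_chart_ball[OF c(1) B])
    also have "\<dots> \<le> (\<integral>\<^sup>+y. ennreal C * indicator ?B y \<partial>lborel)"
    proof (rule nn_integral_mono)
      fix y
      have "density c y \<le> C" if "y \<in> ?B" using C[of y] that by simp
      then show "ennreal (density c y) * indicator ?B y \<le> ennreal C * indicator ?B y"
        by (auto simp: indicator_def intro: ennreal_leI)
    qed
    also have "\<dots> = ennreal C * emeasure lborel ?B" by (rule nn_integral_cmult_indicator) simp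
    also have "\<dots> < \<infinity>"
      using emeasure_bounded_finite[of ?B] by (simp add: ennreal_mult_less_top)
    finally have "emeasure vol (cinv c ` ?B) < \<infinity>" .
    moreover have "open (cinv c ` ?B)" by (rule cinv_image_open[OF c(1) open_ball B])
    moreover have "p \<in> cinv c ` ?B" using c r(1) by (intro image_eqI[of _ _ "cmap c p"]) auto
    ultimately show ?thesis by blast
  qed
  then obtain U where U: "\<And>p. open (U p)" "\<And>p. p \<in> U p" "\<And>p. emeasure vol (U p) < \<infinity>" by metis
  obtain F where F: "finite F" "UNIV \<subseteq> (\<Union>p\<in>F. U p)"
  proof (rule compactE_image[OF compact_UNIV, of UNIV U])
    show "UNIV \<subseteq> (\<Union>p. U p)" using U(2) by blast
  qed (use U(1) in simp_all)
  have "emeasure vol UNIV \<le> emeasure vol (\<Union>p\<in>F. U p)"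
    by (rule emeasure_mono[OF F(2)]) (simp add: sets_vol U(1) borel_open open_UN)
  also have "\<dots> \<le> (\<Sum>p\<in>F. emeasure vol (U p))"
    by (rule emeasure_subadditive_finite[OF F(1)]) (auto simp: sets_vol U(1))
  also have "\<dots> < \<infinity>" using F(1) U(3) by (simp add: ennreal_sum_less_top less_top)
  finally show ?thesis .
qed

text \<open>The ball of radius \<open>r\<close> contains the coordinate ball of radius \<open>r / K\<close>, on which the density
  is bounded below.\<close>

lemma vol_lower_bound: "\<exists>C>0. \<exists>n. \<exists>r0>0. \<exists>x. \<forall>r. 0 < r \<and> r < r0 \<longrightarrow> C * r ^ n \<le> measure vol {y. d x y < r}"
proof -
  fix p :: 'a
  obtain c where c: "c \<in> A" "p \<in> cdom c" using exists_chart by blast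
  let ?x = "cmap c p" and ?n = "DIM((real, 'n) vec)"
  have x: "?x \<in> cmap c ` cdom c" using c by blast
  obtain \<rho> k K where \<rho>: "\<rho> > 0" "K > 0" "cball ?x \<rho> \<subseteq> cmap c ` cdom c"
    and bd: "\<forall>x\<in>cball ?x \<rho>. \<forall>v. k * norm v \<le> sqrt (g c (cinv c x) v v) \<and> sqrt (g c (cinv c x) v v) \<le> K * norm v"
    using metric_bounds[OF c(1) x] by blast
  have K: "sqrt (g c (cinv c x) v v) \<le> K * norm v" if "x \<in> cball ?x \<rho>" for x v using bd that by blast
  have "continuous_on (cball ?x \<rho>) (density c)" by (rule continuous_on_subset[OF density_continuous[OF c(1)] \<rho>(3)])
  then obtain z where z: "z \<in> cball ?x \<rho>" "\<And>y. y \<in> cball ?x \<rho> \<Longrightarrow> density c z \<le> density c y"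
    using continuous_attains_inf[OF compact_cball, of ?x \<rho> "density c"] \<rho>(1) by auto
  define m where "m = density c z"
  have m: "0 < m" unfolding m_def by (rule density_pos[OF c(1)]) (use z(1) \<rho>(3) in blast)
  define b where "b = measure lborel (ball (0 :: (real, 'n) vec) 1)"
  have b: "0 < b" unfolding b_def by (rule content_ball_pos) simp
  have "m * b / K ^ ?n * r ^ ?n \<le> measure vol {y. d p y < r}" if r: "0 < r" "r < K * \<rho>" for r
  proof -
    let ?B = "ball ?x (r / K)"
    have rK: "0 < r / K" "r / K < \<rho>" using r \<rho>(2) by (simp_all add: field_simps)
    have B: "?B \<subseteq> ball ?x \<rho>" "?B \<subseteq> cball ?x \<rho>" using rK by auto
    have \<rho>b: "ball ?x \<rho> \<subseteq> cmap c ` cdom c" using \<rho>(3) ball_subset_cball by blast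
    have B': "?B \<subseteq> cmap c ` cdom c" using B(2) \<rho>(3) by blast
    have sub: "cinv c ` ?B \<subseteq> {y. d p y < r}"
    proof (rule image_subsetI, rule CollectI)
      fix y assume y: "y \<in> ?B"
      have "ext_dist (cinv c ?x) (cinv c y) \<le> ennreal (K * dist ?x y)"
        by (rule ext_dist_upper[OF c(1) \<rho>b \<rho>(2)]) (use K B y \<rho>(1) in auto)
      then have "d p (cinv c y) \<le> K * dist ?x y" using c \<rho>(2) by (simp add: d_le_iff)
      also have "\<dots> < r" using y \<rho>(2) by (simp add: field_simps)
      finally show "d p (cinv c y) < r" .
    qed
    have bm: "{y. d p y < r} \<in> sets borel"
    proof -
      have "continuous_on UNIV (\<lambda>y. d p y)"
      proof -
        have "continuous_on UNIV (\<lambda>y. (p, y))" by (intro continuous_intros)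
        then show ?thesis using continuous_on_compose2[OF d_continuous, of UNIV "\<lambda>y. (p, y)"] by simp
      qed
      then show ?thesis by (intro borel_open open_Collect_less continuous_on_const)
    qed
    have "ennreal (m * measure lborel ?B) = ennreal m * emeasure lborel ?B"
      using m emeasure_bounded_finite[of ?B] by (simp add: ennreal_mult emeasure_eq_ennreal_measure)
    also have "\<dots> = (\<integral>\<^sup>+y. ennreal m * indicator ?B y \<partial>lborel)" by (rule nn_integral_cmult_indicator[symmetric]) simp
    also have "\<dots> \<le> (\<integral>\<^sup>+y\<in>?B. ennreal (density c y) \<partial>lborel)"
    proof (rule nn_integral_mono)
      fix y
      have "m \<le> density c y" if "y \<in> ?B" unfolding m_def by (rule z(2)) (use that B in blast)
      then show "ennreal m * indicator ?B y \<le> ennreal (density c y) * indicator ?B y"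
        by (auto simp: indicator_def intro: ennreal_leI)
    qed
    also have "\<dots> = emeasure vol (cinv c ` ?B)" by (rule emeasure_chart_ball[OF c(1) B', symmetric])
    also have "\<dots> \<le> emeasure vol {y. d p y < r}" by (rule emeasure_mono[OF sub]) (simp add: sets_vol bm)
    also have "\<dots> = ennreal (measure vol {y. d p y < r})"
    proof (rule emeasure_eq_ennreal_measure)
      have "emeasure vol {y. d p y < r} \<le> emeasure vol UNIV" by (rule emeasure_mono) (auto simp: sets_vol)
      then show "emeasure vol {y. d p y < r} \<noteq> top" using vol_finite by (auto simp: top_unique)
    qed
    finally have "m * measure lborel ?B \<le> measure vol {y. d p y < r}" by (simp add: ennreal_le_iff)
    moreover have "measure lborel ?B = (r / K) ^ ?n * b"
      unfolding b_def by (rule content_ball_conv_unit_ball) (use rK in simp)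
    ultimately show ?thesis by (simp add: power_divide field_simps)
  qed
  moreover have "0 < m * b / K ^ ?n" "0 < K * \<rho>" using m b \<rho> by simp_all
  ultimately show ?thesis by blast
qed


section \<open>Geodesic balls and the Pompeiu property\<close>

lemma isometry_ball:
  assumes "isometry A g h"
  shows "h ` geodesic_ball A g y t = {x. d (h y) x < t}"
proof (intro equalityI subsetI)
  fix x assume "x \<in> h ` geodesic_ball A g y t"
  then obtain z where "x = h z" "d z y < t" by (auto simp: geodesic_ball_def)
  then show "x \<in> {x. d (h y) x < t}" using d_isometry[OF assms, of z y] by (simp add: d_commute)
next
  fix x assume x: "x \<in> {x. d (h y) x < t}"
  obtain z where z: "x = h z" using isometryD(1)[OF assms] by (metis bij_pointE)
  have "d z y < t" using x d_isometry[OF assms, of z y] by (simp add: z d_commute)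
  then show "x \<in> h ` geodesic_ball A g y t" by (auto simp: z geodesic_ball_def)
qed

lemma pompeiu_property_geodesic_ball_iff:
  assumes trans: "\<And>p q. \<exists>h. isometry A g h \<and> h p = q"
  shows "pompeiu_property A g (geodesic_ball A g y t) \<longleftrightarrow>
    (\<forall>f. continuous_on UNIV f \<longrightarrow> (\<forall>x. (\<integral>z. indicator {z. d x z < t} z * f z \<partial>vol) = 0) \<longrightarrow> (\<forall>x. f x = (0 :: real)))"
proof -
  have "(\<forall>h. isometry A g h \<longrightarrow> (LINT x:h ` geodesic_ball A g y t|vol. f x) = 0) \<longleftrightarrow>
      (\<forall>x. (\<integral>z. indicator {z. d x z < t} z * f z \<partial>vol) = 0)" for f :: "'a \<Rightarrow> real"
  proof -
    have "(LINT x:h ` geodesic_ball A g y t|vol. f x) = (\<integral>z. indicator {z. d (h y) z < t} z * f z \<partial>vol)"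
      if "isometry A g h" for h
      unfolding isometry_ball[OF that] set_lebesgue_integral_def by simp
    then show ?thesis using trans[of y] by metis
  qed
  then show ?thesis unfolding pompeiu_property_def by simp
qed

lemma homogeneous_metric_measure_riemannian:
  assumes "\<And>p q p' q'. d p q = d p' q' \<Longrightarrow> \<exists>h. isometry A g h \<and> h p = p' \<and> h q = q'"
  shows "homogeneous_metric_measure d vol {h. isometry A g h}"
proof
  show "d x z \<le> d x y + d y z" for x y z by (rule d_triangle)
  show "\<exists>c>0. \<exists>n. \<exists>r0>0. \<exists>x. \<forall>r. 0 < r \<and> r < r0 \<longrightarrow> c * r ^ n \<le> measure vol {y. d x y < r}"
    by (rule vol_lower_bound)
  show "\<exists>\<gamma>. \<gamma> 0 = x \<and> \<gamma> (d x y) = y \<and> (\<forall>s\<in>{0..d x y}. \<forall>t\<in>{0..d x y}. d (\<gamma> s) (\<gamma> t) = \<bar>s - t\<bar>)" for x y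
    by (rule exists_geodesic)
  show "\<exists>h\<in>{h. isometry A g h}. h x = x' \<and> h y = y'" if "d x y = d x' y'" for x y x' y'
    using assms[OF that] by blast
qed (use compact_UNIV d_continuous d_eq_0 d_commute sets_vol vol_finite isometry_continuous
    vol_distr_isometry d_isometry in simp_all)

end

theorem theorem4:
  fixes A :: "('a::{t2_space,second_countable_topology}, 'n::{finite,wellorder}) chart set"
    and g :: "('a, 'n) metric_tensor"
  assumes "two_point_homogeneous A g"
    and "compact (UNIV :: 'a set)"
  defines "D \<equiv> riem_diameter A g"
  shows "\<exists>S. countable S \<and> S \<subseteq> {0<..<D} \<and> {0<..<D} \<subseteq> closure S \<and>
           (\<forall>t\<in>{0<..<D}. \<forall>y.
              (t \<in> S \<longrightarrow> \<not> pompeiu_property A g (geodesic_ball A g y t)) \<and>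
              (t \<notin> S \<longrightarrow> pompeiu_property A g (geodesic_ball A g y t)))"
proof -
  have two_point: "\<exists>h. isometry A g h \<and> h p = p' \<and> h q = q'" if "riem_dist A g p q = riem_dist A g p' q'" for p q p' q'
    using assms(1) that by (simp add: two_point_homogeneous_def)
  interpret R: compact_riemannian_manifold A g
    by standard (use assms(1,2) in \<open>auto simp: two_point_homogeneous_def connected_riemannian_manifold_def\<close>)
  interpret H: homogeneous_metric_measure "riem_dist A g" "riem_measure A g" "{h. isometry A g h}"
    by (rule R.homogeneous_metric_measure_riemannian[OF two_point])
  have D: "D = H.diam" by (simp add: D_def riem_diameter_def H.diam_def)
  have trans: "\<exists>h. isometry A g h \<and> h p = q" for p q
    using two_point[of p p q q] by (auto simp: R.d_eq_0[THEN iffD2])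
  have "pompeiu_property A g (geodesic_ball A g y t) \<longleftrightarrow> t \<notin> H.exceptional_radii" if "t \<in> {0<..<D}" for t y
    unfolding R.pompeiu_property_geodesic_ball_iff[OF trans] H.exceptional_radii_iff[OF that[unfolded D]] H.T_def
    by blast
  moreover have "H.exceptional_radii \<subseteq> {0<..<D}" unfolding D H.exceptional_radii_def by blast
  ultimately show ?thesis
    using H.countable_exceptional_radii H.exceptional_radii_dense unfolding D
    by (intro exI[of _ H.exceptional_radii]) simp
qed

end
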